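(* Let $Q$ be a finite quiver, let $M\in\mathrm{rep}_{\mathbb{C}}(Q)$ be straight with straightening basis $B$, let $\mathbf{e}\in\mathbb{Z}^{Q_0}$, and let the torus $T_M$ act on $\mathrm{Gr}_{\mathbf{e}}(M)$. Let $U\in\mathrm{Gr}_{\mathbf{e}}(M)^{T_M}$ be a fixed point and let $S\subseteq Q(M,B)$ be its coefficient quiver. Then a basis of the tangent space of $\mathrm{Gr}_{\mathbf e}(M)$ at $U$ is given by the mutations of $S$: identifying the tangent space with $\mathrm{Hom}_Q(U,M/U)$, the homomorphisms $f_m$, where $m:S\to S'$ runs over all mutations starting at $S$, form a basis.
   Context: A quiver $Q$ has vertex set $Q_0$ and arrow set $Q_1$; an arrow $a$ has source $s_a$ and target $t_a$. $\mathrm{rep}_{\mathbb{C}}(Q)$ is the category of finite-dimensional complex representations; $\mathrm{Hom}_Q$ denotes morphisms of representations. $\mathrm{Gr}_{\mathbf e}(M)$ is the closed subvariety of $\prod_{i\in Q_0}\mathrm{Gr}_{e_i}(M^{(i)})$ of all subrepresentations $U\subseteq M$ with $\dim U^{(i)}=e_i$. Its tangent space at $U$ (with respect to the natural scheme structure of the quiver Grassmannian) is isomorphic to $\mathrm{Hom}_Q(U,M/U)$. For an indexed basis $B=\{b^{(i)}_k:i\in Q_0,1\le k\le\dim M^{(i)}\}$ with $b^{(i)}_k\in M^{(i)}$, the coefficient quiver $Q(M,B)$ has vertex set $B$ and an arrow $b^{(i)}_k\to b^{(j)}_\ell$ for each $(a:i\to j)\in Q_1$ such that the coefficient of $b^{(j)}_\ell$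 in $M_ab^{(i)}_k$ is non-zero. $M$ is straight if for some $B$ (a straightening basis) all connected components of $Q(M,B)$ are equioriented strings $\bullet\to\cdots\to\bullet$. Basis vectors are normalized so that $M_ab\in B\cup\{0\}$. Torus: $d$ is the number of components of $Q(M,B)$, $c$ the number of arrows of $\mathrm{supp}\,M$ (vertices $i$ with $M^{(i)}\ne0$, arrows $a$ with $M_a\neq0$). $T_M=(\mathbb{C}^* )^{d+c}\ni((\gamma_i)_{i\in[d]},(\nu_j)_{j\in[c]})$ scales the starting vertex of the $i$-th string by $\gamma_i$, and along each arrow of $Q(M,B)$ the scaling factor is multiplied by $\nu_j$, $j$ the label of the underlying arrow of $Q$; this induces an action on $\mathrm{Gr}_{\mathbf e}(M)$. The $T_M$-fixed points are coordinate subrepresentations, i.e. $U$ is spanned by a subset of $B$; its coefficient quiver $S$ is the full subquiver of $Q(M,B)$ on this subset. It is successor closed (for each vertex in $S_0$ and each arrow of $Q(M,B)$ starting there, the target is in $S_0$) and $\mathbf e$-dimensional (it has exactly $e_i$ vertices $b^{(i)}_k$ for each $i\in Q_0$). A mutation is a morphism $m:S\to S'$ between two $\mathbf e$-dimensional successor closed (full) subquivers $S,S'\subseteq Q(M,B)$ such that $L=S\setminus S'$ and $L'=S'\setminus S$ are connected (and non-empty) and project to the same path in $Q$; it is determined by $S$ and the triple $(i,k,\ell)$, where $b^{(i)}_k$ is the starting vertex of $L$ and $b^{(i)}_\ell$ is the starting vertex of $L'$. The associated $f_m\in\mathrm{Hom}_Q(U,M/U)$ sends each basis vector in $L_0$ to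 the class in $M/U$ of the corresponding basis vector in $L'_0$ (the one in the same position along the common path in $Q$) and sends all other basis vectors of $U$ in $S_0$ to zero.
   Formalization: Added assumption: no string of Q(M,B) contains a path over w·a·w (w a path, possibly trivial, a an arrow of Q) with first copy of w outside S and second inside; automatic for acyclic Q. Otherwise false: a loop with nilpotent 2×2 Jordan block, U its kernel. *)

theory Defs
  imports
    Complex_Main
    "HOL-Algebra.AbelCoset"
    "Graph_Theory.Graph_Theory"
    "Jordan_Normal_Form.VS_Connect"
begin

abbreviation complex_field :: "complex ring" where
  "complex_field \<equiv> class_ring"

section \<open>Quiver representations\<close>

text \<open>
  A quiver is a \<^typ>\<open>('v, 'a) pre_digraph\<close>, with source \<^const>\<open>tail\<close> and target \<^const>\<open>head\<close>;
  loops and parallel arrows are allowed. The vector spaces of a representation are carrier-based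
  (AFP entry VectorSpace), since quotients are needed; only their underlying type is shared
  between the vertices, not the linear structure.
\<close>

record ('v, 'a, 'm) quiver_rep =
  rep_space :: "'v \<Rightarrow> (complex, 'm) module"
  rep_map :: "'a \<Rightarrow> 'm \<Rightarrow> 'm"

definition is_rep :: "('v, 'a) pre_digraph \<Rightarrow> ('v, 'a, 'm) quiver_rep \<Rightarrow> bool" where
  "is_rep Q M \<longleftrightarrow>
     (\<forall>i\<in>verts Q. vectorspace complex_field (rep_space M i)
                 \<and> vectorspace.fin_dim complex_field (rep_space M i)) \<and>
     (\<forall>a\<in>arcs Q. linear_map complex_field
                  (rep_space M (tail Q a)) (rep_space M (head Q a)) (rep_map M a))"

abbreviation rep_dim :: "('v, 'a, 'm) quiver_rep \<Rightarrow> 'v \<Rightarrow> nat" where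
  "rep_dim M i \<equiv> vectorspace.dim complex_field (rep_space M i)"

text \<open>
  The space of morphisms. A morphism is a family of linear maps, made unique as a function by
  being \<^term>\<open>undefined\<close> off the vertices and off the carriers. Multiplication and unit are unused
  fields of the module record.
\<close>

definition rep_hom ::
  "('v, 'a) pre_digraph \<Rightarrow> ('v, 'a, 'm) quiver_rep \<Rightarrow> ('v, 'a, 'n) quiver_rep
     \<Rightarrow> (complex, 'v \<Rightarrow> 'm \<Rightarrow> 'n) module" where
  "rep_hom Q M N =
     \<lparr> carrier = {\<phi> \<in> extensional (verts Q).
         (\<forall>i\<in>verts Q. \<phi> i \<in> extensional (carrier (rep_space M i)) \<and>
            linear_map complex_field (rep_space M i) (rep_space N i) (\<phi> i)) \<and>
         (\<forall>a\<in>arcs Q. \<forall>x\<in>carrier (rep_space M (tail Q a)).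
            \<phi> (head Q a) (rep_map M a x) = rep_map N a (\<phi> (tail Q a) x))},
       monoid.mult = undefined,
       one = undefined,
       zero = (\<lambda>i\<in>verts Q. \<lambda>x\<in>carrier (rep_space M i). \<zero>\<^bsub>rep_space N i\<^esub>),
       add = (\<lambda>\<phi> \<psi>. \<lambda>i\<in>verts Q. \<lambda>x\<in>carrier (rep_space M i).
                \<phi> i x \<oplus>\<^bsub>rep_space N i\<^esub> \<psi> i x),
       smult = (\<lambda>c \<phi>. \<lambda>i\<in>verts Q. \<lambda>x\<in>carrier (rep_space M i).
                  c \<odot>\<^bsub>rep_space N i\<^esub> \<phi> i x) \<rparr>"

definition sub_rep ::
  "('v, 'a, 'm) quiver_rep \<Rightarrow> ('v \<Rightarrow> 'm set) \<Rightarrow> ('v, 'a, 'm) quiver_rep" where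
  "sub_rep M U =
     \<lparr> rep_space = (\<lambda>i. (rep_space M i)\<lparr>carrier := U i\<rparr>), rep_map = rep_map M \<rparr>"

definition is_subrep ::
  "('v, 'a) pre_digraph \<Rightarrow> ('v, 'a, 'm) quiver_rep \<Rightarrow> ('v \<Rightarrow> 'm set) \<Rightarrow> bool" where
  "is_subrep Q M U \<longleftrightarrow>
     U \<in> extensional (verts Q) \<and>
     (\<forall>i\<in>verts Q. VectorSpace.subspace complex_field (U i) (rep_space M i)) \<and>
     (\<forall>a\<in>arcs Q. rep_map M a ` U (tail Q a) \<subseteq> U (head Q a))"

text \<open>The unions below range over representatives of a coset.\<close>

definition quotient_space :: "('k, 'm) module \<Rightarrow> 'm set \<Rightarrow> ('k, 'm set) module" where
  "quotient_space V W =
     \<lparr> carrier = a_rcosets\<^bsub>V\<^esub> W,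
       monoid.mult = undefined,
       one = undefined,
       zero = W,
       add = (<+>\<^bsub>V\<^esub>),
       smult = (\<lambda>c X. \<Union>x\<in>X. W +>\<^bsub>V\<^esub> (c \<odot>\<^bsub>V\<^esub> x)) \<rparr>"

definition quotient_rep ::
  "('v, 'a) pre_digraph \<Rightarrow> ('v, 'a, 'm) quiver_rep \<Rightarrow> ('v \<Rightarrow> 'm set)
     \<Rightarrow> ('v, 'a, 'm set) quiver_rep" where
  "quotient_rep Q M U =
     \<lparr> rep_space = (\<lambda>i. quotient_space (rep_space M i) (U i)),
       rep_map = (\<lambda>a X. \<Union>x\<in>X. U (head Q a) +>\<^bsub>rep_space M (head Q a)\<^esub> rep_map M a x) \<rparr>"

text \<open>The closed points of the quiver Grassmannian.\<close>

definition quiver_Grassmannian ::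
  "('v, 'a) pre_digraph \<Rightarrow> ('v, 'a, 'm) quiver_rep \<Rightarrow> ('v \<Rightarrow> int) \<Rightarrow> ('v \<Rightarrow> 'm set) set" where
  "quiver_Grassmannian Q M e =
     {U. is_subrep Q M U \<and> (\<forall>i\<in>verts Q. int (rep_dim (sub_rep M U) i) = e i)}"

text \<open>The tangent space of the quiver Grassmannian at \<open>U\<close>, in its description as
  \<open>Hom\<^sub>Q(U, M/U)\<close>.\<close>

definition tangent_space ::
  "('v, 'a) pre_digraph \<Rightarrow> ('v, 'a, 'm) quiver_rep \<Rightarrow> ('v \<Rightarrow> 'm set)
     \<Rightarrow> (complex, 'v \<Rightarrow> 'm \<Rightarrow> 'm set) module" where
  "tangent_space Q M U = rep_hom Q (sub_rep M U) (quotient_rep Q M U)"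

section \<open>Coefficient quivers and straight representations\<close>

definition is_indexed_basis ::
  "('v, 'a) pre_digraph \<Rightarrow> ('v, 'a, 'm) quiver_rep \<Rightarrow> ('v \<Rightarrow> nat \<Rightarrow> 'm) \<Rightarrow> bool" where
  "is_indexed_basis Q M b \<longleftrightarrow>
     (\<forall>i\<in>verts Q. inj_on (b i) {1..rep_dim M i} \<and>
        vectorspace.basis complex_field (rep_space M i) (b i ` {1..rep_dim M i}))"

definition coord ::
  "('v, 'a, 'm) quiver_rep \<Rightarrow> ('v \<Rightarrow> nat \<Rightarrow> 'm) \<Rightarrow> 'v \<Rightarrow> 'm \<Rightarrow> nat \<Rightarrow> complex" where
  "coord M b i x = (THE c. c \<in> extensional {1..rep_dim M i} \<and>
     x = (\<Oplus>\<^bsub>rep_space M i\<^esub>k\<in>{1..rep_dim M i}. c k \<odot>\<^bsub>rep_space M i\<^esub> b i k))"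

text \<open>
  The basis vector \<open>b i k\<close> is represented by its index \<open>(i, k)\<close>, since the underlying sets of the
  spaces at different vertices need not be disjoint. The arrow \<open>(a, k, l)\<close> lies over the arrow \<open>a\<close>
  of the quiver, so \<^const>\<open>fst\<close> is the projection to \<open>Q\<close> on vertices and on arrows.
\<close>

type_synonym ('v, 'a) coeff_quiver = "('v \<times> nat, 'a \<times> nat \<times> nat) pre_digraph"

definition coefficient_quiver ::
  "('v, 'a) pre_digraph \<Rightarrow> ('v, 'a, 'm) quiver_rep \<Rightarrow> ('v \<Rightarrow> nat \<Rightarrow> 'm)
     \<Rightarrow> ('v, 'a) coeff_quiver" where
  "coefficient_quiver Q M b =
     \<lparr> verts = (SIGMA i:verts Q. {1..rep_dim M i}),
       arcs = {(a, k, l). a \<in> arcs Q \<and>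
                 k \<in> {1..rep_dim M (tail Q a)} \<and> l \<in> {1..rep_dim M (head Q a)} \<and>
                 coord M b (head Q a) (rep_map M a (b (tail Q a) k)) l \<noteq> 0},
       tail = (\<lambda>(a, k, l). (tail Q a, k)),
       head = (\<lambda>(a, k, l). (head Q a, l)) \<rparr>"

definition component_of :: "('v, 'a) pre_digraph \<Rightarrow> 'v \<Rightarrow> ('v, 'a) pre_digraph" where
  "component_of G x = G \<restriction> {y. x \<rightarrow>\<^sup>*\<^bsub>with_proj (mk_symmetric G)\<^esub> y}"

text \<open>\<open>L\<close> is an equioriented string with starting vertex \<open>u\<close> and successive arrows \<open>p\<close>.\<close>

definition is_string :: "('v, 'a) pre_digraph \<Rightarrow> 'v \<Rightarrow> 'a list \<Rightarrow> bool" where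
  "is_string L u p \<longleftrightarrow>
     (\<exists>v. pre_digraph.apath L u p v) \<and>
     verts L = set (pre_digraph.awalk_verts L u p) \<and> arcs L = set p"

definition is_straightening_basis ::
  "('v, 'a) pre_digraph \<Rightarrow> ('v, 'a, 'm) quiver_rep \<Rightarrow> ('v \<Rightarrow> nat \<Rightarrow> 'm) \<Rightarrow> bool" where
  "is_straightening_basis Q M b \<longleftrightarrow>
     is_indexed_basis Q M b \<and>
     (\<forall>x\<in>verts (coefficient_quiver Q M b).
        \<exists>u p. is_string (component_of (coefficient_quiver Q M b) x) u p)"

definition is_normalized ::
  "('v, 'a) pre_digraph \<Rightarrow> ('v, 'a, 'm) quiver_rep \<Rightarrow> ('v \<Rightarrow> nat \<Rightarrow> 'm) \<Rightarrow> bool" where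
  "is_normalized Q M b \<longleftrightarrow>
     (\<forall>a\<in>arcs Q. \<forall>k\<in>{1..rep_dim M (tail Q a)}.
        rep_map M a (b (tail Q a) k) \<in>
          b (head Q a) ` {1..rep_dim M (head Q a)} \<union> {\<zero>\<^bsub>rep_space M (head Q a)\<^esub>})"

section \<open>The torus action\<close>

definition support_arrows :: "('v, 'a) pre_digraph \<Rightarrow> ('v, 'a, 'm) quiver_rep \<Rightarrow> 'a set" where
  "support_arrows Q M =
     {a \<in> arcs Q. \<exists>x\<in>carrier (rep_space M (tail Q a)).
        rep_map M a x \<noteq> \<zero>\<^bsub>rep_space M (head Q a)\<^esub>}"

text \<open>The factors of the torus are indexed by the components of the coefficient quiver and by
  the arrows of the support, instead of by numbers.\<close>

definition torus ::
  "('v, 'a) pre_digraph \<Rightarrow> ('v, 'a, 'm) quiver_rep \<Rightarrow> ('v \<Rightarrow> nat \<Rightarrow> 'm)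
     \<Rightarrow> ((('v, 'a) coeff_quiver \<Rightarrow> complex) \<times> ('a \<Rightarrow> complex)) set" where
  "torus Q M b =
     (let G = coefficient_quiver Q M b in
      (component_of G ` verts G \<rightarrow>\<^sub>E UNIV - {0}) \<times> (support_arrows Q M \<rightarrow>\<^sub>E UNIV - {0}))"

text \<open>The scaling factor at \<open>x\<close>, computed along the path \<open>p\<close> to \<open>x\<close> from the starting vertex \<open>s\<close> of
  the string containing \<open>x\<close>.\<close>

definition weight ::
  "('v, 'a) coeff_quiver \<Rightarrow> (('v, 'a) coeff_quiver \<Rightarrow> complex) \<times> ('a \<Rightarrow> complex)
     \<Rightarrow> 'v \<times> nat \<Rightarrow> complex" where
  "weight G t x = (THE c. \<exists>s p. in_arcs G s = {} \<and> pre_digraph.awalk G s p x \<and>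
     c = fst t (component_of G x) * prod_list (map (\<lambda>f. snd t (fst f)) p))"

definition torus_act ::
  "('v, 'a) pre_digraph \<Rightarrow> ('v, 'a, 'm) quiver_rep \<Rightarrow> ('v \<Rightarrow> nat \<Rightarrow> 'm)
     \<Rightarrow> (('v, 'a) coeff_quiver \<Rightarrow> complex) \<times> ('a \<Rightarrow> complex) \<Rightarrow> 'v \<Rightarrow> 'm \<Rightarrow> 'm" where
  "torus_act Q M b t i x =
     (\<Oplus>\<^bsub>rep_space M i\<^esub>k\<in>{1..rep_dim M i}.
        (weight (coefficient_quiver Q M b) t (i, k) * coord M b i x k)
          \<odot>\<^bsub>rep_space M i\<^esub> b i k)"

definition torus_fixed_points ::
  "('v, 'a) pre_digraph \<Rightarrow> ('v, 'a, 'm) quiver_rep \<Rightarrow> ('v \<Rightarrow> nat \<Rightarrow> 'm) \<Rightarrow> ('v \<Rightarrow> int)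
     \<Rightarrow> ('v \<Rightarrow> 'm set) set" where
  "torus_fixed_points Q M b e =
     {U \<in> quiver_Grassmannian Q M e.
        \<forall>t\<in>torus Q M b. \<forall>i\<in>verts Q. torus_act Q M b t i ` U i = U i}"

definition sub_coefficient_quiver ::
  "('v, 'a) pre_digraph \<Rightarrow> ('v, 'a, 'm) quiver_rep \<Rightarrow> ('v \<Rightarrow> nat \<Rightarrow> 'm) \<Rightarrow> ('v \<Rightarrow> 'm set)
     \<Rightarrow> ('v, 'a) coeff_quiver" where
  "sub_coefficient_quiver Q M b U =
     coefficient_quiver Q M b \<restriction>
       {(i, k). (i, k) \<in> verts (coefficient_quiver Q M b) \<and> b i k \<in> U i}"

section \<open>Mutations\<close>

definition successor_closed :: "('v, 'a) pre_digraph \<Rightarrow> 'v set \<Rightarrow> bool" where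
  "successor_closed G X \<longleftrightarrow> (\<forall>f\<in>arcs G. tail G f \<in> X \<longrightarrow> head G f \<in> X)"

definition succ_closed_subquivers ::
  "('v, 'a) pre_digraph \<Rightarrow> ('v, 'a) coeff_quiver \<Rightarrow> ('v \<Rightarrow> int) \<Rightarrow> ('v, 'a) coeff_quiver set" where
  "succ_closed_subquivers Q G e =
     {G \<restriction> X | X. X \<subseteq> verts G \<and> successor_closed G X \<and>
        (\<forall>i\<in>verts Q. int (card {k. (i, k) \<in> X}) = e i)}"

definition quiver_diff ::
  "('v, 'a) pre_digraph \<Rightarrow> ('v, 'a) pre_digraph \<Rightarrow> ('v, 'a) pre_digraph" where
  "quiver_diff S S' = S \<restriction> (verts S - verts S')"

definition same_projection :: "('v, 'a) coeff_quiver \<Rightarrow> ('v, 'a) coeff_quiver \<Rightarrow> bool" where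
  "same_projection L L' \<longleftrightarrow>
     (\<exists>u p u' p'. is_string L u p \<and> is_string L' u' p' \<and>
        fst u = fst u' \<and> map fst p = map fst p')"

text \<open>
  A mutation is determined by its source and target, so the mutations starting at \<open>S\<close> are
  represented by their targets. The notion of connectedness used here includes non-emptiness.
\<close>

definition mutations_from ::
  "('v, 'a) pre_digraph \<Rightarrow> ('v, 'a) coeff_quiver \<Rightarrow> ('v \<Rightarrow> int) \<Rightarrow> ('v, 'a) coeff_quiver
     \<Rightarrow> ('v, 'a) coeff_quiver set" where
  "mutations_from Q G e S =
     {S'. S \<in> succ_closed_subquivers Q G e \<and> S' \<in> succ_closed_subquivers Q G e \<and>
        Digraph_Component.connected (quiver_diff S S') \<and>
        Digraph_Component.connected (quiver_diff S' S) \<and>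
        same_projection (quiver_diff S S') (quiver_diff S' S)}"

text \<open>The vertex of \<open>L'\<close> in the position that \<open>x\<close> has in \<open>L\<close>.\<close>

definition corresponding_vertex ::
  "('v, 'a) coeff_quiver \<Rightarrow> ('v, 'a) coeff_quiver \<Rightarrow> 'v \<times> nat \<Rightarrow> 'v \<times> nat" where
  "corresponding_vertex L L' x =
     (THE y. \<exists>u p u' p' n. is_string L u p \<and> is_string L' u' p' \<and> n \<le> length p \<and>
        x = pre_digraph.awalk_verts L u p ! n \<and> y = pre_digraph.awalk_verts L' u' p' ! n)"

text \<open>The linear extension of the prescription on basis vectors; \<open>i\<close> is also the vertex over which
  the image basis vector lies.\<close>

definition mutation_hom ::
  "('v, 'a) pre_digraph \<Rightarrow> ('v, 'a, 'm) quiver_rep \<Rightarrow> ('v \<Rightarrow> nat \<Rightarrow> 'm) \<Rightarrow> ('v \<Rightarrow> 'm set)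
     \<Rightarrow> ('v, 'a) coeff_quiver \<Rightarrow> ('v, 'a) coeff_quiver \<Rightarrow> 'v \<Rightarrow> 'm \<Rightarrow> 'm set" where
  "mutation_hom Q M b U S S' =
     (let L = quiver_diff S S'; L' = quiver_diff S' S in
      (\<lambda>i\<in>verts Q. \<lambda>x\<in>U i.
        \<Oplus>\<^bsub>rep_space (quotient_rep Q M U) i\<^esub>k\<in>{k. (i, k) \<in> verts L}.
          coord M b i x k \<odot>\<^bsub>rep_space (quotient_rep Q M U) i\<^esub>
            (U i +>\<^bsub>rep_space M i\<^esub> b i (snd (corresponding_vertex L L' (i, k))))))"

section \<open>Strings overlapping themselves\<close>

text \<open>
  Some string of \<open>G\<close> contains a path lying over \<open>w a w\<close>, for a path \<open>w\<close> (possibly of length zero)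
  and an arrow \<open>a\<close> of \<open>Q\<close>, whose first copy of \<open>w\<close> lies outside the successor closed subquiver \<open>S\<close>
  and whose second copy lies inside. Sending the second copy to the first is then a non-zero
  morphism \<open>U \<rightarrow> M/U\<close>, but it does not come from a mutation: the result of replacing the
  second copy by the first is not successor closed. The smallest example is a loop acting on
  \<open>\<complex>\<^sup>2\<close> by a nilpotent Jordan block, where \<open>U\<close> is the kernel: \<open>Hom\<^sub>Q(U, M/U)\<close> has dimension 1,
  but \<open>S\<close> is the only successor closed subquiver with one vertex.
\<close>

definition self_overlap :: "('v, 'a) coeff_quiver \<Rightarrow> ('v, 'a) coeff_quiver \<Rightarrow> bool" where
  "self_overlap G S \<longleftrightarrow>
     (\<exists>u q f q' v. pre_digraph.awalk G u (q @ f # q') v \<and>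
        fst u = fst (head G f) \<and> map fst q = map fst q' \<and>
        tail G f \<notin> verts S \<and> head G f \<in> verts S)"

lemma coefficient_quiver_awalk_proj:
  assumes "fin_digraph Q" and "pre_digraph.awalk (coefficient_quiver Q M b) u p v"
  shows "pre_digraph.awalk Q (fst u) (map fst p) (fst v)"
proof -
  let ?G = "coefficient_quiver Q M b"
  have cas: "pre_digraph.cas Q (fst u) (map fst p) (fst v)"
    if "pre_digraph.cas ?G u p v" for u
    using that
  proof (induction p arbitrary: u)
    case (Cons f p)
    have "fst (tail ?G f) = tail Q (fst f)" "fst (head ?G f) = head Q (fst f)"
      by (auto simp: coefficient_quiver_def split: prod.splits)
    with Cons show ?case by (metis list.simps(9) pre_digraph.cas.simps(2))
  qed (simp add: pre_digraph.cas.simps)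
  show ?thesis
    using assms(2) cas[of u] unfolding pre_digraph.awalk_def
    by (auto simp: coefficient_quiver_def)
qed

lemma no_self_overlap_if_acyclic:
  assumes "fin_digraph Q" and "\<And>i p. pre_digraph.awalk Q i p i \<Longrightarrow> p = []"
  shows "\<not> self_overlap (coefficient_quiver Q M b) S"
proof
  interpret Q: fin_digraph Q by fact
  assume "self_overlap (coefficient_quiver Q M b) S"
  then obtain u q f q' v
    where w: "pre_digraph.awalk (coefficient_quiver Q M b) u (q @ f # q') v"
      and eq: "fst u = fst (head (coefficient_quiver Q M b) f)"
    unfolding self_overlap_def by blast
  have hd: "head Q (fst f) = fst u"
    using eq by (auto simp: coefficient_quiver_def split: prod.splits)
  have "Q.awalk (fst u) (map fst q @ fst f # map fst q') (fst v)"
    using coefficient_quiver_awalk_proj[OF assms(1) w] by simp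
  then have "Q.awalk (fst u) (map fst q) (tail Q (fst f))" "fst f \<in> arcs Q"
    by (auto simp: Q.awalk_simps)
  then have "Q.awalk (fst u) (map fst q @ [fst f]) (fst u)"
    using hd by (auto simp: Q.awalk_simps)
  then show False using assms(2) by blast
qed

end

theory Submission
  imports Defs
begin

text \<open>
  A torus element separating two basis vectors shows that a fixed point \<open>U\<close> is spanned by a subset
  \<open>X\<close> of the basis. A family of linear maps \<open>U\<^sub>i \<rightarrow> M\<^sub>i/U\<^sub>i\<close> is then a matrix \<open>c x y\<close> indexed by the
  pairs \<open>x \<in> X\<close>, \<open>y \<notin> X\<close> over the same vertex of \<open>Q\<close>. Since all vertices of the coefficient quiver
  have at most one incoming and one outgoing arrow, commuting with the arrows of \<open>Q\<close> means that \<open>c\<close>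
  is constant along simultaneous steps \<open>(x, y) \<rightarrow> (x', y')\<close> over one arrow of \<open>Q\<close>, and vanishes
  where only one side of such a step exists. The pairs thus decompose into chains, each of
  which contributes either nothing or one dimension. The latter happens exactly if the first
  components start at a vertex without predecessor in \<open>X\<close> and the second components end at a
  vertex without successor outside \<open>X\<close>. Such a chain is a mutation: replacing its first components
  by its second ones keeps \<open>X\<close> successor closed, because overlaps are excluded.
\<close>

section \<open>Dual bases\<close>

text \<open>The chains are never listed. The basis property comes from dual functionals: a mutation
  is paired with the matrix entry at its pair of starting vertices. The matrix of a mutation
  morphism is the indicator of its chain, and a starting pair lies on the chain of no other
  mutation, so the pairing is the identity matrix. Conversely a nonzero morphism has a nonzero entry
  at some starting pair. Independence, spanning and distinctness of the morphisms then follow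
  together, without a dimension count. Propagation along a chain needs a termination argument
  although Q may have oriented cycles. It is provided by a rank on the coefficient quiver, the
  position of a vertex in its string. The obstacle is successor closedness after the exchange. The
  only arrow that can leave the exchanged set runs from the end of the added path to the start of
  the removed one. In that case the added path, this arrow and the removed path follow each other on
  one string and lie over w a w, which is exactly the excluded overlap.\<close>

lemma linear_map_complexI:
  assumes "vectorspace complex_field V" "vectorspace complex_field W"
    and "\<And>x. x \<in> carrier V \<Longrightarrow> f x \<in> carrier W"
    and "\<And>x y. x \<in> carrier V \<Longrightarrow> y \<in> carrier V \<Longrightarrow> f (x \<oplus>\<^bsub>V\<^esub> y) = f x \<oplus>\<^bsub>W\<^esub> f y"
    and "\<And>c x. x \<in> carrier V \<Longrightarrow> f (c \<odot>\<^bsub>V\<^esub> x) = c \<odot>\<^bsub>W\<^esub> f x"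
  shows "linear_map complex_field V W f"
proof -
  interpret V: vectorspace complex_field V by fact
  interpret W: vectorspace complex_field W by fact
  show ?thesis
    by unfold_locales (use assms(3-5) in \<open>auto simp: module_hom_def\<close>)
qed

lemma linear_map_cong:
  assumes "linear_map complex_field V W f" "\<And>x. x \<in> carrier V \<Longrightarrow> g x = f x"
  shows "linear_map complex_field V W g"
proof -
  interpret linear_map complex_field V W f by fact
  show ?thesis
    by (rule linear_map_complexI)
      (use assms(2) V.vectorspace_axioms W.vectorspace_axioms in auto)
qed

text \<open>A finite basis presented by its coordinate functionals. Spanning is not assumed: it
  follows from \<open>\<kappa>_b\<close> together with \<open>\<kappa>_eq_zero\<close>, which says
  that the functionals separate points. The format is used for the spaces of M, of U and of M/U, and
  at the end for the tangent space, where no dimension is known in advance.\<close>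

locale dual_basis = vectorspace complex_field V
  for V :: "(complex, 'm) module" +
  fixes I :: "'i set" and b :: "'i \<Rightarrow> 'm" and \<kappa> :: "'i \<Rightarrow> 'm \<Rightarrow> complex"
  assumes fin: "finite I"
    and b_closed [simp]: "k \<in> I \<Longrightarrow> b k \<in> carrier V"
    and \<kappa>_add: "k \<in> I \<Longrightarrow> x \<in> carrier V \<Longrightarrow> y \<in> carrier V \<Longrightarrow>
      \<kappa> k (x \<oplus>\<^bsub>V\<^esub> y) = \<kappa> k x + \<kappa> k y"
    and \<kappa>_smult: "k \<in> I \<Longrightarrow> x \<in> carrier V \<Longrightarrow> \<kappa> k (c \<odot>\<^bsub>V\<^esub> x) = c * \<kappa> k x"
    and \<kappa>_b: "k \<in> I \<Longrightarrow> l \<in> I \<Longrightarrow> \<kappa> k (b l) = (if k = l then 1 else 0)"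
    and \<kappa>_eq_zero: "x \<in> carrier V \<Longrightarrow> (\<And>k. k \<in> I \<Longrightarrow> \<kappa> k x = 0) \<Longrightarrow> x = \<zero>\<^bsub>V\<^esub>"
begin

lemma smult_closed_complex [simp]: "x \<in> carrier V \<Longrightarrow> c \<odot>\<^bsub>V\<^esub> x \<in> carrier V"
  by (rule smult_closed) auto

lemma \<kappa>_zero: "k \<in> I \<Longrightarrow> \<kappa> k \<zero>\<^bsub>V\<^esub> = 0"
  using \<kappa>_add[of k "\<zero>\<^bsub>V\<^esub>" "\<zero>\<^bsub>V\<^esub>"] by simp

lemma \<kappa>_finsum:
  assumes "k \<in> I" "g \<in> A \<rightarrow> carrier V"
  shows "finite A \<Longrightarrow> \<kappa> k (\<Oplus>\<^bsub>V\<^esub>j\<in>A. g j) = (\<Sum>j\<in>A. \<kappa> k (g j))"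
  using assms(2)
proof (induction rule: infinite_finite_induct)
  case (insert a A)
  then show ?case using assms(1) by (simp add: \<kappa>_add)
qed (simp_all add: \<kappa>_zero assms)

lemma \<kappa>_expansion:
  assumes "k \<in> I" "J \<subseteq> I"
  shows "\<kappa> k (\<Oplus>\<^bsub>V\<^esub>j\<in>J. c j \<odot>\<^bsub>V\<^esub> b j) = (if k \<in> J then c k else 0)"
proof -
  have f: "finite J" using assms(2) fin finite_subset by blast
  have "\<kappa> k (\<Oplus>\<^bsub>V\<^esub>j\<in>J. c j \<odot>\<^bsub>V\<^esub> b j) = (\<Sum>j\<in>J. \<kappa> k (c j \<odot>\<^bsub>V\<^esub> b j))"
    using assms f by (intro \<kappa>_finsum) auto
  also have "\<dots> = (\<Sum>j\<in>J. if k = j then c j else 0)"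
    using assms by (intro sum.cong) (auto simp: \<kappa>_smult \<kappa>_b subset_iff)
  finally show ?thesis using f by simp
qed

lemma \<kappa>_inject:
  assumes "x \<in> carrier V" "y \<in> carrier V" "\<And>k. k \<in> I \<Longrightarrow> \<kappa> k x = \<kappa> k y"
  shows "x = y"
proof -
  have "x \<ominus>\<^bsub>V\<^esub> y = \<zero>\<^bsub>V\<^esub>"
  proof (rule \<kappa>_eq_zero)
    show "x \<ominus>\<^bsub>V\<^esub> y \<in> carrier V" using assms by simp
    fix k assume k: "k \<in> I"
    have "\<kappa> k (x \<ominus>\<^bsub>V\<^esub> y) + \<kappa> k y = \<kappa> k x"
      using assms k \<kappa>_add[of k "x \<ominus>\<^bsub>V\<^esub> y" y]
      by (simp add: M.minus_eq M.add.m_assoc M.l_neg)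
    then show "\<kappa> k (x \<ominus>\<^bsub>V\<^esub> y) = 0" using assms(3)[OF k] by simp
  qed
  then show ?thesis using assms by simp
qed

text \<open>Both sides have the same coordinates, and coordinates separate points. This is where
  spanning comes from.\<close>

lemma expansion:
  assumes "x \<in> carrier V"
  shows "(\<Oplus>\<^bsub>V\<^esub>k\<in>I. \<kappa> k x \<odot>\<^bsub>V\<^esub> b k) = x"
  by (rule \<kappa>_inject) (use assms in \<open>auto intro!: M.finsum_closed simp: \<kappa>_expansion\<close>)

lemma inj_b: "inj_on b I"
proof (rule inj_onI, rule ccontr)
  fix k l assume "k \<in> I" "l \<in> I" "b k = b l" "k \<noteq> l"
  then show False using \<kappa>_b[of k k] \<kappa>_b[of k l] by simp
qed

lemma lincomb_b: "lincomb a (b ` I) = (\<Oplus>\<^bsub>V\<^esub>k\<in>I. a (b k) \<odot>\<^bsub>V\<^esub> b k)"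
  unfolding lincomb_def by (subst M.finsum_reindex) (auto simp: inj_b)

lemma basis_b: "basis (b ` I)"
  unfolding basis_def
proof (intro conjI)
  show sub: "b ` I \<subseteq> carrier V" by auto
  show "lin_indpt (b ` I)"
  proof (rule finite_lin_indpt2)
    fix a assume "lincomb a (b ` I) = \<zero>\<^bsub>V\<^esub>"
    then have "(\<Oplus>\<^bsub>V\<^esub>k\<in>I. a (b k) \<odot>\<^bsub>V\<^esub> b k) = \<zero>\<^bsub>V\<^esub>" by (simp add: lincomb_b)
    then have "a (b k) = 0" if "k \<in> I" for k
      using \<kappa>_expansion[OF that subset_refl, of "\<lambda>k. a (b k)"] \<kappa>_zero[OF that] that by simp
    then show "\<forall>v\<in>b ` I. a v = \<zero>\<^bsub>complex_field\<^esub>" by auto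
  qed (use fin sub in auto)
  show "gen_set (b ` I)"
  proof
    show "span (b ` I) \<subseteq> carrier V" using span_is_subset2[OF sub] .
    show "carrier V \<subseteq> span (b ` I)"
    proof
      fix x assume x: "x \<in> carrier V"
      have "lincomb (\<lambda>v. \<kappa> (inv_into I b v) x) (b ` I) = (\<Oplus>\<^bsub>V\<^esub>k\<in>I. \<kappa> k x \<odot>\<^bsub>V\<^esub> b k)"
        unfolding lincomb_b using x
        by (intro M.finsum_cong') (auto simp: inv_into_f_f[OF inj_b])
      with expansion[OF x] show "x \<in> span (b ` I)"
        by (subst finite_span) (use fin in \<open>auto intro!: exI[of _ "\<lambda>v. \<kappa> (inv_into I b v) x"]\<close>)
    qed
  qed
qed

lemma dim_eq: "dim = card I"
  using dim_basis[OF _ basis_b] fin by (simp add: card_image inj_b)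

lemma linear_maps_eqI:
  assumes "linear_map complex_field V W f" "linear_map complex_field V W g"
    and "\<And>k. k \<in> I \<Longrightarrow> f (b k) = g (b k)" and x: "x \<in> carrier V"
  shows "f x = g x"
proof -
  interpret W: vectorspace complex_field W using assms(1) by (simp add: linear_map_def)
  interpret f: linear_map complex_field V W f by fact
  interpret g: linear_map complex_field V W g by fact
  have *: "h x = (\<Oplus>\<^bsub>W\<^esub>k\<in>I. \<kappa> k x \<odot>\<^bsub>W\<^esub> h (b k))" if "linear_map complex_field V W h" for h
  proof -
    interpret h: linear_map complex_field V W h by fact
    have "h (\<Oplus>\<^bsub>V\<^esub>k\<in>J. \<kappa> k x \<odot>\<^bsub>V\<^esub> b k) = (\<Oplus>\<^bsub>W\<^esub>k\<in>J. \<kappa> k x \<odot>\<^bsub>W\<^esub> h (b k))"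
      if "finite J" "J \<subseteq> I" for J
      using that
      by (induction J) (auto simp: Pi_def subset_iff)
    from this[OF fin subset_refl] expansion[OF x] show ?thesis by simp
  qed
  have "f x = (\<Oplus>\<^bsub>W\<^esub>k\<in>I. \<kappa> k x \<odot>\<^bsub>W\<^esub> f (b k))" by (rule *) fact
  also have "\<dots> = (\<Oplus>\<^bsub>W\<^esub>k\<in>I. \<kappa> k x \<odot>\<^bsub>W\<^esub> g (b k))"
    using assms(3) by (intro W.M.finsum_cong') auto
  also have "\<dots> = g x" by (rule *[symmetric]) fact
  finally show ?thesis .
qed

end

section \<open>Quotient spaces\<close>

locale quotient_vs = vectorspace complex_field V
  for V :: "(complex, 'm) module" +
  fixes W :: "'m set"
  assumes sub: "VectorSpace.subspace complex_field W V"
begin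

lemma submod: "LinearCombinations.submodule complex_field W V"
  using sub by (simp add: VectorSpace.subspace_def)

lemma W_sub: "W \<subseteq> carrier V"
  using submod LinearCombinations.submodule.subset by blast

lemma W_smult: "x \<in> W \<Longrightarrow> c \<odot>\<^bsub>V\<^esub> x \<in> W"
  using submod LinearCombinations.submodule.smult_closed by fastforce

lemma smult_closed_complex [simp]: "x \<in> carrier V \<Longrightarrow> c \<odot>\<^bsub>V\<^esub> x \<in> carrier V"
  by (rule smult_closed) auto

lemma W_inv: "x \<in> W \<Longrightarrow> \<ominus>\<^bsub>V\<^esub> x \<in> W"
  using W_smult[of x "\<ominus>\<^bsub>complex_field\<^esub> \<one>\<^bsub>complex_field\<^esub>"] W_sub smult_minus_1[of x] by auto

sublocale Q: abelian_subgroup W V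
proof (rule abelian_subgroupI3)
  show "additive_subgroup W V"
  proof (rule additive_subgroupI)
    interpret W: LinearCombinations.submodule complex_field W V by (rule submod)
    show "subgroup W (add_monoid V)"
      by (rule M.add.subgroupI)
        (use W_sub W.m_closed W.zero_closed W_inv in \<open>force simp: a_inv_def[symmetric]\<close>)+
  qed
  show "abelian_group V" by (rule M.abelian_group_axioms)
qed


lemma coset_eq_iff:
  assumes "x \<in> carrier V" "y \<in> carrier V"
  shows "W +>\<^bsub>V\<^esub> x = W +>\<^bsub>V\<^esub> y \<longleftrightarrow> x \<ominus>\<^bsub>V\<^esub> y \<in> W"
proof -
  have "x \<ominus>\<^bsub>V\<^esub> y \<in> W \<longleftrightarrow> x \<in> W +>\<^bsub>V\<^esub> y"
    using assms by (simp add: M.minus_eq Q.a_rcos_module)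
  also have "\<dots> \<longleftrightarrow> W +>\<^bsub>V\<^esub> x = W +>\<^bsub>V\<^esub> y"
    using assms Q.a_rcos_self[of x] M.a_repr_independence[OF _ _ Q.a_subgroup] by blast
  finally show ?thesis ..
qed

lemma coset_closed [simp]:
  "x \<in> carrier V \<Longrightarrow> W +>\<^bsub>V\<^esub> x \<in> carrier (quotient_space V W)"
  by (simp add: quotient_space_def M.a_rcosetsI W_sub)

lemma coset_cases:
  assumes "X \<in> carrier (quotient_space V W)"
  obtains x where "x \<in> carrier V" "X = W +>\<^bsub>V\<^esub> x"
  using assms by (auto simp: quotient_space_def A_RCOSETS_def')

lemma coset_add:
  assumes "x \<in> carrier V" "y \<in> carrier V"
  shows "(W +>\<^bsub>V\<^esub> x) \<oplus>\<^bsub>quotient_space V W\<^esub> (W +>\<^bsub>V\<^esub> y) = W +>\<^bsub>V\<^esub> (x \<oplus>\<^bsub>V\<^esub> y)"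
  using assms by (simp add: quotient_space_def Q.a_rcos_sum)

lemma coset_rep_mem: "x \<in> carrier V \<Longrightarrow> x' \<in> W +>\<^bsub>V\<^esub> x \<Longrightarrow> x' \<in> carrier V"
  using M.a_r_coset_subset_G[OF W_sub] by blast

text \<open>The operations of a quotient are defined as unions over all representatives. This is the
  well-definedness argument in that form; it serves scalar multiplication and the induced arrow maps
  alike.\<close>

lemma coset_UN:
  assumes "x \<in> carrier V"
    and "\<And>x'. x' \<in> carrier V \<Longrightarrow> x' \<ominus>\<^bsub>V\<^esub> x \<in> W \<Longrightarrow> F x' = F x"
  shows "(\<Union>x'\<in>W +>\<^bsub>V\<^esub> x. F x') = F x"
proof -
  have "F x' = F x" if "x' \<in> W +>\<^bsub>V\<^esub> x" for x'
    using that assms coset_rep_mem[OF assms(1) that]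
    by (simp add: M.minus_eq Q.a_rcos_module)
  with Q.a_rcos_self[OF assms(1)] show ?thesis by blast
qed

lemma minus_smult:
  assumes "x \<in> carrier V" "y \<in> carrier V"
  shows "(c \<odot>\<^bsub>V\<^esub> x) \<ominus>\<^bsub>V\<^esub> (c \<odot>\<^bsub>V\<^esub> y) = c \<odot>\<^bsub>V\<^esub> (x \<ominus>\<^bsub>V\<^esub> y)"
  using assms by (simp add: M.minus_eq smult_r_distr smult_r_minus)

lemma coset_smult:
  assumes "x \<in> carrier V"
  shows "c \<odot>\<^bsub>quotient_space V W\<^esub> (W +>\<^bsub>V\<^esub> x) = W +>\<^bsub>V\<^esub> (c \<odot>\<^bsub>V\<^esub> x)"
proof -
  have "(\<Union>x'\<in>W +>\<^bsub>V\<^esub> x. W +>\<^bsub>V\<^esub> (c \<odot>\<^bsub>V\<^esub> x')) = W +>\<^bsub>V\<^esub> (c \<odot>\<^bsub>V\<^esub> x)"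
    using assms by (intro coset_UN) (simp_all add: coset_eq_iff minus_smult W_smult)
  then show ?thesis by (simp add: quotient_space_def)
qed

lemma coset_zero: "\<zero>\<^bsub>quotient_space V W\<^esub> = W +>\<^bsub>V\<^esub> \<zero>\<^bsub>V\<^esub>"
  by (simp add: quotient_space_def M.a_coset_add_zero W_sub)

lemma coset_of_mem: "x \<in> W \<Longrightarrow> W +>\<^bsub>V\<^esub> x = \<zero>\<^bsub>quotient_space V W\<^esub>"
  using M.a_coset_join2[OF _ Q.a_subgroup] W_sub by (auto simp: quotient_space_def)

lemma vectorspace_quotient: "vectorspace complex_field (quotient_space V W)"
proof (rule vs_criteria)
  let ?Q = "quotient_space V W"
  show "field complex_field" by (rule class_field)
  show "\<zero>\<^bsub>?Q\<^esub> \<in> carrier ?Q" by (simp add: coset_zero)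
  show "\<forall>v w. v \<in> carrier ?Q \<and> w \<in> carrier ?Q \<longrightarrow> v \<oplus>\<^bsub>?Q\<^esub> w \<in> carrier ?Q"
    by (auto elim!: coset_cases simp: coset_add)
  show "\<forall>v\<in>carrier ?Q. \<exists>w\<in>carrier ?Q. v \<oplus>\<^bsub>?Q\<^esub> w = \<zero>\<^bsub>?Q\<^esub>"
  proof
    fix v assume "v \<in> carrier ?Q"
    then obtain x where "x \<in> carrier V" "v = W +>\<^bsub>V\<^esub> x" by (rule coset_cases)
    then show "\<exists>w\<in>carrier ?Q. v \<oplus>\<^bsub>?Q\<^esub> w = \<zero>\<^bsub>?Q\<^esub>"
      by (intro bexI[of _ "W +>\<^bsub>V\<^esub> (\<ominus>\<^bsub>V\<^esub> x)"]) (auto simp: coset_add coset_zero M.r_neg)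
  qed
  show "\<forall>c v. c \<in> carrier complex_field \<and> v \<in> carrier ?Q \<longrightarrow> c \<odot>\<^bsub>?Q\<^esub> v \<in> carrier ?Q"
    by (auto elim!: coset_cases simp: coset_smult)
  show "\<forall>v w. v \<in> carrier ?Q \<and> w \<in> carrier ?Q \<longrightarrow> v \<oplus>\<^bsub>?Q\<^esub> w = w \<oplus>\<^bsub>?Q\<^esub> v"
    by (auto elim!: coset_cases simp: coset_add M.a_comm)
  show "\<forall>v w x. v \<in> carrier ?Q \<and> w \<in> carrier ?Q \<and> x \<in> carrier ?Q \<longrightarrow>
      v \<oplus>\<^bsub>?Q\<^esub> w \<oplus>\<^bsub>?Q\<^esub> x = v \<oplus>\<^bsub>?Q\<^esub> (w \<oplus>\<^bsub>?Q\<^esub> x)"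
    by (auto elim!: coset_cases simp: coset_add M.a_assoc)
  show "\<forall>v\<in>carrier ?Q. v \<oplus>\<^bsub>?Q\<^esub> \<zero>\<^bsub>?Q\<^esub> = v"
    by (auto elim!: coset_cases simp: coset_add coset_zero)
  show "\<forall>a b v. a \<in> carrier complex_field \<and> b \<in> carrier complex_field \<and> v \<in> carrier ?Q \<longrightarrow>
      (a \<otimes>\<^bsub>complex_field\<^esub> b) \<odot>\<^bsub>?Q\<^esub> v = a \<odot>\<^bsub>?Q\<^esub> (b \<odot>\<^bsub>?Q\<^esub> v)"
    using smult_assoc1 by (auto elim!: coset_cases simp: coset_smult)
  show "\<forall>v\<in>carrier ?Q. \<one>\<^bsub>complex_field\<^esub> \<odot>\<^bsub>?Q\<^esub> v = v"
    using smult_one by (auto elim!: coset_cases simp: coset_smult)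
  show "\<forall>a b v. a \<in> carrier complex_field \<and> b \<in> carrier complex_field \<and> v \<in> carrier ?Q \<longrightarrow>
      (a \<oplus>\<^bsub>complex_field\<^esub> b) \<odot>\<^bsub>?Q\<^esub> v = a \<odot>\<^bsub>?Q\<^esub> v \<oplus>\<^bsub>?Q\<^esub> b \<odot>\<^bsub>?Q\<^esub> v"
    using smult_l_distr by (auto elim!: coset_cases simp: coset_smult coset_add)
  show "\<forall>a v w. a \<in> carrier complex_field \<and> v \<in> carrier ?Q \<and> w \<in> carrier ?Q \<longrightarrow>
      a \<odot>\<^bsub>?Q\<^esub> (v \<oplus>\<^bsub>?Q\<^esub> w) = a \<odot>\<^bsub>?Q\<^esub> v \<oplus>\<^bsub>?Q\<^esub> a \<odot>\<^bsub>?Q\<^esub> w"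
    using smult_r_distr by (auto elim!: coset_cases simp: coset_smult coset_add)
qed

end

text \<open>The span of the \<open>b k\<close> with k in J, described as the common kernel of the
  remaining coordinates. In this form the functionals indexed by J restrict to a dual basis of W,
  and the others descend to a dual basis of the quotient.\<close>

locale coordinate_subspace = dual_basis V I b \<kappa> + quotient_vs V W
  for V :: "(complex, 'm) module" and I :: "'i set" and b \<kappa> W +
  fixes J :: "'i set"
  assumes J_sub: "J \<subseteq> I"
    and W_eq: "W = {x \<in> carrier V. \<forall>k\<in>I - J. \<kappa> k x = 0}"
begin

lemma mem_W: "x \<in> W \<longleftrightarrow> x \<in> carrier V \<and> (\<forall>k\<in>I - J. \<kappa> k x = 0)"
  by (subst W_eq) simp

lemma dual_basis_subspace: "dual_basis (V\<lparr>carrier := W\<rparr>) J b \<kappa>"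
proof -
  show ?thesis
  proof (intro dual_basis.intro dual_basis_axioms.intro)
    show "vectorspace complex_field (V\<lparr>carrier := W\<rparr>)" by (rule subspace_is_vs[OF sub])
    show "finite J" using J_sub fin finite_subset by blast
    show "b k \<in> carrier (V\<lparr>carrier := W\<rparr>)" if "k \<in> J" for k
      using that J_sub by (auto simp del: Q.a_Hcarr simp: mem_W \<kappa>_b subset_iff)
    show "x = \<zero>\<^bsub>V\<lparr>carrier := W\<rparr>\<^esub>"
      if "x \<in> carrier (V\<lparr>carrier := W\<rparr>)" "\<And>k. k \<in> J \<Longrightarrow> \<kappa> k x = 0" for x
      using that J_sub \<kappa>_eq_zero[of x] by (auto simp del: Q.a_Hcarr simp: mem_W)
    show "\<kappa> k (x \<oplus>\<^bsub>V\<lparr>carrier := W\<rparr>\<^esub> y) = \<kappa> k x + \<kappa> k y"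
      if "k \<in> J" "x \<in> carrier (V\<lparr>carrier := W\<rparr>)" "y \<in> carrier (V\<lparr>carrier := W\<rparr>)" for k x y
      using that J_sub \<kappa>_add[of k x y] by (auto simp del: Q.a_Hcarr simp: mem_W)
    show "\<kappa> k (c \<odot>\<^bsub>V\<lparr>carrier := W\<rparr>\<^esub> x) = c * \<kappa> k x"
      if "k \<in> J" "x \<in> carrier (V\<lparr>carrier := W\<rparr>)" for k c x
      using that J_sub \<kappa>_smult[of k x c] by (auto simp del: Q.a_Hcarr simp: mem_W)
  qed (use J_sub in \<open>auto simp: \<kappa>_b subset_iff\<close>)
qed

text \<open>Independent of the representative for \<open>k \<notin> J\<close>, because \<open>\<kappa> k\<close> vanishes on \<open>W\<close> then.\<close>

definition qcoord :: "'i \<Rightarrow> 'm set \<Rightarrow> complex" where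
  "qcoord k X = \<kappa> k (SOME x. x \<in> X)"

lemma qcoord_coset:
  assumes "x \<in> carrier V" "k \<in> I - J"
  shows "qcoord k (W +>\<^bsub>V\<^esub> x) = \<kappa> k x"
proof -
  define y where "y = (SOME y. y \<in> W +>\<^bsub>V\<^esub> x)"
  have y: "y \<in> W +>\<^bsub>V\<^esub> x" unfolding y_def using Q.a_rcos_self[OF assms(1)] by (rule someI)
  then obtain w where w: "w \<in> W" "y = w \<oplus>\<^bsub>V\<^esub> x" by (auto simp: a_r_coset_def')
  then have "\<kappa> k y = \<kappa> k w + \<kappa> k x" using assms W_sub by (auto intro: \<kappa>_add)
  also have "\<kappa> k w = 0" using w(1) assms(2) by (simp del: Q.a_Hcarr add: mem_W)
  finally show ?thesis by (simp add: qcoord_def y_def)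
qed

lemma dual_basis_quotient:
  "dual_basis (quotient_space V W) (I - J) (\<lambda>k. W +>\<^bsub>V\<^esub> b k) qcoord"
proof -
  show ?thesis
  proof (intro dual_basis.intro dual_basis_axioms.intro)
    show "vectorspace complex_field (quotient_space V W)" by (rule vectorspace_quotient)
    show "X = \<zero>\<^bsub>quotient_space V W\<^esub>"
      if X: "X \<in> carrier (quotient_space V W)" and 0: "\<And>k. k \<in> I - J \<Longrightarrow> qcoord k X = 0" for X
    proof -
      obtain x where x: "x \<in> carrier V" "X = W +>\<^bsub>V\<^esub> x" using X by (rule coset_cases)
      with 0 have "\<forall>k\<in>I - J. \<kappa> k x = 0" by (simp add: qcoord_coset)
      with x have "x \<in> W" by (simp del: Q.a_Hcarr add: mem_W)
      with x show ?thesis by (simp add: coset_of_mem)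
    qed
    show "qcoord k (X \<oplus>\<^bsub>quotient_space V W\<^esub> Y) = qcoord k X + qcoord k Y"
      if "k \<in> I - J" "X \<in> carrier (quotient_space V W)" "Y \<in> carrier (quotient_space V W)"
      for k X Y
      using that by (auto elim!: coset_cases simp: coset_add qcoord_coset \<kappa>_add)
    show "qcoord k (c \<odot>\<^bsub>quotient_space V W\<^esub> X) = c * qcoord k X"
      if "k \<in> I - J" "X \<in> carrier (quotient_space V W)" for k c X
      using that by (auto elim!: coset_cases simp: coset_smult qcoord_coset \<kappa>_smult)
  qed (use fin in \<open>auto simp: qcoord_coset \<kappa>_b\<close>)
qed

end

text \<open>Coordinates are given by a definite description, which is awkward to compute with. The
  proof works with the relation P x c, meaning that c is a coordinate family of x. It is total
  because the basis spans, single-valued because the basis is independent, and compatible with sums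
  and multiples; linearity of the described functionals follows.\<close>

lemma dual_basis_coord:
  fixes V :: "(complex, 'm) module"
  assumes vs: "vectorspace complex_field V"
    and finI: "finite I" and inj: "inj_on b I" and basis: "vectorspace.basis complex_field V (b ` I)"
  shows "dual_basis V I b (\<lambda>k x. (THE c. c \<in> extensional I \<and>
     x = (\<Oplus>\<^bsub>V\<^esub>k\<in>I. c k \<odot>\<^bsub>V\<^esub> b k)) k)"
proof -
  interpret vectorspace complex_field V by fact
  define P where "P x c \<longleftrightarrow> c \<in> extensional I \<and> x = (\<Oplus>\<^bsub>V\<^esub>k\<in>I. c k \<odot>\<^bsub>V\<^esub> b k)" for x c
  have b: "b k \<in> carrier V" if "k \<in> I" for k
    using basis that by (auto simp: basis_def)
  have sm: "c \<odot>\<^bsub>V\<^esub> x \<in> carrier V" if "x \<in> carrier V" for c x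
    using that by (intro smult_closed) auto
  have lincomb_b: "lincomb a (b ` I) = (\<Oplus>\<^bsub>V\<^esub>k\<in>I. a (b k) \<odot>\<^bsub>V\<^esub> b k)" for a
    unfolding lincomb_def by (subst M.finsum_reindex) (auto simp: inj b sm)
  have ex: "\<exists>c. P x c" if x: "x \<in> carrier V" for x
  proof -
    have "span (b ` I) = {lincomb a (b ` I) |a. a \<in> b ` I \<rightarrow> carrier complex_field}"
      by (rule finite_span) (use finI b in auto)
    moreover have "x \<in> span (b ` I)" using basis x by (simp add: basis_def)
    ultimately obtain a where "x = lincomb a (b ` I)" by blast
    then have "P x (restrict (\<lambda>k. a (b k)) I)"
      by (auto simp: P_def lincomb_b sm b intro!: M.finsum_cong')
    then show ?thesis by blast
  qed
  have P_add: "P (x \<oplus>\<^bsub>V\<^esub> y) (\<lambda>k\<in>I. c k + d k)" if "P x c" "P y d" for x y c d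
  proof -
    have "(\<Oplus>\<^bsub>V\<^esub>k\<in>I. (\<lambda>k\<in>I. c k + d k) k \<odot>\<^bsub>V\<^esub> b k) =
      (\<Oplus>\<^bsub>V\<^esub>k\<in>I. c k \<odot>\<^bsub>V\<^esub> b k \<oplus>\<^bsub>V\<^esub> d k \<odot>\<^bsub>V\<^esub> b k)"
      using smult_l_distr by (intro M.finsum_cong') (auto simp: b sm)
    also have "\<dots> = x \<oplus>\<^bsub>V\<^esub> y"
      using that by (auto simp: P_def b sm intro!: M.finsum_addf)
    finally show ?thesis by (simp add: P_def)
  qed
  have P_smult: "P (a \<odot>\<^bsub>V\<^esub> x) (\<lambda>k\<in>I. a * c k)" if "P x c" for x a c
  proof -
    have "(\<Oplus>\<^bsub>V\<^esub>k\<in>I. (\<lambda>k\<in>I. a * c k) k \<odot>\<^bsub>V\<^esub> b k) =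
      (\<Oplus>\<^bsub>V\<^esub>k\<in>I. a \<odot>\<^bsub>V\<^esub> (c k \<odot>\<^bsub>V\<^esub> b k))"
      using smult_assoc1 by (intro M.finsum_cong') (auto simp: b sm)
    also have "\<dots> = a \<odot>\<^bsub>V\<^esub> x"
      using that finI by (auto simp: P_def b sm intro!: finsum_smult[symmetric])
    finally show ?thesis by (simp add: P_def)
  qed
  have P_b: "P (b k) (\<lambda>j\<in>I. if j = k then 1 else 0)" if "k \<in> I" for k
  proof -
    have "(\<Oplus>\<^bsub>V\<^esub>j\<in>I. (\<lambda>j\<in>I. if j = k then 1 else 0) j \<odot>\<^bsub>V\<^esub> b j) =
      (\<Oplus>\<^bsub>V\<^esub>j\<in>I. if k = j then b j else \<zero>\<^bsub>V\<^esub>)"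
      using smult_one lmult_0 by (intro M.finsum_cong') (auto simp: b)
    also have "\<dots> = b k" using that finI b by (intro M.finsum_singleton) auto
    finally show ?thesis by (simp add: P_def)
  qed
  have P_zero: "c k = 0" if "P \<zero>\<^bsub>V\<^esub> c" "k \<in> I" for c k
  proof -
    \<comment> \<open>\<open>lincomb\<close> takes its coefficients from vectors, so the family c,
      indexed by I, is transported along the inverse of the injective map b.\<close>
    have "lincomb (\<lambda>v. c (inv_into I b v)) (b ` I) = \<zero>\<^bsub>V\<^esub>"
      using that(1) unfolding lincomb_b P_def
      by (auto simp: inv_into_f_f[OF inj] b sm intro!: M.finsum_cong' cong: M.finsum_cong2)
    moreover have "\<not> lin_dep (b ` I)" using basis by (simp add: basis_def)
    ultimately have "(\<lambda>v. c (inv_into I b v)) \<in> b ` I \<rightarrow> {\<zero>\<^bsub>complex_field\<^esub>}"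
      using finI by (intro not_lindepD[of "b ` I" "b ` I"]) auto
    then have "c (inv_into I b (b k)) = 0" using that(2) by (auto simp: Pi_def)
    then show ?thesis using that(2) inj by simp
  qed
  have uniq: "c = d" if "P x c" "P x d" for x c d
  proof (rule extensionalityI[of _ I])
    fix k assume k: "k \<in> I"
    have x: "x \<in> carrier V" using that by (auto simp: P_def b sm intro!: M.finsum_closed)
    \<comment> \<open>The difference of two coordinate families of x is a coordinate family of the
      zero vector, so \<open>P_zero\<close> applies.\<close>
    have "P (x \<oplus>\<^bsub>V\<^esub> (-1) \<odot>\<^bsub>V\<^esub> x) (\<lambda>k\<in>I. c k + (\<lambda>k\<in>I. (-1) * d k) k)"
      by (intro P_add P_smult that)
    moreover have "x \<oplus>\<^bsub>V\<^esub> (-1) \<odot>\<^bsub>V\<^esub> x = \<zero>\<^bsub>V\<^esub>"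
      using smult_l_distr[of 1 "-1" x] smult_one[of x] lmult_0[of x] x by simp
    ultimately show "c k = d k" using P_zero k by force
  qed (use that in \<open>auto simp: P_def\<close>)
  have the: "(THE c. P x c) = c" if "P x c" for x c
    using that uniq by (intro the_equality) blast+
  have P_the: "P x (THE c. P x c)" if "x \<in> carrier V" for x
    using ex[OF that] the by metis
  have "dual_basis V I b (\<lambda>k x. (THE c. P x c) k)"
  proof (intro dual_basis.intro dual_basis_axioms.intro)
    show "vectorspace complex_field V" by fact
    show "finite I" by fact
    show "b k \<in> carrier V" if "k \<in> I" for k by (rule b[OF that])
    show "(THE c. P (x \<oplus>\<^bsub>V\<^esub> y) c) k = (THE c. P x c) k + (THE c. P y c) k"
      if "k \<in> I" "x \<in> carrier V" "y \<in> carrier V" for k x y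
      using the[OF P_add[OF P_the P_the]] that by simp
    show "(THE d. P (c \<odot>\<^bsub>V\<^esub> x) d) k = c * (THE d. P x d) k"
      if "k \<in> I" "x \<in> carrier V" for k c x
      using the[OF P_smult[OF P_the]] that by simp
    show "(THE c. P (b l) c) k = (if k = l then 1 else 0)" if "k \<in> I" "l \<in> I" for k l
      using the[OF P_b] that by simp
    show "x = \<zero>\<^bsub>V\<^esub>" if x: "x \<in> carrier V" and 0: "\<And>k. k \<in> I \<Longrightarrow> (THE c. P x c) k = 0" for x
    proof -
      have "x = (\<Oplus>\<^bsub>V\<^esub>k\<in>I. (THE c. P x c) k \<odot>\<^bsub>V\<^esub> b k)" using P_the[OF x] by (simp add: P_def)
      also have "\<dots> = (\<Oplus>\<^bsub>V\<^esub>k\<in>I. \<zero>\<^bsub>V\<^esub>)"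
        using 0 lmult_0 by (intro M.finsum_cong') (auto simp: b)
      finally show ?thesis by simp
    qed
  qed
  then show ?thesis unfolding P_def .
qed

lemma dual_basis_rep_space:
  assumes "is_rep Q M" "is_indexed_basis Q M b" "i \<in> verts Q"
  shows "dual_basis (rep_space M i) {1..rep_dim M i} (b i) (\<lambda>k x. coord M b i x k)"
  unfolding coord_def
  using assms by (intro dual_basis_coord) (auto simp: is_rep_def is_indexed_basis_def)

section \<open>Morphisms of representations\<close>

lemma rep_hom_carrierI:
  assumes "\<phi> \<in> extensional (verts Q)"
    and "\<And>i. i \<in> verts Q \<Longrightarrow> \<phi> i \<in> extensional (carrier (rep_space M i))"
    and "\<And>i. i \<in> verts Q \<Longrightarrow> linear_map complex_field (rep_space M i) (rep_space N i) (\<phi> i)"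
    and "\<And>a x. a \<in> arcs Q \<Longrightarrow> x \<in> carrier (rep_space M (tail Q a)) \<Longrightarrow>
      \<phi> (head Q a) (rep_map M a x) = rep_map N a (\<phi> (tail Q a) x)"
  shows "\<phi> \<in> carrier (rep_hom Q M N)"
  using assms by (auto simp: rep_hom_def)

lemma rep_hom_ext:
  assumes "\<phi> \<in> carrier (rep_hom Q M N)" "\<psi> \<in> carrier (rep_hom Q M N)"
    and "\<And>i x. i \<in> verts Q \<Longrightarrow> x \<in> carrier (rep_space M i) \<Longrightarrow> \<phi> i x = \<psi> i x"
  shows "\<phi> = \<psi>"
proof (rule extensionalityI[of _ "verts Q"])
  show "\<phi> i = \<psi> i" if "i \<in> verts Q" for i
    by (rule extensionalityI[of _ "carrier (rep_space M i)"])
      (use assms that in \<open>auto simp: rep_hom_def\<close>)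
qed (use assms in \<open>auto simp: rep_hom_def\<close>)

locale rep_pair = wf_digraph Q for Q :: "('v, 'a) pre_digraph" +
  fixes M :: "('v, 'a, 'm) quiver_rep" and N :: "('v, 'a, 'n) quiver_rep"
  assumes M_vs: "i \<in> verts Q \<Longrightarrow> vectorspace complex_field (rep_space M i)"
    and N_vs: "i \<in> verts Q \<Longrightarrow> vectorspace complex_field (rep_space N i)"
    and M_map: "a \<in> arcs Q \<Longrightarrow> x \<in> carrier (rep_space M (tail Q a)) \<Longrightarrow>
      rep_map M a x \<in> carrier (rep_space M (head Q a))"
    and N_lin: "a \<in> arcs Q \<Longrightarrow>
      linear_map complex_field (rep_space N (tail Q a)) (rep_space N (head Q a)) (rep_map N a)"
begin

abbreviation "H \<equiv> rep_hom Q M N"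

lemma rep_hom_lin:
  "\<phi> \<in> carrier H \<Longrightarrow> i \<in> verts Q \<Longrightarrow>
    linear_map complex_field (rep_space M i) (rep_space N i) (\<phi> i)"
  by (simp add: rep_hom_def)

lemma rep_hom_comm:
  "\<phi> \<in> carrier H \<Longrightarrow> a \<in> arcs Q \<Longrightarrow> x \<in> carrier (rep_space M (tail Q a)) \<Longrightarrow>
    \<phi> (head Q a) (rep_map M a x) = rep_map N a (\<phi> (tail Q a) x)"
  by (simp add: rep_hom_def)

lemma rep_hom_closed:
  assumes "\<phi> \<in> carrier H" "i \<in> verts Q" "x \<in> carrier (rep_space M i)"
  shows "\<phi> i x \<in> carrier (rep_space N i)"
proof -
  interpret linear_map complex_field "rep_space M i" "rep_space N i" "\<phi> i"
    by (rule rep_hom_lin) fact+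
  show ?thesis using assms by simp
qed

lemma zero_apply:
  "i \<in> verts Q \<Longrightarrow> x \<in> carrier (rep_space M i) \<Longrightarrow> \<zero>\<^bsub>H\<^esub> i x = \<zero>\<^bsub>rep_space N i\<^esub>"
  by (simp add: rep_hom_def)

lemma add_apply:
  "i \<in> verts Q \<Longrightarrow> x \<in> carrier (rep_space M i) \<Longrightarrow>
    (\<phi> \<oplus>\<^bsub>H\<^esub> \<psi>) i x = \<phi> i x \<oplus>\<^bsub>rep_space N i\<^esub> \<psi> i x"
  by (simp add: rep_hom_def)

lemma smult_apply:
  "i \<in> verts Q \<Longrightarrow> x \<in> carrier (rep_space M i) \<Longrightarrow>
    (c \<odot>\<^bsub>H\<^esub> \<phi>) i x = c \<odot>\<^bsub>rep_space N i\<^esub> \<phi> i x"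
  by (simp add: rep_hom_def)

lemma zero_closed: "\<zero>\<^bsub>H\<^esub> \<in> carrier H"
proof (rule rep_hom_carrierI)
  fix i assume i: "i \<in> verts Q"
  interpret M: vectorspace complex_field "rep_space M i" by (rule M_vs[OF i])
  interpret N: vectorspace complex_field "rep_space N i" by (rule N_vs[OF i])
  show "linear_map complex_field (rep_space M i) (rep_space N i) (\<zero>\<^bsub>H\<^esub> i)"
    using i by (intro linear_map_complexI)
      (simp_all add: M.vectorspace_axioms N.vectorspace_axioms zero_apply M.smult_closed N.rmult_0)
next
  fix a x assume a: "a \<in> arcs Q" and x: "x \<in> carrier (rep_space M (tail Q a))"
  interpret Na: linear_map complex_field "rep_space N (tail Q a)" "rep_space N (head Q a)" "rep_map N a"
    by (rule N_lin[OF a])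
  show "\<zero>\<^bsub>H\<^esub> (head Q a) (rep_map M a x) = rep_map N a (\<zero>\<^bsub>H\<^esub> (tail Q a) x)"
    using a x by (simp add: zero_apply M_map)
qed (simp_all add: rep_hom_def)

lemma add_closed:
  assumes \<phi>: "\<phi> \<in> carrier H" and \<psi>: "\<psi> \<in> carrier H"
  shows "\<phi> \<oplus>\<^bsub>H\<^esub> \<psi> \<in> carrier H"
proof (rule rep_hom_carrierI)
  fix i assume i: "i \<in> verts Q"
  interpret M: vectorspace complex_field "rep_space M i" by (rule M_vs[OF i])
  interpret N: vectorspace complex_field "rep_space N i" by (rule N_vs[OF i])
  interpret F: linear_map complex_field "rep_space M i" "rep_space N i" "\<phi> i"
    by (rule rep_hom_lin[OF \<phi> i])
  interpret G: linear_map complex_field "rep_space M i" "rep_space N i" "\<psi> i"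
    by (rule rep_hom_lin[OF \<psi> i])
  show "linear_map complex_field (rep_space M i) (rep_space N i) ((\<phi> \<oplus>\<^bsub>H\<^esub> \<psi>) i)"
    using i N.smult_r_distr by (intro linear_map_complexI)
      (simp_all add: M.vectorspace_axioms N.vectorspace_axioms add_apply M.smult_closed
        N.M.a_ac)
next
  fix a x assume a: "a \<in> arcs Q" and x: "x \<in> carrier (rep_space M (tail Q a))"
  interpret Na: linear_map complex_field "rep_space N (tail Q a)" "rep_space N (head Q a)" "rep_map N a"
    by (rule N_lin[OF a])
  show "(\<phi> \<oplus>\<^bsub>H\<^esub> \<psi>) (head Q a) (rep_map M a x) = rep_map N a ((\<phi> \<oplus>\<^bsub>H\<^esub> \<psi>) (tail Q a) x)"
    using a x by (simp add: add_apply M_map rep_hom_comm[OF \<phi>] rep_hom_comm[OF \<psi>]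
        rep_hom_closed[OF \<phi>] rep_hom_closed[OF \<psi>])
qed (simp_all add: rep_hom_def)

lemma smult_closed:
  assumes \<phi>: "\<phi> \<in> carrier H"
  shows "c \<odot>\<^bsub>H\<^esub> \<phi> \<in> carrier H"
proof (rule rep_hom_carrierI)
  fix i assume i: "i \<in> verts Q"
  interpret M: vectorspace complex_field "rep_space M i" by (rule M_vs[OF i])
  interpret N: vectorspace complex_field "rep_space N i" by (rule N_vs[OF i])
  interpret F: linear_map complex_field "rep_space M i" "rep_space N i" "\<phi> i"
    by (rule rep_hom_lin[OF \<phi> i])
  show "linear_map complex_field (rep_space M i) (rep_space N i) ((c \<odot>\<^bsub>H\<^esub> \<phi>) i)"
    using i N.smult_r_distr N.smult_assoc1[symmetric] by (intro linear_map_complexI)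
      (simp_all add: M.vectorspace_axioms N.vectorspace_axioms smult_apply M.smult_closed
        N.smult_closed mult.commute)
next
  fix a x assume a: "a \<in> arcs Q" and x: "x \<in> carrier (rep_space M (tail Q a))"
  interpret Na: linear_map complex_field "rep_space N (tail Q a)" "rep_space N (head Q a)" "rep_map N a"
    by (rule N_lin[OF a])
  show "(c \<odot>\<^bsub>H\<^esub> \<phi>) (head Q a) (rep_map M a x) = rep_map N a ((c \<odot>\<^bsub>H\<^esub> \<phi>) (tail Q a) x)"
    using a x by (simp add: smult_apply M_map rep_hom_comm[OF \<phi>] rep_hom_closed[OF \<phi>])
qed (simp_all add: rep_hom_def)

text \<open>Each axiom is inherited pointwise from the spaces of N: morphisms are extensional, so
  \<open>rep_hom_ext\<close> reduces an equation between them to their values on the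
  carriers.\<close>

lemma vectorspace_rep_hom: "vectorspace complex_field H"
proof -
  note apps = zero_apply add_apply smult_apply
  note closed = zero_closed add_closed smult_closed
  show ?thesis
  proof (rule vs_criteria)
    show "field complex_field" by (rule class_field)
    show "\<zero>\<^bsub>H\<^esub> \<in> carrier H" by (rule zero_closed)
    show "\<forall>v w. v \<in> carrier H \<and> w \<in> carrier H \<longrightarrow> v \<oplus>\<^bsub>H\<^esub> w \<in> carrier H"
      by (simp add: add_closed)
    show "\<forall>c v. c \<in> carrier complex_field \<and> v \<in> carrier H \<longrightarrow> c \<odot>\<^bsub>H\<^esub> v \<in> carrier H"
      by (simp add: smult_closed)
    show "\<forall>v\<in>carrier H. \<exists>w\<in>carrier H. v \<oplus>\<^bsub>H\<^esub> w = \<zero>\<^bsub>H\<^esub>"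
    proof
      fix \<phi> assume \<phi>: "\<phi> \<in> carrier H"
      have "\<phi> \<oplus>\<^bsub>H\<^esub> (-1) \<odot>\<^bsub>H\<^esub> \<phi> = \<zero>\<^bsub>H\<^esub>"
      proof (rule rep_hom_ext[where Q = Q and M = M and N = N])
        fix i x assume i: "i \<in> verts Q" and x: "x \<in> carrier (rep_space M i)"
        interpret N: vectorspace complex_field "rep_space N i" by (rule N_vs[OF i])
        have y: "\<phi> i x \<in> carrier (rep_space N i)" by (rule rep_hom_closed[OF \<phi> i x])
        show "(\<phi> \<oplus>\<^bsub>H\<^esub> (-1) \<odot>\<^bsub>H\<^esub> \<phi>) i x = \<zero>\<^bsub>H\<^esub> i x"
          using N.smult_l_distr[of 1 "-1" "\<phi> i x"] N.smult_one[OF y] N.lmult_0[OF y] i x y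
          by (simp add: apps)
      qed (intro closed \<phi>)+
      then show "\<exists>w\<in>carrier H. \<phi> \<oplus>\<^bsub>H\<^esub> w = \<zero>\<^bsub>H\<^esub>" using smult_closed[OF \<phi>] by blast
    qed
    show "\<forall>v w. v \<in> carrier H \<and> w \<in> carrier H \<longrightarrow> v \<oplus>\<^bsub>H\<^esub> w = w \<oplus>\<^bsub>H\<^esub> v"
    proof (intro allI impI, elim conjE)
      fix v w assume v: "v \<in> carrier H" and w: "w \<in> carrier H"
      show "v \<oplus>\<^bsub>H\<^esub> w = w \<oplus>\<^bsub>H\<^esub> v"
      proof (rule rep_hom_ext[where Q = Q and M = M and N = N])
        fix i x assume i: "i \<in> verts Q" and x: "x \<in> carrier (rep_space M i)"
        interpret N: vectorspace complex_field "rep_space N i" by (rule N_vs[OF i])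
        show "(v \<oplus>\<^bsub>H\<^esub> w) i x = (w \<oplus>\<^bsub>H\<^esub> v) i x"
          using i x by (simp add: apps N.M.a_comm rep_hom_closed[OF v] rep_hom_closed[OF w])
      qed (intro closed v w)+
    qed
    show "\<forall>v w x. v \<in> carrier H \<and> w \<in> carrier H \<and> x \<in> carrier H \<longrightarrow>
      v \<oplus>\<^bsub>H\<^esub> w \<oplus>\<^bsub>H\<^esub> x = v \<oplus>\<^bsub>H\<^esub> (w \<oplus>\<^bsub>H\<^esub> x)"
    proof (intro allI impI, elim conjE)
      fix v w u assume v: "v \<in> carrier H" and w: "w \<in> carrier H" and u: "u \<in> carrier H"
      show "v \<oplus>\<^bsub>H\<^esub> w \<oplus>\<^bsub>H\<^esub> u = v \<oplus>\<^bsub>H\<^esub> (w \<oplus>\<^bsub>H\<^esub> u)"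
      proof (rule rep_hom_ext[where Q = Q and M = M and N = N])
        fix i x assume i: "i \<in> verts Q" and x: "x \<in> carrier (rep_space M i)"
        interpret N: vectorspace complex_field "rep_space N i" by (rule N_vs[OF i])
        show "(v \<oplus>\<^bsub>H\<^esub> w \<oplus>\<^bsub>H\<^esub> u) i x = (v \<oplus>\<^bsub>H\<^esub> (w \<oplus>\<^bsub>H\<^esub> u)) i x"
          using i x by (simp add: apps N.M.a_assoc rep_hom_closed[OF v] rep_hom_closed[OF w]
              rep_hom_closed[OF u])
      qed (intro closed v w u)+
    qed
    show "\<forall>v\<in>carrier H. v \<oplus>\<^bsub>H\<^esub> \<zero>\<^bsub>H\<^esub> = v"
    proof
      fix v assume v: "v \<in> carrier H"
      show "v \<oplus>\<^bsub>H\<^esub> \<zero>\<^bsub>H\<^esub> = v"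
      proof (rule rep_hom_ext[where Q = Q and M = M and N = N])
        fix i x assume i: "i \<in> verts Q" and x: "x \<in> carrier (rep_space M i)"
        interpret N: vectorspace complex_field "rep_space N i" by (rule N_vs[OF i])
        show "(v \<oplus>\<^bsub>H\<^esub> \<zero>\<^bsub>H\<^esub>) i x = v i x" using i x by (simp add: apps rep_hom_closed[OF v])
      qed (intro closed v)+
    qed
    show "\<forall>a b v. a \<in> carrier complex_field \<and> b \<in> carrier complex_field \<and> v \<in> carrier H \<longrightarrow>
      (a \<otimes>\<^bsub>complex_field\<^esub> b) \<odot>\<^bsub>H\<^esub> v = a \<odot>\<^bsub>H\<^esub> (b \<odot>\<^bsub>H\<^esub> v)"
    proof (intro allI impI, elim conjE)
      fix a b v assume v: "v \<in> carrier H"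
      show "(a \<otimes>\<^bsub>complex_field\<^esub> b) \<odot>\<^bsub>H\<^esub> v = a \<odot>\<^bsub>H\<^esub> (b \<odot>\<^bsub>H\<^esub> v)"
      proof (rule rep_hom_ext[where Q = Q and M = M and N = N])
        fix i x assume i: "i \<in> verts Q" and x: "x \<in> carrier (rep_space M i)"
        interpret N: vectorspace complex_field "rep_space N i" by (rule N_vs[OF i])
        show "((a \<otimes>\<^bsub>complex_field\<^esub> b) \<odot>\<^bsub>H\<^esub> v) i x = (a \<odot>\<^bsub>H\<^esub> (b \<odot>\<^bsub>H\<^esub> v)) i x"
          using i x N.smult_assoc1[of a b "v i x"] by (simp add: apps rep_hom_closed[OF v])
      qed (intro closed v)+
    qed
    show "\<forall>v\<in>carrier H. \<one>\<^bsub>complex_field\<^esub> \<odot>\<^bsub>H\<^esub> v = v"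
    proof
      fix v assume v: "v \<in> carrier H"
      show "\<one>\<^bsub>complex_field\<^esub> \<odot>\<^bsub>H\<^esub> v = v"
      proof (rule rep_hom_ext[where Q = Q and M = M and N = N])
        fix i x assume i: "i \<in> verts Q" and x: "x \<in> carrier (rep_space M i)"
        interpret N: vectorspace complex_field "rep_space N i" by (rule N_vs[OF i])
        show "(\<one>\<^bsub>complex_field\<^esub> \<odot>\<^bsub>H\<^esub> v) i x = v i x"
          using i x N.smult_one[of "v i x"] by (simp add: apps rep_hom_closed[OF v])
      qed (intro closed v)+
    qed
    show "\<forall>a b v. a \<in> carrier complex_field \<and> b \<in> carrier complex_field \<and> v \<in> carrier H \<longrightarrow>
      (a \<oplus>\<^bsub>complex_field\<^esub> b) \<odot>\<^bsub>H\<^esub> v = a \<odot>\<^bsub>H\<^esub> v \<oplus>\<^bsub>H\<^esub> b \<odot>\<^bsub>H\<^esub> v"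
    proof (intro allI impI, elim conjE)
      fix a b v assume v: "v \<in> carrier H"
      show "(a \<oplus>\<^bsub>complex_field\<^esub> b) \<odot>\<^bsub>H\<^esub> v = a \<odot>\<^bsub>H\<^esub> v \<oplus>\<^bsub>H\<^esub> b \<odot>\<^bsub>H\<^esub> v"
      proof (rule rep_hom_ext[where Q = Q and M = M and N = N])
        fix i x assume i: "i \<in> verts Q" and x: "x \<in> carrier (rep_space M i)"
        interpret N: vectorspace complex_field "rep_space N i" by (rule N_vs[OF i])
        show "((a \<oplus>\<^bsub>complex_field\<^esub> b) \<odot>\<^bsub>H\<^esub> v) i x = (a \<odot>\<^bsub>H\<^esub> v \<oplus>\<^bsub>H\<^esub> b \<odot>\<^bsub>H\<^esub> v) i x"
          using i x N.smult_l_distr[of a b "v i x"] by (simp add: apps rep_hom_closed[OF v])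
      qed (intro closed v)+
    qed
    show "\<forall>a v w. a \<in> carrier complex_field \<and> v \<in> carrier H \<and> w \<in> carrier H \<longrightarrow>
      a \<odot>\<^bsub>H\<^esub> (v \<oplus>\<^bsub>H\<^esub> w) = a \<odot>\<^bsub>H\<^esub> v \<oplus>\<^bsub>H\<^esub> a \<odot>\<^bsub>H\<^esub> w"
    proof (intro allI impI, elim conjE)
      fix a v w assume v: "v \<in> carrier H" and w: "w \<in> carrier H"
      show "a \<odot>\<^bsub>H\<^esub> (v \<oplus>\<^bsub>H\<^esub> w) = a \<odot>\<^bsub>H\<^esub> v \<oplus>\<^bsub>H\<^esub> a \<odot>\<^bsub>H\<^esub> w"
      proof (rule rep_hom_ext[where Q = Q and M = M and N = N])
        fix i x assume i: "i \<in> verts Q" and x: "x \<in> carrier (rep_space M i)"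
        interpret N: vectorspace complex_field "rep_space N i" by (rule N_vs[OF i])
        show "(a \<odot>\<^bsub>H\<^esub> (v \<oplus>\<^bsub>H\<^esub> w)) i x = (a \<odot>\<^bsub>H\<^esub> v \<oplus>\<^bsub>H\<^esub> a \<odot>\<^bsub>H\<^esub> w) i x"
          using i x N.smult_r_distr[of a "v i x" "w i x"]
          by (simp add: apps rep_hom_closed[OF v] rep_hom_closed[OF w])
      qed (intro closed v w)+
    qed
  qed
qed

end

section \<open>Walks in full subquivers\<close>

lemma awalk_verts_induce [simp]:
  "pre_digraph.awalk_verts (G \<restriction> Y) = pre_digraph.awalk_verts G"
proof (intro ext)
  show "pre_digraph.awalk_verts (G \<restriction> Y) u p = pre_digraph.awalk_verts G u p" for u p
    by (induction p arbitrary: u) (simp_all add: pre_digraph.awalk_verts.simps)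
qed

lemma cas_induce [simp]: "pre_digraph.cas (G \<restriction> Y) = pre_digraph.cas G"
proof (intro ext)
  show "pre_digraph.cas (G \<restriction> Y) u p v = pre_digraph.cas G u p v" for u p v
    by (induction p arbitrary: u) (simp_all add: pre_digraph.cas.simps)
qed

lemma induce_induce: "Z \<subseteq> Y \<Longrightarrow> (G \<restriction> Y) \<restriction> Z = G \<restriction> Z"
  by (auto simp: induce_subgraph_def)

text \<open>The number of vertices over i on a path can be read off from its projection. Two paths
  with the same projection therefore use equally many basis vectors at every vertex of Q, which is
  why exchanging them preserves the dimension vector.\<close>

lemma card_fiber:
  fixes xs :: "('v \<times> nat) list"
  assumes "distinct xs"
  shows "card {k. (i, k) \<in> set xs} = length (filter (\<lambda>j. j = i) (map fst xs))"
proof -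
  have "{k. (i, k) \<in> set xs} = snd ` set (filter (\<lambda>x. fst x = i) xs)"
    by force
  also have "card \<dots> = card (set (filter (\<lambda>x. fst x = i) xs))"
    by (intro card_image inj_onI) (auto simp: prod_eq_iff)
  also have "\<dots> = length (filter (\<lambda>x. fst x = i) xs)"
    by (intro distinct_card distinct_filter assms)
  also have "\<dots> = length (filter (\<lambda>j. j = i) (map fst xs))"
    by (simp add: filter_map o_def)
  finally show ?thesis .
qed

context wf_digraph
begin

lemma awalk_verts_nth:
  assumes "awalk u p v" "n < length p"
  shows "p ! n \<in> arcs G" "awalk_verts u p ! n = tail G (p ! n)"
    "awalk_verts u p ! Suc n = head G (p ! n)"
  using assms
proof (induction p arbitrary: u n)
  case (Cons f p)
  {
    case 1
    then show ?case using Cons by (cases n) (auto simp: awalk_Cons_iff)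
  next
    case 2
    then show ?case using Cons by (cases n) (auto simp: awalk_Cons_iff)
  next
    case 3
    then show ?case using Cons by (cases n; cases p) (auto simp: awalk_Cons_iff)
  }
qed auto

lemma awalk_verts_nth_0: "awalk u p v \<Longrightarrow> awalk_verts u p ! 0 = u"
  by (cases p) (auto simp: awalk_Cons_iff)

lemma awalk_verts_nth_last: "awalk u p v \<Longrightarrow> awalk_verts u p ! length p = v"
  by (induction p arbitrary: u) (auto simp: awalk_Cons_iff awalk_Nil_iff)

lemma mem_awalk_verts:
  "x \<in> set (awalk_verts u p) \<longleftrightarrow> (\<exists>n\<le>length p. x = awalk_verts u p ! n)"
  by (auto simp: in_set_conv_nth length_awalk_verts less_Suc_eq_le)

lemma awalk_induce_iff:
  "pre_digraph.awalk (G \<restriction> Y) u p v \<longleftrightarrow> awalk u p v \<and> set (awalk_verts u p) \<subseteq> Y"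
  if "Y \<subseteq> verts G"
proof
  assume L: "pre_digraph.awalk (G \<restriction> Y) u p v"
  then have w: "awalk u p v" using that
    by (auto simp: pre_digraph.awalk_def)
  moreover have "awalk_verts u p ! n \<in> Y" if "n \<le> length p" for n
  proof (cases "n < length p")
    case True
    then have "p ! n \<in> arcs (G \<restriction> Y)"
      using L nth_mem[OF True] unfolding pre_digraph.awalk_def by blast
    then show ?thesis using awalk_verts_nth[OF w True] by auto
  next
    case False
    then have n: "n = length p" using that by simp
    show ?thesis
    proof (cases p rule: rev_cases)
      case Nil
      then show ?thesis using n L by (auto simp: pre_digraph.awalk_def)
    next
      case (snoc q f)
      then have "f \<in> arcs (G \<restriction> Y)" using L by (auto simp: pre_digraph.awalk_def)
      then show ?thesis using awalk_verts_nth[OF w, of "length q"] n snoc by auto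
    qed
  qed
  ultimately show "awalk u p v \<and> set (awalk_verts u p) \<subseteq> Y"
    by (auto simp: mem_awalk_verts)
next
  assume R: "awalk u p v \<and> set (awalk_verts u p) \<subseteq> Y"
  then have w: "awalk u p v" and sub: "\<And>n. n \<le> length p \<Longrightarrow> awalk_verts u p ! n \<in> Y"
    by (metis mem_awalk_verts subsetD)+
  have "f \<in> arcs (G \<restriction> Y)" if f: "f \<in> set p" for f
  proof -
    obtain n where n: "n < length p" "f = p ! n" using f by (auto simp: in_set_conv_nth)
    with awalk_verts_nth[OF w n(1)] sub[of n] sub[of "Suc n"] show ?thesis by auto
  qed
  moreover have "u \<in> Y" using sub[of 0] awalk_verts_nth_0[OF w] by simp
  ultimately show "pre_digraph.awalk (G \<restriction> Y) u p v"
    using w by (auto simp: pre_digraph.awalk_def)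
qed

lemma connected_awalk_verts:
  assumes "awalk u p v"
  shows "Digraph_Component.connected (G \<restriction> set (awalk_verts u p))"
proof -
  let ?Y = "set (awalk_verts u p)"
  have Y: "?Y \<subseteq> verts G" using assms by auto
  then interpret Y: wf_digraph "G \<restriction> ?Y" by (intro wellformed_induce_subgraph)
  have "Y.awalk u p v" using assms awalk_induce_iff[OF Y] by blast
  from Y.sym_reachableI_in_awalk[OF this]
  show ?thesis by (auto simp: Digraph_Component.connected_def strongly_connected_def)
qed

end

section \<open>Strings and mutation paths\<close>

text \<open>Only the local shape of a union of strings is kept: at most one arrow into and out of
  each vertex, and a rank that grows by one along arrows and so excludes oriented cycles.
  \<open>proj_tail\<close> and \<open>proj_head\<close> express compatibility with the projection to
  Q without mentioning Q.\<close>

locale string_quiver = fin_digraph G for G :: "('v, 'a) coeff_quiver" +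
  fixes r :: "'v \<times> nat \<Rightarrow> nat"
  assumes out_unique: "f \<in> arcs G \<Longrightarrow> g \<in> arcs G \<Longrightarrow> tail G f = tail G g \<Longrightarrow> f = g"
    and in_unique: "f \<in> arcs G \<Longrightarrow> g \<in> arcs G \<Longrightarrow> head G f = head G g \<Longrightarrow> f = g"
    and rank: "f \<in> arcs G \<Longrightarrow> r (head G f) = Suc (r (tail G f))"
    and proj_tail: "f \<in> arcs G \<Longrightarrow> g \<in> arcs G \<Longrightarrow> fst f = fst g \<Longrightarrow> fst (tail G f) = fst (tail G g)"
    and proj_head: "f \<in> arcs G \<Longrightarrow> g \<in> arcs G \<Longrightarrow> fst f = fst g \<Longrightarrow> fst (head G f) = fst (head G g)"
begin

lemma awalk_verts_rank:
  assumes "awalk u p v" "n \<le> length p"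
  shows "r (awalk_verts u p ! n) = r u + n"
  using assms(2)
proof (induction n)
  case 0
  then show ?case using awalk_verts_nth_0[OF assms(1)] by simp
next
  case (Suc n)
  then show ?case using awalk_verts_nth[OF assms(1), of n] rank by simp
qed

lemma distinct_awalk_verts: "awalk u p v \<Longrightarrow> distinct (awalk_verts u p)"
proof -
  assume w: "awalk u p v"
  have "inj_on (\<lambda>n. awalk_verts u p ! n) {..length p}"
  proof (rule inj_onI)
    fix n m assume "n \<in> {..length p}" "m \<in> {..length p}"
      and "awalk_verts u p ! n = awalk_verts u p ! m"
    then have "r u + n = r u + m" using awalk_verts_rank[OF w] by (metis atMost_iff)
    then show "n = m" by simp
  qed
  then show "distinct (awalk_verts u p)"
    by (simp add: distinct_conv_nth length_awalk_verts less_Suc_eq_le inj_on_eq_iff)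
qed

text \<open>Outgoing arrows are unique, so a walk is determined by its start and its length.\<close>

lemma awalk_prefix:
  assumes "awalk u p v" "awalk u q w" "length p \<le> length q"
  shows "p = take (length p) q"
  using assms
proof (induction p arbitrary: u q)
  case (Cons f p)
  then obtain g q' where q: "q = g # q'" by (cases q) auto
  with Cons.prems out_unique have "f = g" by (auto simp: awalk_Cons_iff)
  moreover have "p = take (length p) q'"
    using Cons.IH[of "head G f" q'] Cons.prems q \<open>f = g\<close> by (simp add: awalk_Cons_iff)
  ultimately show ?case using q by simp
qed simp

lemma is_string_iff:
  assumes "Y \<subseteq> verts G"
  shows "is_string (G \<restriction> Y) u p \<longleftrightarrow> (\<exists>v. awalk u p v) \<and> Y = set (awalk_verts u p)"
proof
  assume "is_string (G \<restriction> Y) u p"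
  then show "(\<exists>v. awalk u p v) \<and> Y = set (awalk_verts u p)"
    using awalk_induce_iff[OF assms] by (auto simp: is_string_def pre_digraph.apath_def)
next
  assume R: "(\<exists>v. awalk u p v) \<and> Y = set (awalk_verts u p)"
  then obtain v where w: "awalk u p v" and Y: "Y = set (awalk_verts u p)" by blast
  have wY: "pre_digraph.awalk (G \<restriction> Y) u p v" using w Y awalk_induce_iff[OF assms] by blast
  \<comment> \<open>The full subquiver on the vertices of a walk has no arrows beyond those of the
    walk: an arrow raises the rank by one, so it joins consecutive vertices, and it is then the
    unique arrow leaving the first of them.\<close>
  have "f \<in> set p" if f: "f \<in> arcs G" "tail G f \<in> Y" "head G f \<in> Y" for f
  proof -
    obtain n where n: "n \<le> length p" "tail G f = awalk_verts u p ! n"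
      using f(2) Y by (auto simp: mem_awalk_verts)
    obtain m where m: "m \<le> length p" "head G f = awalk_verts u p ! m"
      using f(3) Y by (auto simp: mem_awalk_verts)
    have "m = Suc n"
      using rank[OF f(1)] awalk_verts_rank[OF w n(1)] awalk_verts_rank[OF w m(1)] n m by simp
    then have "n < length p" using m by simp
    with awalk_verts_nth[OF w this] n out_unique[OF f(1)] have "f = p ! n" by metis
    with \<open>n < length p\<close> show ?thesis by simp
  qed
  moreover have "set p \<subseteq> arcs (G \<restriction> Y)" using wY by (simp add: pre_digraph.awalk_def)
  ultimately have "arcs (G \<restriction> Y) = set p" by auto
  then show "is_string (G \<restriction> Y) u p"
    unfolding is_string_def pre_digraph.apath_def
    using wY distinct_awalk_verts[OF w]
    by (intro conjI exI[of _ v]) (simp_all add: Y[symmetric] del: induce_subgraph_arcs)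
qed

text \<open>The number of vertices gives the length, and the start is the vertex of least rank.
  Consequently the removed and added vertex sets of a mutation determine its two paths.\<close>

lemma awalk_verts_set_unique:
  assumes "awalk u p v" "awalk u' p' v'" "set (awalk_verts u p) = set (awalk_verts u' p')"
  shows "u = u'" "p = p'"
proof -
  have "length (awalk_verts u p) = length (awalk_verts u' p')"
    using assms distinct_awalk_verts by (metis distinct_card)
  then have len: "length p = length p'" by (simp add: length_awalk_verts)
  have "u \<in> set (awalk_verts u' p')" "u' \<in> set (awalk_verts u p)"
    using assms hd_in_awalk_verts(1) by blast+
  then obtain n m where n: "n \<le> length p'" "u = awalk_verts u' p' ! n"
    and m: "m \<le> length p" "u' = awalk_verts u p ! m" by (auto simp: mem_awalk_verts)
  have "r u = r u' + n" "r u' = r u + m"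
    using awalk_verts_rank[OF assms(1) m(1)] awalk_verts_rank[OF assms(2) n(1)]
    by (simp_all add: n(2)[symmetric] m(2)[symmetric])
  then have "n = 0" by simp
  then show u: "u = u'" using n awalk_verts_nth_0[OF assms(2)] by simp
  show "p = p'" using awalk_prefix[of u p v p' v'] assms(1,2) len u by simp
qed

end

locale closed_subquiver = string_quiver G r for G :: "('v, 'a) coeff_quiver" and r +
  fixes X :: "('v \<times> nat) set"
  assumes X_sub: "X \<subseteq> verts G"
    and X_closed: "f \<in> arcs G \<Longrightarrow> tail G f \<in> X \<Longrightarrow> head G f \<in> X"
begin

text \<open>Every entry mentioned here has its first index in X and its second outside X, over one
  vertex of Q, because X is successor closed. Nothing is asked when \<open>head G g\<close> lies in
  X: the corresponding basis vector then has class zero in M/U.\<close>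

definition hom_matrix :: "('v \<times> nat \<Rightarrow> 'v \<times> nat \<Rightarrow> complex) \<Rightarrow> bool" where
  "hom_matrix c \<longleftrightarrow>
     (\<forall>f\<in>arcs G. \<forall>g\<in>arcs G. fst f = fst g \<longrightarrow> tail G f \<in> X \<longrightarrow> head G g \<notin> X \<longrightarrow>
        c (tail G f) (tail G g) = c (head G f) (head G g)) \<and>
     (\<forall>g\<in>arcs G. \<forall>x\<in>X. fst x = fst (tail G g) \<longrightarrow> head G g \<notin> X \<longrightarrow>
        (\<forall>f\<in>arcs G. tail G f = x \<longrightarrow> fst f \<noteq> fst g) \<longrightarrow> c x (tail G g) = 0) \<and>
     (\<forall>f\<in>arcs G. \<forall>y\<in>verts G - X. fst y = fst (head G f) \<longrightarrow> tail G f \<in> X \<longrightarrow>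
        (\<forall>g\<in>arcs G. head G g = y \<longrightarrow> fst g \<noteq> fst f) \<longrightarrow> c (head G f) y = 0)"

lemma hom_matrixD:
  assumes "hom_matrix c"
  shows "f \<in> arcs G \<Longrightarrow> g \<in> arcs G \<Longrightarrow> fst f = fst g \<Longrightarrow> tail G f \<in> X \<Longrightarrow> head G g \<notin> X \<Longrightarrow>
      c (tail G f) (tail G g) = c (head G f) (head G g)"
    and "g \<in> arcs G \<Longrightarrow> x \<in> X \<Longrightarrow> fst x = fst (tail G g) \<Longrightarrow> head G g \<notin> X \<Longrightarrow>
      (\<And>f. f \<in> arcs G \<Longrightarrow> tail G f = x \<Longrightarrow> fst f \<noteq> fst g) \<Longrightarrow> c x (tail G g) = 0"
    and "f \<in> arcs G \<Longrightarrow> y \<in> verts G - X \<Longrightarrow> fst y = fst (head G f) \<Longrightarrow> tail G f \<in> X \<Longrightarrow>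
      (\<And>g. g \<in> arcs G \<Longrightarrow> head G g = y \<Longrightarrow> fst g \<noteq> fst f) \<Longrightarrow> c (head G f) y = 0"
proof -
  note c = assms[unfolded hom_matrix_def]
  show "c (tail G f) (tail G g) = c (head G f) (head G g)"
    if "f \<in> arcs G" "g \<in> arcs G" "fst f = fst g" "tail G f \<in> X" "head G g \<notin> X"
    by (rule c[THEN conjunct1, THEN bspec, THEN bspec, THEN mp, THEN mp, THEN mp, OF that])
  show "c x (tail G g) = 0"
    if "g \<in> arcs G" "x \<in> X" "fst x = fst (tail G g)" "head G g \<notin> X"
      "\<And>f. f \<in> arcs G \<Longrightarrow> tail G f = x \<Longrightarrow> fst f \<noteq> fst g"
  proof -
    have "\<forall>f\<in>arcs G. tail G f = x \<longrightarrow> fst f \<noteq> fst g" using that(5) by blast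
    from c[THEN conjunct2, THEN conjunct1, THEN bspec, THEN bspec, THEN mp, THEN mp, THEN mp,
        OF that(1-4) this] show ?thesis .
  qed
  show "c (head G f) y = 0"
    if "f \<in> arcs G" "y \<in> verts G - X" "fst y = fst (head G f)" "tail G f \<in> X"
      "\<And>g. g \<in> arcs G \<Longrightarrow> head G g = y \<Longrightarrow> fst g \<noteq> fst f"
  proof -
    have "\<forall>g\<in>arcs G. head G g = y \<longrightarrow> fst g \<noteq> fst f" using that(5) by blast
    from c[THEN conjunct2, THEN conjunct2, THEN bspec, THEN bspec, THEN mp, THEN mp, THEN mp,
        OF that(1-4) this] show ?thesis .
  qed
qed

text \<open>A mutation in local terms. That u has no predecessor in X is what permits removing the
  first path; that the end v' has its successors in X is what permits adding the second. Closedness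
  of the exchanged set is deliberately not part of the definition; it is proved in
  \<open>mut_target_closed\<close>.\<close>

definition mut_path :: "'v \<times> nat \<Rightarrow> ('a \<times> nat \<times> nat) list \<Rightarrow> 'v \<times> nat \<Rightarrow> ('a \<times> nat \<times> nat) list \<Rightarrow> bool"
  where
  "mut_path u p u' p' \<longleftrightarrow>
     (\<exists>v v'. awalk u p v \<and> awalk u' p' v' \<and> (\<forall>f\<in>arcs G. tail G f = v' \<longrightarrow> head G f \<in> X)) \<and>
     u \<in> X \<and> set (awalk_verts u' p') \<inter> X = {} \<and> fst u = fst u' \<and> map fst p = map fst p' \<and>
     (\<forall>f\<in>arcs G. head G f = u \<longrightarrow> tail G f \<notin> X)"

definition matched ::
  "'v \<times> nat \<Rightarrow> ('a \<times> nat \<times> nat) list \<Rightarrow> 'v \<times> nat \<Rightarrow> ('a \<times> nat \<times> nat) list \<Rightarrow>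
    'v \<times> nat \<Rightarrow> 'v \<times> nat \<Rightarrow> bool" where
  "matched u p u' p' x y \<longleftrightarrow>
     (\<exists>n\<le>length p. x = awalk_verts u p ! n \<and> y = awalk_verts u' p' ! n)"

lemma awalk_verts_X:
  assumes "awalk u p v" "u \<in> X"
  shows "set (awalk_verts u p) \<subseteq> X"
proof -
  have "awalk_verts u p ! n \<in> X" if "n \<le> length p" for n
    using that
  proof (induction n)
    case 0
    then show ?case using awalk_verts_nth_0[OF assms(1)] assms by simp
  next
    case (Suc n)
    then show ?case using awalk_verts_nth[OF assms(1), of n] X_closed by simp
  qed
  then show ?thesis by (auto simp: mem_awalk_verts)
qed

text \<open>A nonzero entry propagates backwards to a pair whose first vertex has no predecessor
  in \<open>X\<close>, and forwards until the second vertex has no successor outside \<open>X\<close>.\<close>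

lemma hom_matrix_forward:
  assumes c: "hom_matrix c" and "x \<in> X" "y \<in> verts G - X" "fst x = fst y" "c x y \<noteq> 0"
  shows "\<exists>p p' v v'. awalk x p v \<and> awalk y p' v' \<and> (\<forall>f\<in>arcs G. tail G f = v' \<longrightarrow> head G f \<in> X) \<and>
    set (awalk_verts y p') \<inter> X = {} \<and> map fst p = map fst p'"
  using assms(2-5)
proof (induction "Max (r ` verts G) - r x" arbitrary: x y rule: less_induct)
  case less
  show ?case
  proof (cases "\<forall>f\<in>arcs G. tail G f = y \<longrightarrow> head G f \<in> X")
    case True
    then show ?thesis using less X_sub
      by (intro exI[of _ "[]"] exI[of _ x] exI[of _ y]) (auto simp: awalk_Nil_iff)
  next
    case False
    then obtain g where g: "g \<in> arcs G" "tail G g = y" "head G g \<notin> X" by blast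
    \<comment> \<open>Without such an arrow the second clause of \<open>hom_matrix\<close> would
      force the entry at (x, y) to vanish.\<close>
    obtain f where f: "f \<in> arcs G" "tail G f = x" "fst f = fst g"
      using c g less.prems unfolding hom_matrix_def by metis
    have "c (head G f) (head G g) = c x y"
      using c f g less.prems unfolding hom_matrix_def by metis
    moreover have hX: "head G f \<in> X" using X_closed f less.prems by blast
    \<comment> \<open>The first vertex stays in X, where ranks are bounded, and its rank grows with
      every step.\<close>
    moreover have "Max (r ` verts G) - r (head G f) < Max (r ` verts G) - r x"
    proof -
      have "r (head G f) \<le> Max (r ` verts G)" using hX X_sub by auto
      then show ?thesis using rank[OF f(1)] f by simp
    qed
    ultimately have "\<exists>p p' v v'. awalk (head G f) p v \<and> awalk (head G g) p' v' \<and>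
        (\<forall>f\<in>arcs G. tail G f = v' \<longrightarrow> head G f \<in> X) \<and>
        set (awalk_verts (head G g) p') \<inter> X = {} \<and> map fst p = map fst p'"
    proof (intro less.hyps)
      show "head G g \<in> verts G - X" using g by simp
      show "fst (head G f) = fst (head G g)" using f g by (intro proj_head)
    qed (use less.prems in auto)
    then obtain p p' v v' where "awalk (head G f) p v" "awalk (head G g) p' v'"
        "\<forall>f\<in>arcs G. tail G f = v' \<longrightarrow> head G f \<in> X"
        "set (awalk_verts (head G g) p') \<inter> X = {}" "map fst p = map fst p'" by blast
    then show ?thesis using f g less.prems
      by (intro exI[of _ "f # p"] exI[of _ "g # p'"] exI[of _ v] exI[of _ v'])
        (auto simp: awalk_Cons_iff)
  qed
qed

lemma hom_matrix_nonzero: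
  assumes c: "hom_matrix c" and xy: "x \<in> X" "y \<in> verts G - X" "fst x = fst y" "c x y \<noteq> 0"
  shows "\<exists>u p u' p'. mut_path u p u' p' \<and> c u u' \<noteq> 0"
proof -
  \<comment> \<open>Backward propagation is done by choosing a nonzero entry whose first vertex has
    least rank. If that vertex had a predecessor in X, the third clause of \<open>hom_matrix\<close>
    would provide a parallel arrow into the second vertex, and the pair of tails would carry the
    same nonzero entry at smaller rank.\<close>
  define P where "P = (\<lambda>(x, y). x \<in> X \<and> y \<in> verts G - X \<and> fst x = fst y \<and> c x y \<noteq> 0)"
  have "P (x, y)" using xy by (simp add: P_def)
  then obtain z where "P z" and min: "\<And>z'. P z' \<Longrightarrow> r (fst z) \<le> r (fst z')"
    using ex_has_least_nat[of P "(x, y)" "\<lambda>z. r (fst z)"] by blast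
  then obtain u u' where z: "z = (u, u')" and u: "u \<in> X" "u' \<in> verts G - X" "fst u = fst u'" "c u u' \<noteq> 0"
    by (cases z) (auto simp: P_def)
  have start: "tail G f \<notin> X" if f: "f \<in> arcs G" "head G f = u" for f
  proof
    assume fX: "tail G f \<in> X"
    obtain g where g: "g \<in> arcs G" "head G g = u'" "fst g = fst f"
      using c f fX u unfolding hom_matrix_def by metis
    then have "c (tail G f) (tail G g) = c u u'"
      using c f fX u unfolding hom_matrix_def by (metis DiffD2)
    moreover have "tail G g \<notin> X" using X_closed g u by blast
    ultimately have "P (tail G f, tail G g)"
      using f g fX u proj_tail[OF f(1) g(1)] by (simp add: P_def wellformed)
    from min[OF this] z show False using rank[OF f(1)] f by simp
  qed
  show ?thesis
    using hom_matrix_forward[OF c u] start u unfolding mut_path_def by blast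
qed

lemma
  assumes m: "mut_path u p u' p'"
  shows mut_path_u: "u \<in> X"
    and mut_path_map: "map fst p' = map fst p"
    and mut_path_fst: "fst u' = fst u"
    and mut_path_not_X: "set (awalk_verts u' p') \<inter> X = {}"
  by (simp_all only: m[unfolded mut_path_def])

lemma mut_path_length: "mut_path u p u' p' \<Longrightarrow> length p' = length p"
  by (rule map_eq_imp_length_eq[OF mut_path_map])

lemma mut_path_start:
  "mut_path u p u' p' \<Longrightarrow> f \<in> arcs G \<Longrightarrow> head G f = u \<Longrightarrow> tail G f \<notin> X"
  unfolding mut_path_def by blast

lemma mut_path_awalk:
  assumes "mut_path u p u' p'"
  obtains v v' where "awalk u p v" "awalk u' p' v'"
    "\<And>f. f \<in> arcs G \<Longrightarrow> tail G f = v' \<Longrightarrow> head G f \<in> X"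
  using assms unfolding mut_path_def by blast

lemma mut_path_fst_nth:
  assumes m: "mut_path u p u' p'" and "n < length p"
  shows "fst (p' ! n) = fst (p ! n)"
  using mut_path_map[OF m] mut_path_length[OF m] assms(2) by (metis nth_map)

text \<open>The end of the second path has its successors in X. An arrow from this path to a vertex
  outside X therefore starts earlier, where uniqueness of outgoing arrows identifies it with the
  next arrow of the path. \<open>mut_path_begin\<close> is the mirror image for the first
  path.\<close>

lemma mut_path_end:
  assumes m: "mut_path u p u' p'" and "n \<le> length p"
    and "f \<in> arcs G" "tail G f = awalk_verts u' p' ! n" "head G f \<notin> X"
  shows "n < length p" "f = p' ! n"
proof -
  obtain v v' where w: "awalk u p v" "awalk u' p' v'"
    and v': "\<And>f. f \<in> arcs G \<Longrightarrow> tail G f = v' \<Longrightarrow> head G f \<in> X"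
    using mut_path_awalk[OF m] by blast
  have "n \<noteq> length p" using v'[OF assms(3)] assms(4,5) awalk_verts_nth_last[OF w(2)]
    by (auto simp: mut_path_length[OF m])
  then show n: "n < length p" using assms(2) by simp
  then show "f = p' ! n"
    using awalk_verts_nth[OF w(2), of n] assms out_unique by (simp add: mut_path_length[OF m])
qed

lemma mut_path_begin:
  assumes m: "mut_path u p u' p'" and "n \<le> length p"
    and "f \<in> arcs G" "head G f = awalk_verts u p ! n" "tail G f \<in> X"
  obtains k where "n = Suc k" "k < length p" "f = p ! k"
proof -
  obtain v v' where w: "awalk u p v" "awalk u' p' v'" using mut_path_awalk[OF m] by blast
  have "n \<noteq> 0"
    using mut_path_start[OF m assms(3)] assms(4,5) awalk_verts_nth_0[OF w(1)] by metis
  then obtain k where k: "n = Suc k" using not0_implies_Suc by blast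
  moreover have "f = p ! k"
    using awalk_verts_nth[OF w(1), of k] k assms in_unique by simp
  ultimately show ?thesis using that assms(2) by simp
qed

text \<open>The two end conditions of \<open>mut_path\<close> make the chain of matched pairs
  maximal. So a simultaneous step has both its pairs on the chain or neither (fact 1), and a step
  available on one side only never starts or ends on the chain (facts 2 and 3).\<close>

lemma hom_matrix_matched:
  assumes m: "mut_path u p u' p'"
  shows "hom_matrix (\<lambda>x y. if matched u p u' p' x y then 1 else 0)"
proof -
  obtain v v' where w: "awalk u p v" "awalk u' p' v'" using mut_path_awalk[OF m] by blast
  note len = mut_path_length[OF m]
  have 1: "matched u p u' p' (tail G f) (tail G g) \<longleftrightarrow> matched u p u' p' (head G f) (head G g)"
    if f: "f \<in> arcs G" "g \<in> arcs G" "fst f = fst g" "tail G f \<in> X" "head G g \<notin> X" for f g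
  proof
    assume "matched u p u' p' (tail G f) (tail G g)"
    then obtain n where n: "n \<le> length p" "tail G f = awalk_verts u p ! n"
      "tail G g = awalk_verts u' p' ! n" by (auto simp: matched_def)
    note e = mut_path_end[OF m n(1) f(2) n(3) f(5)]
    have "f = p ! n" using awalk_verts_nth[OF w(1) e(1)] n f out_unique by simp
    then show "matched u p u' p' (head G f) (head G g)"
      using awalk_verts_nth[OF w(1) e(1)] awalk_verts_nth[OF w(2), of n] e len
      by (auto simp: matched_def intro!: exI[of _ "Suc n"])
  next
    assume "matched u p u' p' (head G f) (head G g)"
    then obtain n where n: "n \<le> length p" "head G f = awalk_verts u p ! n"
      "head G g = awalk_verts u' p' ! n" by (auto simp: matched_def)
    obtain k where k: "n = Suc k" "k < length p" "f = p ! k"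
      using mut_path_begin[OF m n(1) f(1) n(2) f(4)] .
    have "g = p' ! k" using awalk_verts_nth[OF w(2), of k] n k len f in_unique by simp
    then show "matched u p u' p' (tail G f) (tail G g)"
      using awalk_verts_nth[OF w(1) k(2)] awalk_verts_nth[OF w(2), of k] k len
      by (auto simp: matched_def intro!: exI[of _ k])
  qed
  have 2: "\<not> matched u p u' p' x (tail G g)"
    if g: "g \<in> arcs G" "head G g \<notin> X" "\<forall>f\<in>arcs G. tail G f = x \<longrightarrow> fst f \<noteq> fst g" for x g
  proof
    assume "matched u p u' p' x (tail G g)"
    then obtain n where n: "n \<le> length p" "x = awalk_verts u p ! n"
      "tail G g = awalk_verts u' p' ! n" by (auto simp: matched_def)
    note e = mut_path_end[OF m n(1) g(1) n(3) g(2)]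
    show False
      using g(3) awalk_verts_nth[OF w(1) e(1)] n(2) mut_path_fst_nth[OF m e(1)] e(2) by metis
  qed
  have 3: "\<not> matched u p u' p' (head G f) y"
    if f: "f \<in> arcs G" "tail G f \<in> X" "\<forall>g\<in>arcs G. head G g = y \<longrightarrow> fst g \<noteq> fst f" for f y
  proof
    assume "matched u p u' p' (head G f) y"
    then obtain n where n: "n \<le> length p" "head G f = awalk_verts u p ! n"
      "y = awalk_verts u' p' ! n" by (auto simp: matched_def)
    obtain k where k: "n = Suc k" "k < length p" "f = p ! k"
      using mut_path_begin[OF m n(1) f(1) n(2) f(2)] .
    show False
      using f(3) awalk_verts_nth[OF w(2), of k] n(3) k len mut_path_fst_nth[OF m k(2)] by metis
  qed
  show ?thesis unfolding hom_matrix_def using 1 2 3 by auto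
qed

text \<open>The second path has to run until it cannot continue outside X, so the starting vertices
  fix the length. If q' were longer than p', its next arrow would leave the end of p' towards a
  vertex outside X.\<close>

lemma mut_path_maximal:
  assumes m: "mut_path u p u' p'" and m2: "mut_path u q u' q'"
  shows "length q \<le> length p"
proof (rule ccontr)
  assume less: "\<not> length q \<le> length p"
  obtain v v' where w: "awalk u p v" "awalk u' p' v'" using mut_path_awalk[OF m] by blast
  obtain x x' where z: "awalk u q x" "awalk u' q' x'" using mut_path_awalk[OF m2] by blast
  have lp: "length p' = length p" and lq: "length q' = length q"
    using mut_path_length m m2 by blast+
  let ?g = "q' ! length p"
  have n: "length p < length q'" using less lq by simp
  have "p' = take (length p) q'" using awalk_prefix[OF w(2) z(2)] less lp lq by simp
  moreover have "awalk_verts u' (take (length p) q') = take (Suc (length p)) (awalk_verts u' q')"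
    using z(2) by (intro awalk_verts_take_conv) auto
  ultimately have "awalk_verts u' p' = take (Suc (length p)) (awalk_verts u' q')" by simp
  then have "awalk_verts u' p' ! length p = tail G ?g"
    using awalk_verts_nth[OF z(2) n] by simp
  moreover have "head G ?g \<notin> X"
    using awalk_verts_nth[OF z(2) n] mut_path_not_X[OF m2] n
    by (metis Int_iff Suc_leI empty_iff mem_awalk_verts)
  ultimately show False
    using mut_path_end(1)[OF m, of "length p" ?g] awalk_verts_nth[OF z(2) n] by simp
qed

text \<open>This yields the off-diagonal zeros of the dual basis. A position n > 0 of u on the other
  first path would give u a predecessor in X, since that path stays in X; once the starts agree,
  \<open>mut_path_maximal\<close> makes the lengths agree.\<close>

lemma matched_start_unique:
  assumes m: "mut_path u p u' p'" and m2: "mut_path w q w' q'" and "matched w q w' q' u u'"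
  shows "u = w \<and> p = q \<and> u' = w' \<and> p' = q'"
proof -
  obtain v v' where a: "awalk u p v" "awalk u' p' v'" using mut_path_awalk[OF m] by blast
  obtain x x' where z: "awalk w q x" "awalk w' q' x'" using mut_path_awalk[OF m2] by blast
  obtain n where n: "n \<le> length q" "u = awalk_verts w q ! n" "u' = awalk_verts w' q' ! n"
    using assms(3) by (auto simp: matched_def)
  have "n = 0"
  proof (rule ccontr)
    assume "n \<noteq> 0"
    then obtain k where k: "n = Suc k" using not0_implies_Suc by blast
    then have "k < length q" using n by simp
    note e = awalk_verts_nth[OF z(1) this]
    have "tail G (q ! k) \<in> X"
      using awalk_verts_X[OF z(1) mut_path_u[OF m2]] e(2) \<open>k < length q\<close>
      by (metis less_imp_le_nat mem_awalk_verts subsetD)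
    then show False using mut_path_start[OF m e(1)] e(3) n(2) k by simp
  qed
  then have u: "u = w" "u' = w'"
    using n awalk_verts_nth_0[OF z(1)] awalk_verts_nth_0[OF z(2)] by simp_all
  have "length q = length p"
    using mut_path_maximal m m2 unfolding u by (metis le_antisym)
  moreover from this have "length q' = length p'"
    using mut_path_length[OF m] mut_path_length[OF m2] by simp
  ultimately have "p = q" "p' = q'"
    using awalk_prefix[OF a(1), of q x] awalk_prefix[OF a(2), of q' x'] z u by auto
  with u show ?thesis by simp
qed

end

section \<open>Matrices of linear maps\<close>

lemma linear_map_comp:
  assumes "linear_map complex_field V W f" "linear_map complex_field W Z g"
  shows "linear_map complex_field V Z (\<lambda>x. g (f x))"
proof -
  interpret V: vectorspace complex_field V using assms(1) by (simp add: linear_map_def)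
  interpret Z: vectorspace complex_field Z using assms(2) by (simp add: linear_map_def)
  interpret f: linear_map complex_field V W f by fact
  interpret g: linear_map complex_field W Z g by fact
  show ?thesis
    by (rule linear_map_complexI) (use V.vectorspace_axioms Z.vectorspace_axioms in auto)
qed

lemma (in dual_basis) linear_map_finsum:
  assumes W: "vectorspace complex_field W" and J: "J \<subseteq> I"
    and w: "\<And>k. k \<in> J \<Longrightarrow> w k \<in> carrier W"
  shows "linear_map complex_field V W (\<lambda>x. \<Oplus>\<^bsub>W\<^esub>k\<in>J. \<kappa> k x \<odot>\<^bsub>W\<^esub> w k)"
proof (rule linear_map_complexI)
  interpret W: vectorspace complex_field W by fact
  have J_fin: "finite J" using J fin finite_subset by blast
  have sm: "c \<odot>\<^bsub>W\<^esub> x \<in> carrier W" if "x \<in> carrier W" for c x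
    using that by (intro W.smult_closed) auto
  show "vectorspace complex_field V" by (rule vectorspace_axioms)
  show "vectorspace complex_field W" by fact
  show "(\<Oplus>\<^bsub>W\<^esub>k\<in>J. \<kappa> k x \<odot>\<^bsub>W\<^esub> w k) \<in> carrier W" for x
    by (intro W.M.finsum_closed) (auto simp: w sm)
  show "(\<Oplus>\<^bsub>W\<^esub>k\<in>J. \<kappa> k (x \<oplus>\<^bsub>V\<^esub> y) \<odot>\<^bsub>W\<^esub> w k) =
      (\<Oplus>\<^bsub>W\<^esub>k\<in>J. \<kappa> k x \<odot>\<^bsub>W\<^esub> w k) \<oplus>\<^bsub>W\<^esub> (\<Oplus>\<^bsub>W\<^esub>k\<in>J. \<kappa> k y \<odot>\<^bsub>W\<^esub> w k)"
    if "x \<in> carrier V" "y \<in> carrier V" for x y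
  proof -
    have "(\<Oplus>\<^bsub>W\<^esub>k\<in>J. \<kappa> k (x \<oplus>\<^bsub>V\<^esub> y) \<odot>\<^bsub>W\<^esub> w k) =
        (\<Oplus>\<^bsub>W\<^esub>k\<in>J. \<kappa> k x \<odot>\<^bsub>W\<^esub> w k \<oplus>\<^bsub>W\<^esub> \<kappa> k y \<odot>\<^bsub>W\<^esub> w k)"
      using W.smult_l_distr J that by (intro W.M.finsum_cong') (auto simp: w sm \<kappa>_add subset_iff)
    also have "\<dots> = (\<Oplus>\<^bsub>W\<^esub>k\<in>J. \<kappa> k x \<odot>\<^bsub>W\<^esub> w k) \<oplus>\<^bsub>W\<^esub> (\<Oplus>\<^bsub>W\<^esub>k\<in>J. \<kappa> k y \<odot>\<^bsub>W\<^esub> w k)"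
      by (intro W.M.finsum_addf) (auto simp: w sm)
    finally show ?thesis .
  qed
  show "(\<Oplus>\<^bsub>W\<^esub>k\<in>J. \<kappa> k (c \<odot>\<^bsub>V\<^esub> x) \<odot>\<^bsub>W\<^esub> w k) = c \<odot>\<^bsub>W\<^esub> (\<Oplus>\<^bsub>W\<^esub>k\<in>J. \<kappa> k x \<odot>\<^bsub>W\<^esub> w k)"
    if "x \<in> carrier V" for c x
  proof -
    have "(\<Oplus>\<^bsub>W\<^esub>k\<in>J. \<kappa> k (c \<odot>\<^bsub>V\<^esub> x) \<odot>\<^bsub>W\<^esub> w k) = (\<Oplus>\<^bsub>W\<^esub>k\<in>J. c \<odot>\<^bsub>W\<^esub> (\<kappa> k x \<odot>\<^bsub>W\<^esub> w k))"
      using W.smult_assoc1 J that by (intro W.M.finsum_cong') (auto simp: w sm \<kappa>_smult subset_iff)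
    also have "\<dots> = c \<odot>\<^bsub>W\<^esub> (\<Oplus>\<^bsub>W\<^esub>k\<in>J. \<kappa> k x \<odot>\<^bsub>W\<^esub> w k)"
      using J_fin by (intro W.finsum_smult[symmetric]) (auto simp: w sm)
    finally show ?thesis .
  qed
qed

lemma (in dual_basis) matrix_expansion:
  assumes f: "linear_map complex_field V W f" and W: "dual_basis W I' b' \<kappa>'"
    and l: "l \<in> I'" and x: "x \<in> carrier V"
  shows "\<kappa>' l (f x) = (\<Sum>k\<in>I. \<kappa> k x * \<kappa>' l (f (b k)))"
proof -
  interpret W: dual_basis W I' b' \<kappa>' by fact
  interpret f: linear_map complex_field V W f by fact
  have lin: "linear_map complex_field V W (\<lambda>x. \<Oplus>\<^bsub>W\<^esub>k\<in>I. \<kappa> k x \<odot>\<^bsub>W\<^esub> f (b k))"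
    using W.vectorspace_axioms by (intro linear_map_finsum) auto
  have "f x = (\<Oplus>\<^bsub>W\<^esub>k\<in>I. \<kappa> k x \<odot>\<^bsub>W\<^esub> f (b k))"
  proof (rule linear_maps_eqI[OF f lin _ x])
    fix k assume "k \<in> I"
    then have "(\<Oplus>\<^bsub>W\<^esub>j\<in>I. \<kappa> j (b k) \<odot>\<^bsub>W\<^esub> f (b j)) =
      (\<Oplus>\<^bsub>W\<^esub>j\<in>I. if k = j then f (b j) else \<zero>\<^bsub>W\<^esub>)"
      using W.smult_one W.lmult_0 by (intro W.M.finsum_cong') (auto simp: \<kappa>_b)
    also have "\<dots> = f (b k)" using \<open>k \<in> I\<close> fin by (intro W.M.finsum_singleton) auto
    finally show "f (b k) = (\<Oplus>\<^bsub>W\<^esub>j\<in>I. \<kappa> j (b k) \<odot>\<^bsub>W\<^esub> f (b j))" by simp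
  qed
  then have "\<kappa>' l (f x) = \<kappa>' l (\<Oplus>\<^bsub>W\<^esub>k\<in>I. \<kappa> k x \<odot>\<^bsub>W\<^esub> f (b k))" by (rule arg_cong)
  also have "\<dots> = (\<Sum>k\<in>I. \<kappa>' l (\<kappa> k x \<odot>\<^bsub>W\<^esub> f (b k)))"
    using l fin by (intro W.\<kappa>_finsum) auto
  also have "\<dots> = (\<Sum>k\<in>I. \<kappa> k x * \<kappa>' l (f (b k)))"
    by (intro sum.cong refl W.\<kappa>_smult[OF l] f.T_im b_closed)
  finally show ?thesis .
qed

section \<open>Coordinate subrepresentations\<close>

text \<open>The assumption \<open>coordinate\<close> is the form in which torus invariance enters:
  together with an element, U contains every basis vector occurring in it.\<close>

locale coordinate_subrep = fin_digraph Q for Q :: "('v, 'a) pre_digraph" +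
  fixes M :: "('v, 'a, 'm) quiver_rep" and b :: "'v \<Rightarrow> nat \<Rightarrow> 'm" and U :: "'v \<Rightarrow> 'm set"
  assumes rep: "is_rep Q M" and indexed_basis: "is_indexed_basis Q M b"
    and subrep: "is_subrep Q M U"
    and coordinate: "i \<in> verts Q \<Longrightarrow> x \<in> U i \<Longrightarrow> k \<in> {1..rep_dim M i} \<Longrightarrow>
      coord M b i x k \<noteq> 0 \<Longrightarrow> b i k \<in> U i"
begin

abbreviation "I i \<equiv> {1..rep_dim M i}"

definition "J i = {k \<in> I i. b i k \<in> U i}"

text \<open>This is \<open>qcoord\<close> for the subspace at i, as \<open>qcoord_eq\<close>
  records, written with the vertex as an explicit argument.\<close>

definition "qc i k X = coord M b i (SOME x. x \<in> X) k"

abbreviation "N \<equiv> quotient_rep Q M U"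

lemma J_sub: "J i \<subseteq> I i" by (auto simp: J_def)

lemma coordinates: "i \<in> verts Q \<Longrightarrow>
    dual_basis (rep_space M i) (I i) (b i) (\<lambda>k x. coord M b i x k)"
  by (rule dual_basis_rep_space[OF rep indexed_basis])

lemma U_subspace: "i \<in> verts Q \<Longrightarrow> VectorSpace.subspace complex_field (U i) (rep_space M i)"
  using subrep by (simp add: is_subrep_def)

lemma U_map: "a \<in> arcs Q \<Longrightarrow> x \<in> U (tail Q a) \<Longrightarrow> rep_map M a x \<in> U (head Q a)"
  using subrep by (auto simp: is_subrep_def)

lemma map_linear: "a \<in> arcs Q \<Longrightarrow>
    linear_map complex_field (rep_space M (tail Q a)) (rep_space M (head Q a)) (rep_map M a)"
  using rep by (simp add: is_rep_def)

lemma quotient_vs: "i \<in> verts Q \<Longrightarrow> quotient_vs (rep_space M i) (U i)"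
  by (intro quotient_vs.intro quotient_vs_axioms.intro dual_basis.axioms(1)[OF coordinates] U_subspace)

lemma coordinate_subspace:
  assumes i: "i \<in> verts Q"
  shows "coordinate_subspace (rep_space M i) (I i) (b i) (\<lambda>k x. coord M b i x k) (U i) (J i)"
proof -
  interpret dual_basis "rep_space M i" "I i" "b i" "\<lambda>k x. coord M b i x k"
    by (rule coordinates[OF i])
  interpret W: LinearCombinations.submodule complex_field "U i" "rep_space M i"
    using U_subspace[OF i] by (simp add: VectorSpace.subspace_def)
  have "U i = {x \<in> carrier (rep_space M i). \<forall>k\<in>I i - J i. coord M b i x k = 0}" (is "_ = ?R")
  proof
    show "U i \<subseteq> ?R" using W.subset coordinate[OF i] by (auto simp: J_def)
    show "?R \<subseteq> U i"
    proof
      fix x assume x: "x \<in> ?R"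
      have "(\<Oplus>\<^bsub>rep_space M i\<^esub>k\<in>A. coord M b i x k \<odot>\<^bsub>rep_space M i\<^esub> b i k) \<in> U i"
        if "finite A" "A \<subseteq> I i" for A
        using that
      proof (induction A)
        case (insert k A)
        have "coord M b i x k \<odot>\<^bsub>rep_space M i\<^esub> b i k \<in> U i"
        proof (cases "k \<in> J i")
          case True
          then show ?thesis by (intro W.smult_closed) (auto simp: J_def)
        next
          case False
          then have "coord M b i x k = 0" using x insert.prems by auto
          then show ?thesis using lmult_0[of "b i k"] insert.prems W.zero_closed by simp
        qed
        then show ?case using insert by (simp add: subset_iff)
      qed simp
      from this[OF fin subset_refl] expansion[of x] x show "x \<in> U i" by simp
    qed
  qed
  then show ?thesis
    using coordinates[OF i] quotient_vs[OF i] J_sub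
    by (intro coordinate_subspace.intro coordinate_subspace_axioms.intro)
qed

lemma U_carrier: "i \<in> verts Q \<Longrightarrow> x \<in> U i \<Longrightarrow> x \<in> carrier (rep_space M i)"
  by (rule subsetD[OF quotient_vs.W_sub[OF quotient_vs]])

lemma b_closed: "i \<in> verts Q \<Longrightarrow> k \<in> I i \<Longrightarrow> b i k \<in> carrier (rep_space M i)"
  by (rule dual_basis.b_closed[OF coordinates])

lemma sub_dual_basis:
  assumes "i \<in> verts Q"
  shows "dual_basis (rep_space (sub_rep M U) i) (J i) (b i) (\<lambda>k x. coord M b i x k)"
proof -
  have "rep_space (sub_rep M U) i = (rep_space M i)\<lparr>carrier := U i\<rparr>" by (simp add: sub_rep_def)
  then show ?thesis
    using coordinate_subspace.dual_basis_subspace[OF coordinate_subspace[OF assms]] by simp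
qed

lemma qcoord_eq:
  assumes "i \<in> verts Q"
  shows "coordinate_subspace.qcoord (\<lambda>k x. coord M b i x k) = qc i"
  by (intro ext) (simp only: qc_def coordinate_subspace.qcoord_def[OF coordinate_subspace[OF assms]])

lemma quotient_dual_basis:
  assumes "i \<in> verts Q"
  shows "dual_basis (rep_space N i) (I i - J i) (\<lambda>k. U i +>\<^bsub>rep_space M i\<^esub> b i k) (qc i)"
proof -
  have "rep_space N i = quotient_space (rep_space M i) (U i)" by (simp add: quotient_rep_def)
  then show ?thesis
    using coordinate_subspace.dual_basis_quotient[OF coordinate_subspace[OF assms]]
    by (simp only: qcoord_eq[OF assms])
qed

lemma qc_coset:
  assumes i: "i \<in> verts Q" and "x \<in> carrier (rep_space M i)" "k \<in> I i - J i"
  shows "qc i k (U i +>\<^bsub>rep_space M i\<^esub> x) = coord M b i x k"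
  using coordinate_subspace.qcoord_coset[OF coordinate_subspace[OF i] assms(2,3)]
  by (simp only: qcoord_eq[OF i])

text \<open>The union over representatives collapses because differences lying in U are mapped into
  U.\<close>

lemma quotient_map_coset:
  assumes a: "a \<in> arcs Q" and x: "x \<in> carrier (rep_space M (tail Q a))"
  shows "rep_map N a (U (tail Q a) +>\<^bsub>rep_space M (tail Q a)\<^esub> x) =
    U (head Q a) +>\<^bsub>rep_space M (head Q a)\<^esub> rep_map M a x"
proof -
  interpret T: quotient_vs "rep_space M (tail Q a)" "U (tail Q a)" using a by (intro quotient_vs) simp
  interpret H: quotient_vs "rep_space M (head Q a)" "U (head Q a)" using a by (intro quotient_vs) simp
  interpret f: linear_map complex_field "rep_space M (tail Q a)" "rep_space M (head Q a)" "rep_map M a"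
    by (rule map_linear[OF a])
  have "U (head Q a) +>\<^bsub>rep_space M (head Q a)\<^esub> rep_map M a x' =
      U (head Q a) +>\<^bsub>rep_space M (head Q a)\<^esub> rep_map M a x"
    if x': "x' \<in> carrier (rep_space M (tail Q a))"
      and mem: "x' \<ominus>\<^bsub>rep_space M (tail Q a)\<^esub> x \<in> U (tail Q a)" for x'
  proof -
    have "rep_map M a x' \<ominus>\<^bsub>rep_space M (head Q a)\<^esub> rep_map M a x =
        rep_map M a (x' \<ominus>\<^bsub>rep_space M (tail Q a)\<^esub> x)"
      using x x' by (simp add: f.T_minus)
    then show ?thesis using U_map[OF a mem] x x' by (simp add: H.coset_eq_iff)
  qed
  then show ?thesis unfolding quotient_rep_def by (simp add: T.coset_UN[OF x])
qed

lemma quotient_map_linear: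
  assumes a: "a \<in> arcs Q"
  shows "linear_map complex_field (rep_space N (tail Q a)) (rep_space N (head Q a)) (rep_map N a)"
proof -
  interpret T: quotient_vs "rep_space M (tail Q a)" "U (tail Q a)" using a by (intro quotient_vs) simp
  interpret H: quotient_vs "rep_space M (head Q a)" "U (head Q a)" using a by (intro quotient_vs) simp
  interpret f: linear_map complex_field "rep_space M (tail Q a)" "rep_space M (head Q a)" "rep_map M a"
    by (rule map_linear[OF a])
  have sp: "rep_space N i = quotient_space (rep_space M i) (U i)" for i
    by (simp add: quotient_rep_def)
  show ?thesis
    unfolding sp
  proof (rule linear_map_complexI)
    show "rep_map N a X \<in> carrier (quotient_space (rep_space M (head Q a)) (U (head Q a)))"
      if "X \<in> carrier (quotient_space (rep_space M (tail Q a)) (U (tail Q a)))" for X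
      using that by (rule T.coset_cases) (simp add: quotient_map_coset[OF a])
    show "rep_map N a (X \<oplus>\<^bsub>quotient_space (rep_space M (tail Q a)) (U (tail Q a))\<^esub> Y) =
        rep_map N a X \<oplus>\<^bsub>quotient_space (rep_space M (head Q a)) (U (head Q a))\<^esub> rep_map N a Y"
      if X: "X \<in> carrier (quotient_space (rep_space M (tail Q a)) (U (tail Q a)))"
        and Y: "Y \<in> carrier (quotient_space (rep_space M (tail Q a)) (U (tail Q a)))" for X Y
      using X Y by (elim T.coset_cases) (simp add: quotient_map_coset[OF a] T.coset_add H.coset_add)
    show "rep_map N a (c \<odot>\<^bsub>quotient_space (rep_space M (tail Q a)) (U (tail Q a))\<^esub> X) =
        c \<odot>\<^bsub>quotient_space (rep_space M (head Q a)) (U (head Q a))\<^esub> rep_map N a X"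
      if X: "X \<in> carrier (quotient_space (rep_space M (tail Q a)) (U (tail Q a)))" for X c
      using X by (elim T.coset_cases) (simp add: quotient_map_coset[OF a] T.coset_smult H.coset_smult)
  qed (rule T.vectorspace_quotient H.vectorspace_quotient)+
qed

sublocale rep_pair Q "sub_rep M U" N
proof (intro rep_pair.intro rep_pair_axioms.intro)
  show "wf_digraph Q" by unfold_locales
  show "vectorspace complex_field (rep_space (sub_rep M U) i)" if "i \<in> verts Q" for i
    using sub_dual_basis[OF that] by (rule dual_basis.axioms)
  show "vectorspace complex_field (rep_space N i)" if "i \<in> verts Q" for i
    using quotient_dual_basis[OF that] by (rule dual_basis.axioms)
  show "rep_map (sub_rep M U) a x \<in> carrier (rep_space (sub_rep M U) (head Q a))"
    if "a \<in> arcs Q" "x \<in> carrier (rep_space (sub_rep M U) (tail Q a))" for a x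
    using that U_map by (simp add: sub_rep_def)
qed (rule quotient_map_linear)

lemma tangent_space_eq: "tangent_space Q M U = H"
  by (simp add: tangent_space_def)

lemma sub_map_linear:
  assumes a: "a \<in> arcs Q"
  shows "linear_map complex_field (rep_space (sub_rep M U) (tail Q a))
    (rep_space (sub_rep M U) (head Q a)) (rep_map M a)"
proof -
  interpret f: linear_map complex_field "rep_space M (tail Q a)" "rep_space M (head Q a)" "rep_map M a"
    by (rule map_linear[OF a])
  show ?thesis
    using a M_vs[of "tail Q a"] M_vs[of "head Q a"] U_carrier[of "tail Q a"] U_map[OF a]
    by (intro linear_map_complexI) (auto simp: sub_rep_def)
qed

text \<open>Intended for x in X and y outside X over the same vertex of Q; that vertex is read off
  from x alone.\<close>

definition hmat :: "('v \<Rightarrow> 'm \<Rightarrow> 'm set) \<Rightarrow> 'v \<times> nat \<Rightarrow> 'v \<times> nat \<Rightarrow> complex" where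
  "hmat \<phi> x y = qc (fst x) (snd y) (\<phi> (fst x) (b (fst x) (snd x)))"

text \<open>One scalar component of the commutation with a: the l'-coordinate, in the quotient at
  the head, of both sides applied to the k-th basis vector. The left sum runs over J because the
  image under M lies in U, the right sum over the complement because \<phi> takes values in the
  quotient.\<close>

definition commutes_at :: "('v \<Rightarrow> 'm \<Rightarrow> 'm set) \<Rightarrow> 'a \<Rightarrow> nat \<Rightarrow> nat \<Rightarrow> bool" where
  "commutes_at \<phi> a k l' \<longleftrightarrow>
     (\<Sum>l\<in>J (head Q a). coord M b (head Q a) (rep_map M a (b (tail Q a) k)) l *
        hmat \<phi> (head Q a, l) (head Q a, l')) =
     (\<Sum>l\<in>I (tail Q a) - J (tail Q a). hmat \<phi> (tail Q a, k) (tail Q a, l) *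
        coord M b (head Q a) (rep_map M a (b (tail Q a) l)) l')"

lemma commutes_at_iff:
  assumes lin: "\<And>i. i \<in> verts Q \<Longrightarrow>
      linear_map complex_field (rep_space (sub_rep M U) i) (rep_space N i) (\<phi> i)"
    and a: "a \<in> arcs Q" and k: "k \<in> J (tail Q a)" and l': "l' \<in> I (head Q a) - J (head Q a)"
  shows "commutes_at \<phi> a k l' \<longleftrightarrow>
    qc (head Q a) l' (\<phi> (head Q a) (rep_map M a (b (tail Q a) k))) =
    qc (head Q a) l' (rep_map N a (\<phi> (tail Q a) (b (tail Q a) k)))"
proof -
  let ?t = "tail Q a" and ?h = "head Q a"
  have v: "?t \<in> verts Q" "?h \<in> verts Q" using a by auto
  have sc: "carrier (rep_space (sub_rep M U) i) = U i" for i by (simp add: sub_rep_def)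
  have bk: "b ?t k \<in> U ?t" using k by (simp add: J_def)
  interpret \<phi>t: linear_map complex_field "rep_space (sub_rep M U) ?t" "rep_space N ?t" "\<phi> ?t"
    by (rule lin[OF v(1)])
  have "qc ?h l' (\<phi> ?h (rep_map M a (b ?t k))) =
      (\<Sum>l\<in>J ?h. coord M b ?h (rep_map M a (b ?t k)) l * qc ?h l' (\<phi> ?h (b ?h l)))"
    using dual_basis.matrix_expansion[OF sub_dual_basis[OF v(2)] lin[OF v(2)]
        quotient_dual_basis[OF v(2)] l'] U_map[OF a bk] by (simp add: sc)
  moreover have "qc ?h l' (rep_map N a (\<phi> ?t (b ?t k))) =
      (\<Sum>l\<in>I ?t - J ?t. qc ?t l (\<phi> ?t (b ?t k)) *
        qc ?h l' (rep_map N a (U ?t +>\<^bsub>rep_space M ?t\<^esub> b ?t l)))"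
    using dual_basis.matrix_expansion[OF quotient_dual_basis[OF v(1)] quotient_map_linear[OF a]
        quotient_dual_basis[OF v(2)] l'] \<phi>t.T_im[of "b ?t k"] bk by (simp add: sc)
  moreover have "qc ?h l' (rep_map N a (U ?t +>\<^bsub>rep_space M ?t\<^esub> b ?t l)) =
      coord M b ?h (rep_map M a (b ?t l)) l'" if "l \<in> I ?t - J ?t" for l
  proof -
    interpret f: linear_map complex_field "rep_space M ?t" "rep_space M ?h" "rep_map M a"
      by (rule map_linear[OF a])
    show ?thesis
      using that b_closed[OF v(1), of l] f.T_im[of "b ?t l"] qc_coset[OF v(2) _ l']
      by (simp add: quotient_map_coset[OF a])
  qed
  ultimately show ?thesis by (simp add: commutes_at_def hmat_def)
qed

lemma commutes_at_hom:
  assumes "\<phi> \<in> carrier H" "a \<in> arcs Q" "k \<in> J (tail Q a)" "l' \<in> I (head Q a) - J (head Q a)"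
  shows "commutes_at \<phi> a k l'"
proof -
  have "b (tail Q a) k \<in> carrier (rep_space (sub_rep M U) (tail Q a))"
    using assms(3) by (simp add: J_def sub_rep_def)
  with rep_hom_comm[OF assms(1,2) this] show ?thesis
    using commutes_at_iff[OF rep_hom_lin[OF assms(1)] assms(2-4)] by (simp add: sub_rep_def)
qed

lemma hom_if_commutes_at:
  assumes "\<phi> \<in> extensional (verts Q)"
    and "\<And>i. i \<in> verts Q \<Longrightarrow> \<phi> i \<in> extensional (U i)"
    and lin: "\<And>i. i \<in> verts Q \<Longrightarrow>
      linear_map complex_field (rep_space (sub_rep M U) i) (rep_space N i) (\<phi> i)"
    and comm: "\<And>a k l'. a \<in> arcs Q \<Longrightarrow> k \<in> J (tail Q a) \<Longrightarrow> l' \<in> I (head Q a) - J (head Q a) \<Longrightarrow>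
      commutes_at \<phi> a k l'"
  shows "\<phi> \<in> carrier H"
proof (rule rep_hom_carrierI)
  fix a x assume a: "a \<in> arcs Q" and x: "x \<in> carrier (rep_space (sub_rep M U) (tail Q a))"
  let ?t = "tail Q a" and ?h = "head Q a"
  have v: "?t \<in> verts Q" "?h \<in> verts Q" using a by auto
  have A: "linear_map complex_field (rep_space (sub_rep M U) ?t) (rep_space N ?h)
      (\<lambda>x. \<phi> ?h (rep_map M a x))"
    by (rule linear_map_comp[OF sub_map_linear[OF a] lin[OF v(2)]])
  have B: "linear_map complex_field (rep_space (sub_rep M U) ?t) (rep_space N ?h)
      (\<lambda>x. rep_map N a (\<phi> ?t x))"
    by (rule linear_map_comp[OF lin[OF v(1)] quotient_map_linear[OF a]])
  have "\<phi> ?h (rep_map M a x) = rep_map N a (\<phi> ?t x)"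
  proof (rule dual_basis.linear_maps_eqI[OF sub_dual_basis[OF v(1)] A B _ x])
    fix k assume k: "k \<in> J ?t"
    have bk: "b ?t k \<in> carrier (rep_space (sub_rep M U) ?t)"
      using k by (simp add: J_def sub_rep_def)
    show "\<phi> ?h (rep_map M a (b ?t k)) = rep_map N a (\<phi> ?t (b ?t k))"
    proof (rule dual_basis.\<kappa>_inject[OF quotient_dual_basis[OF v(2)]])
      show "\<phi> ?h (rep_map M a (b ?t k)) \<in> carrier (rep_space N ?h)"
        using A bk by (simp add: linear_map_def mod_hom_def mod_hom_axioms_def module_hom_def Pi_def)
      show "rep_map N a (\<phi> ?t (b ?t k)) \<in> carrier (rep_space N ?h)"
        using B bk by (simp add: linear_map_def mod_hom_def mod_hom_axioms_def module_hom_def Pi_def)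
      show "qc ?h l (\<phi> ?h (rep_map M a (b ?t k))) = qc ?h l (rep_map N a (\<phi> ?t (b ?t k)))"
        if "l \<in> I ?h - J ?h" for l
        using comm[OF a k that] commutes_at_iff[OF lin a k that] by simp
    qed
  qed
  then show "\<phi> ?h (rep_map (sub_rep M U) a x) = rep_map N a (\<phi> ?t x)" by (simp add: sub_rep_def)
qed (use assms in \<open>auto simp: sub_rep_def\<close>)

lemma hom_eq_zeroI:
  assumes \<phi>: "\<phi> \<in> carrier H"
    and 0: "\<And>i k l. i \<in> verts Q \<Longrightarrow> k \<in> J i \<Longrightarrow> l \<in> I i - J i \<Longrightarrow> hmat \<phi> (i, k) (i, l) = 0"
  shows "\<phi> = \<zero>\<^bsub>H\<^esub>"
proof (rule rep_hom_ext[OF \<phi> zero_closed])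
  fix i x assume i: "i \<in> verts Q" and x: "x \<in> carrier (rep_space (sub_rep M U) i)"
  show "\<phi> i x = \<zero>\<^bsub>H\<^esub> i x"
  proof (rule dual_basis.linear_maps_eqI[OF sub_dual_basis[OF i] rep_hom_lin[OF \<phi> i]
        rep_hom_lin[OF zero_closed i] _ x])
    fix k assume k: "k \<in> J i"
    then have bk: "b i k \<in> carrier (rep_space (sub_rep M U) i)" by (simp add: J_def sub_rep_def)
    have "\<phi> i (b i k) = \<zero>\<^bsub>rep_space N i\<^esub>"
      using 0[OF i k]
      by (intro dual_basis.\<kappa>_eq_zero[OF quotient_dual_basis[OF i]] rep_hom_closed[OF \<phi> i bk])
        (simp add: hmat_def)
    then show "\<phi> i (b i k) = \<zero>\<^bsub>H\<^esub> i (b i k)" by (simp add: zero_apply[OF i bk])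
  qed
qed

lemma
  assumes i: "i \<in> verts Q" and k: "k \<in> J i" and l: "l \<in> I i - J i" and \<phi>: "\<phi> \<in> carrier H"
  shows hmat_add: "\<psi> \<in> carrier H \<Longrightarrow>
      hmat (\<phi> \<oplus>\<^bsub>H\<^esub> \<psi>) (i, k) (i, l) = hmat \<phi> (i, k) (i, l) + hmat \<psi> (i, k) (i, l)"
    and hmat_smult: "hmat (c \<odot>\<^bsub>H\<^esub> \<phi>) (i, k) (i, l) = c * hmat \<phi> (i, k) (i, l)"
proof -
  have bk: "b i k \<in> carrier (rep_space (sub_rep M U) i)" using k by (simp add: J_def sub_rep_def)
  note Q = quotient_dual_basis[OF i]
  show "hmat (\<phi> \<oplus>\<^bsub>H\<^esub> \<psi>) (i, k) (i, l) = hmat \<phi> (i, k) (i, l) + hmat \<psi> (i, k) (i, l)"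
    if \<psi>: "\<psi> \<in> carrier H"
    using dual_basis.\<kappa>_add[OF Q l rep_hom_closed[OF \<phi> i bk] rep_hom_closed[OF \<psi> i bk]]
    by (simp add: hmat_def add_apply[OF i bk])
  show "hmat (c \<odot>\<^bsub>H\<^esub> \<phi>) (i, k) (i, l) = c * hmat \<phi> (i, k) (i, l)"
    using dual_basis.\<kappa>_smult[OF Q l rep_hom_closed[OF \<phi> i bk]]
    by (simp add: hmat_def smult_apply[OF i bk])
qed

end

section \<open>Mutations and mutation paths correspond\<close>

lemma quiver_diff_induce: "quiver_diff (G \<restriction> X) (G \<restriction> Y) = G \<restriction> (X - Y)"
  by (simp add: quiver_diff_def induce_induce)

context closed_subquiver
begin

definition mut_target ::
  "'v \<times> nat \<Rightarrow> ('a \<times> nat \<times> nat) list \<Rightarrow> 'v \<times> nat \<Rightarrow> ('a \<times> nat \<times> nat) list \<Rightarrow> ('v \<times> nat) set"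
  where "mut_target u p u' p' = X - set (awalk_verts u p) \<union> set (awalk_verts u' p')"

lemma mut_path_verts:
  assumes m: "mut_path u p u' p'"
  shows "set (awalk_verts u p) \<subseteq> X" "set (awalk_verts u' p') \<subseteq> verts G - X"
proof -
  obtain v v' where w: "awalk u p v" "awalk u' p' v'" using mut_path_awalk[OF m] by blast
  show "set (awalk_verts u p) \<subseteq> X" using awalk_verts_X[OF w(1) mut_path_u[OF m]] .
  show "set (awalk_verts u' p') \<subseteq> verts G - X" using w(2) mut_path_not_X[OF m] by auto
qed

lemma mut_target_diff:
  assumes m: "mut_path u p u' p'"
  shows "X - mut_target u p u' p' = set (awalk_verts u p)"
    and "mut_target u p u' p' - X = set (awalk_verts u' p')"
    and "mut_target u p u' p' \<subseteq> verts G"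
  using mut_path_verts[OF m] X_sub unfolding mut_target_def by blast+

text \<open>An arrow starting in X can leave the exchanged set only by ending on the removed path.
  Arrows into its later vertices come from the path itself, and arrows into u start outside X. The
  critical case is an arrow from the added path to u.\<close>

lemma mut_target_closed:
  assumes m: "mut_path u p u' p'" and no: "\<not> self_overlap G (G \<restriction> X)"
  shows "successor_closed G (mut_target u p u' p')"
  unfolding successor_closed_def
proof (intro ballI impI)
  obtain v v' where w: "awalk u p v" "awalk u' p' v'"
    and end': "\<And>f. f \<in> arcs G \<Longrightarrow> tail G f = v' \<Longrightarrow> head G f \<in> X"
    using mut_path_awalk[OF m] by blast
  note sub = mut_path_verts[OF m]
  fix f assume f: "f \<in> arcs G" and t: "tail G f \<in> mut_target u p u' p'"
  have no_hit: "head G f \<notin> set (awalk_verts u p)"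
    if hit: "head G f \<noteq> u" "tail G f \<notin> set (awalk_verts u p)"
  proof
    assume "head G f \<in> set (awalk_verts u p)"
    then obtain n where n: "n \<le> length p" "head G f = awalk_verts u p ! n"
      by (auto simp: mem_awalk_verts)
    then have "n \<noteq> 0" using awalk_verts_nth_0[OF w(1)] hit by metis
    then obtain k where k: "n = Suc k" using not0_implies_Suc by blast
    then have "k < length p" using n by simp
    note e = awalk_verts_nth[OF w(1) this]
    have "f = p ! k" using in_unique[OF f e(1)] e(3) n(2) k by simp
    then have "tail G f = awalk_verts u p ! k" using e(2) by simp
    then show False using hit(2) \<open>k < length p\<close> by (metis less_imp_le_nat mem_awalk_verts)
  qed
  consider "tail G f \<in> set (awalk_verts u' p')" | "tail G f \<in> X - set (awalk_verts u p)"
    using t unfolding mut_target_def by blast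
  then show "head G f \<in> mut_target u p u' p'"
  proof cases
    case 1
    then obtain n where n: "n \<le> length p" "tail G f = awalk_verts u' p' ! n"
      using mut_path_length[OF m] by (auto simp: mem_awalk_verts)
    show ?thesis
    proof (cases "head G f \<in> X")
      case False
      note e = mut_path_end[OF m n(1) f n(2) False]
      then have "head G f = awalk_verts u' p' ! Suc n" "Suc n \<le> length p'"
        using awalk_verts_nth[OF w(2), of n] mut_path_length[OF m] by auto
      then have "head G f \<in> set (awalk_verts u' p')" unfolding mem_awalk_verts by blast
      then show ?thesis by (simp add: mut_target_def)
    next
      case True
      \<comment> \<open>Inner arrows of the second path stay on it, hence outside X; an arrow into X
        must leave its last vertex.\<close>
      have "n = length p"
      proof (rule ccontr)
        assume "n \<noteq> length p"
        then have nl: "n < length p'" using n mut_path_length[OF m] by simp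
        note e = awalk_verts_nth[OF w(2) nl]
        have "f = p' ! n" using out_unique[OF f e(1)] e(2) n(2) by simp
        then have "head G f = awalk_verts u' p' ! Suc n" using e(3) by simp
        then have "head G f \<in> set (awalk_verts u' p')" using nl Suc_leI mem_awalk_verts by blast
        then show False using True sub(2) by blast
      qed
      then have v': "tail G f = v'"
        using n(2) awalk_verts_nth_last[OF w(2)] mut_path_length[OF m] by simp
      have "head G f \<noteq> u"
      proof
        assume hu: "head G f = u"
        \<comment> \<open>This walk lies over w a w, where w is the common projection of p' and p
          and a that of f. Its first copy of w is outside X and its second inside, so it is a
          self-overlap.\<close>
        have "awalk u' (p' @ f # p) v" using w f v' hu by (auto simp: awalk_Cons_iff)
        moreover have "tail G f \<notin> X" using 1 sub(2) by blast
        moreover have "fst u' = fst (head G f)" using hu mut_path_fst[OF m] by simp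
        ultimately have "self_overlap G (G \<restriction> X)"
          unfolding self_overlap_def using True mut_path_map[OF m]
          by (intro exI[of _ u'] exI[of _ p'] exI[of _ f] exI[of _ p] exI[of _ v] conjI) simp_all
        then show False using no by blast
      qed
      moreover have "tail G f \<notin> set (awalk_verts u p)" using 1 sub by blast
      ultimately show ?thesis using no_hit True by (simp add: mut_target_def)
    qed
  next
    case 2
    have "head G f \<noteq> u" using mut_path_start[OF m f] 2 by blast
    with no_hit 2 X_closed[OF f] show ?thesis by (simp add: mut_target_def)
  qed
qed

lemma matched_fst:
  assumes m: "mut_path u p u' p'" and "matched u p u' p' x y"
  shows "fst y = fst x"
proof -
  obtain v v' where w: "awalk u p v" "awalk u' p' v'" using mut_path_awalk[OF m] by blast
  obtain n where n: "n \<le> length p" "x = awalk_verts u p ! n" "y = awalk_verts u' p' ! n"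
    using assms(2) by (auto simp: matched_def)
  show ?thesis
  proof (cases n)
    case 0
    then show ?thesis
      using n awalk_verts_nth_0[OF w(1)] awalk_verts_nth_0[OF w(2)] mut_path_fst[OF m] by simp
  next
    case (Suc k)
    then have k: "k < length p" "k < length p'" using n mut_path_length[OF m] by simp_all
    show ?thesis
      using awalk_verts_nth[OF w(1) k(1)] awalk_verts_nth[OF w(2) k(2)] Suc n
        proj_head[of "p ! k" "p' ! k"] mut_path_fst_nth[OF m k(1)] by simp
  qed
qed

lemma mut_target_card:
  assumes m: "mut_path u p u' p'"
  shows "card {k. (i, k) \<in> mut_target u p u' p'} = card {k. (i, k) \<in> X}"
proof -
  obtain v v' where w: "awalk u p v" "awalk u' p' v'" using mut_path_awalk[OF m] by blast
  let ?A = "{k. (i, k) \<in> set (awalk_verts u p)}" and ?B = "{k. (i, k) \<in> set (awalk_verts u' p')}"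
  let ?C = "{k. (i, k) \<in> X}"
  note sub = mut_path_verts[OF m]
  have fin: "finite {k. (i, k) \<in> Y}" if "Y \<subseteq> verts G" for Y
  proof -
    have "{k. (i, k) \<in> Y} \<subseteq> snd ` Y" by force
    with that show ?thesis using finite_verts finite_subset finite_imageI by metis
  qed
  have "map fst (awalk_verts u p) = map fst (awalk_verts u' p')"
  proof (rule nth_equalityI)
    fix n assume "n < length (map fst (awalk_verts u p))"
    then have n: "n \<le> length p" by (simp add: length_awalk_verts)
    then have "fst (awalk_verts u p ! n) = fst (awalk_verts u' p' ! n)"
      using matched_fst[OF m] unfolding matched_def by metis
    then show "map fst (awalk_verts u p) ! n = map fst (awalk_verts u' p') ! n"
      using n mut_path_length[OF m] by (simp add: length_awalk_verts)
  qed (simp add: length_awalk_verts mut_path_length[OF m])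
  then have AB: "card ?A = card ?B"
    using card_fiber[OF distinct_awalk_verts[OF w(1)]] card_fiber[OF distinct_awalk_verts[OF w(2)]]
    by simp
  have "{k. (i, k) \<in> mut_target u p u' p'} = (?C - ?A) \<union> ?B"
    by (auto simp: mut_target_def)
  also have "card \<dots> = card (?C - ?A) + card ?B"
    using sub X_sub fin[OF X_sub] fin[of "set (awalk_verts u' p')"] by (intro card_Un_disjoint) auto
  also have "card (?C - ?A) = card ?C - card ?A"
    using sub(1) X_sub by (intro card_Diff_subset fin) auto
  also have "card ?C - card ?A + card ?B = card ?C"
  proof -
    have "card ?A \<le> card ?C" using sub(1) fin[OF X_sub] by (intro card_mono) auto
    then show ?thesis using AB by simp
  qed
  finally show ?thesis .
qed

lemma mut_path_mutation:
  assumes m: "mut_path u p u' p'" and no: "\<not> self_overlap G (G \<restriction> X)"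
    and S: "G \<restriction> X \<in> succ_closed_subquivers Q G e"
  shows "G \<restriction> mut_target u p u' p' \<in> mutations_from Q G e (G \<restriction> X)"
proof -
  obtain v v' where w: "awalk u p v" "awalk u' p' v'" using mut_path_awalk[OF m] by blast
  \<comment> \<open>The dimension condition is known for some vertex set presenting the same full
    subquiver; comparing vertices shows that this set is X.\<close>
  obtain Y where "G \<restriction> X = G \<restriction> Y" "\<forall>i\<in>verts Q. int (card {k. (i, k) \<in> Y}) = e i"
    using S by (auto simp: succ_closed_subquivers_def)
  then have "\<forall>i\<in>verts Q. int (card {k. (i, k) \<in> X}) = e i"
    by (metis induce_subgraph_verts)
  then have "G \<restriction> mut_target u p u' p' \<in> succ_closed_subquivers Q G e"
    using mut_target_card[OF m] mut_target_closed[OF m no] mut_target_diff(3)[OF m]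
    by (auto simp: succ_closed_subquivers_def)
  moreover have "same_projection (G \<restriction> set (awalk_verts u p)) (G \<restriction> set (awalk_verts u' p'))"
  proof -
    have "is_string (G \<restriction> set (awalk_verts u p)) u p"
      using w(1) by (subst is_string_iff) blast+
    moreover have "is_string (G \<restriction> set (awalk_verts u' p')) u' p'"
      using w(2) by (subst is_string_iff) blast+
    ultimately show ?thesis
      unfolding same_projection_def using mut_path_fst[OF m] mut_path_map[OF m] by metis
  qed
  ultimately show ?thesis
    using S connected_awalk_verts[OF w(1)] connected_awalk_verts[OF w(2)]
    by (simp add: mutations_from_def quiver_diff_induce mut_target_diff[OF m])
qed

text \<open>The end conditions come from closedness of the target Y. A predecessor of u in X would
  lie in Y, forcing u into Y, or on the first path, where no vertex has rank below that of u. A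
  successor of v' outside X would lie on the second path, but with a rank beyond its end.\<close>

lemma mutation_mut_path:
  assumes "S' \<in> mutations_from Q G e (G \<restriction> X)"
  shows "\<exists>u p u' p'. mut_path u p u' p' \<and> S' = G \<restriction> mut_target u p u' p'"
proof -
  obtain Y where Y: "S' = G \<restriction> Y" "Y \<subseteq> verts G" "successor_closed G Y"
    using assms by (auto simp: mutations_from_def succ_closed_subquivers_def)
  obtain u p u' p' where s: "is_string (G \<restriction> (X - Y)) u p" "is_string (G \<restriction> (Y - X)) u' p'"
    and eq: "fst u = fst u'" "map fst p = map fst p'"
    using assms by (auto simp: mutations_from_def Y(1) quiver_diff_induce same_projection_def)
  obtain v where w: "awalk u p v" and L: "X - Y = set (awalk_verts u p)"
    using s(1) is_string_iff[of "X - Y"] X_sub by blast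
  obtain v' where w': "awalk u' p' v'" and L': "Y - X = set (awalk_verts u' p')"
    using s(2) is_string_iff[of "Y - X"] Y(2) by blast
  have u: "u \<in> X - Y" unfolding L using w hd_in_awalk_verts(1) by blast
  have start: "tail G f \<notin> X" if f: "f \<in> arcs G" "head G f = u" for f
  proof
    assume t: "tail G f \<in> X"
    show False
    proof (cases "tail G f \<in> Y")
      case True
      then show False using Y(3) f u by (auto simp: successor_closed_def)
    next
      case False
      then have "tail G f \<in> set (awalk_verts u p)" using t L by blast
      then obtain n where "n \<le> length p" "tail G f = awalk_verts u p ! n"
        by (auto simp: mem_awalk_verts)
      then have "r (tail G f) = r u + n" using awalk_verts_rank[OF w] by simp
      then show False using rank[OF f(1)] f(2) by simp
    qed
  qed
  have "head G f \<in> X" if f: "f \<in> arcs G" "tail G f = v'" for f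
  proof (rule ccontr)
    assume h: "head G f \<notin> X"
    have "v' \<in> set (awalk_verts u' p')" using w' awalk_verts_nth_last mem_awalk_verts by blast
    then have "v' \<in> Y" using L' by blast
    then have "head G f \<in> Y - X" using f h Y(3) by (auto simp: successor_closed_def)
    then obtain n where n: "n \<le> length p'" "head G f = awalk_verts u' p' ! n"
      unfolding L' mem_awalk_verts by blast
    then have "r (head G f) = r u' + n" using awalk_verts_rank[OF w'] by simp
    moreover have "r v' = r u' + length p'"
      using awalk_verts_rank[OF w', of "length p'"] awalk_verts_nth_last[OF w'] by simp
    ultimately show False using rank[OF f(1)] f(2) n(1) by simp
  qed
  then have "mut_path u p u' p'"
    unfolding mut_path_def using w w' u start eq L' by blast
  moreover have "mut_target u p u' p' = Y"
    unfolding mut_target_def using L L' by blast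
  ultimately show ?thesis using Y(1) by blast
qed

text \<open>The definite description has a unique solution: a string is determined by its vertex
  set, and its vertices are distinct, so x determines its position.\<close>

lemma corresponding_vertex_matched:
  assumes m: "mut_path u p u' p'" and xy: "matched u p u' p' x y"
  shows "corresponding_vertex (G \<restriction> set (awalk_verts u p)) (G \<restriction> set (awalk_verts u' p')) x = y"
proof -
  obtain v v' where w: "awalk u p v" "awalk u' p' v'" using mut_path_awalk[OF m] by blast
  have sub: "set (awalk_verts u p) \<subseteq> verts G" "set (awalk_verts u' p') \<subseteq> verts G"
    using w by auto
  have str: "is_string (G \<restriction> set (awalk_verts u p)) t q \<longleftrightarrow> t = u \<and> q = p" for t q
    using is_string_iff[OF sub(1), of t q] w(1) awalk_verts_set_unique[OF w(1), of t q] by metis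
  have str': "is_string (G \<restriction> set (awalk_verts u' p')) t q \<longleftrightarrow> t = u' \<and> q = p'" for t q
    using is_string_iff[OF sub(2), of t q] w(2) awalk_verts_set_unique[OF w(2), of t q] by metis
  obtain n where n: "n \<le> length p" "x = awalk_verts u p ! n" "y = awalk_verts u' p' ! n"
    using xy by (auto simp: matched_def)
  show ?thesis
    unfolding corresponding_vertex_def str str'
  proof (rule the_equality)
    show "\<exists>s q s' q' n. (s = u \<and> q = p) \<and> (s' = u' \<and> q' = p') \<and> n \<le> length q \<and>
        x = pre_digraph.awalk_verts (G \<restriction> set (awalk_verts u p)) s q ! n \<and>
        y = pre_digraph.awalk_verts (G \<restriction> set (awalk_verts u' p')) s' q' ! n"
      using n by (auto intro!: exI[of _ n])
    fix z assume "\<exists>s q s' q' n. (s = u \<and> q = p) \<and> (s' = u' \<and> q' = p') \<and> n \<le> length q \<and>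
        x = pre_digraph.awalk_verts (G \<restriction> set (awalk_verts u p)) s q ! n \<and>
        z = pre_digraph.awalk_verts (G \<restriction> set (awalk_verts u' p')) s' q' ! n"
    then obtain k where k: "k \<le> length p" "x = awalk_verts u p ! k" "z = awalk_verts u' p' ! k"
      by auto
    have "awalk_verts u p ! n = awalk_verts u p ! k" using n(2) k(2) by (rule subst)
    then have "n = k"
      using distinct_awalk_verts[OF w(1)] n(1) k(1)
      by (simp add: nth_eq_iff_index_eq length_awalk_verts less_Suc_eq_le)
    then show "z = y" using k(3) n(3) by simp
  qed
qed

lemma matched_iff:
  assumes m: "mut_path u p u' p'"
  shows "matched u p u' p' x y \<longleftrightarrow> x \<in> set (awalk_verts u p) \<and>
    y = corresponding_vertex (G \<restriction> set (awalk_verts u p)) (G \<restriction> set (awalk_verts u' p')) x"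
  using corresponding_vertex_matched[OF m] unfolding matched_def mem_awalk_verts by metis

lemma matched_mem:
  assumes m: "mut_path u p u' p'" and "matched u p u' p' x y"
  shows "x \<in> X" "y \<in> verts G - X"
  using assms(2) mut_path_verts[OF m] mut_path_length[OF m]
  unfolding matched_def mem_awalk_verts subset_iff by metis+

end

section \<open>Coefficient quivers of straight representations\<close>

lemma coefficient_quiver_simps [simp]:
  "verts (coefficient_quiver Q M b) = (SIGMA i:verts Q. {1..rep_dim M i})"
  "tail (coefficient_quiver Q M b) (a, k, l) = (tail Q a, k)"
  "head (coefficient_quiver Q M b) (a, k, l) = (head Q a, l)"
  by (simp_all add: coefficient_quiver_def)

lemma arc_coefficient_quiver:
  "(a, k, l) \<in> arcs (coefficient_quiver Q M b) \<longleftrightarrow> a \<in> arcs Q \<and>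
     k \<in> {1..rep_dim M (tail Q a)} \<and> l \<in> {1..rep_dim M (head Q a)} \<and>
     coord M b (head Q a) (rep_map M a (b (tail Q a) k)) l \<noteq> 0"
  by (simp add: coefficient_quiver_def)

lemma fst_tail_head:
  "fst (tail (coefficient_quiver Q M b) f) = tail Q (fst f)"
  "fst (head (coefficient_quiver Q M b) f) = head Q (fst f)"
  by (cases f; simp)+

lemma fin_digraph_coefficient_quiver:
  assumes "fin_digraph Q"
  shows "fin_digraph (coefficient_quiver Q M b)"
proof -
  interpret fin_digraph Q by fact
  let ?G = "coefficient_quiver Q M b"
  have "arcs ?G \<subseteq> (SIGMA a:arcs Q. {1..rep_dim M (tail Q a)} \<times> {1..rep_dim M (head Q a)})"
    by (auto simp: arc_coefficient_quiver)
  then have "finite (arcs ?G)" by (rule finite_subset) auto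
  moreover have "tail ?G f \<in> verts ?G" "head ?G f \<in> verts ?G" if "f \<in> arcs ?G" for f
    using that by (cases f; simp add: arc_coefficient_quiver)+
  ultimately show ?thesis
    by unfold_locales (auto intro!: finite_SigmaI)
qed

text \<open>The choice depends on the component only, so all vertices of one string share the same
  start and the same list of arrows. This is what makes positions comparable along an arrow.\<close>

definition string_of :: "('v, 'a) pre_digraph \<Rightarrow> 'v \<times> 'a list" where
  "string_of C = (SOME up. is_string C (fst up) (snd up))"

definition string_rank :: "('v, 'a) pre_digraph \<Rightarrow> 'v \<Rightarrow> nat" where
  "string_rank G x = (THE n. n \<le> length (snd (string_of (component_of G x))) \<and>
     pre_digraph.awalk_verts G (fst (string_of (component_of G x)))
       (snd (string_of (component_of G x))) ! n = x)"

locale strings = fin_digraph G for G :: "('v, 'a) pre_digraph" +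
  assumes strings: "x \<in> verts G \<Longrightarrow> \<exists>u p. is_string (component_of G x) u p"
begin

definition "start x = fst (string_of (component_of G x))"
definition "path x = snd (string_of (component_of G x))"
abbreviation "vs x \<equiv> awalk_verts (start x) (path x)"

lemma component_subset: "{y. x \<rightarrow>\<^sup>*\<^bsub>with_proj (mk_symmetric G)\<^esub> y} \<subseteq> verts G"
  by (auto elim!: reachable_in_vertsE)

lemma
  assumes x: "x \<in> verts G"
  shows verts_component: "verts (component_of G x) = set (vs x)"
    and arcs_component: "arcs (component_of G x) = set (path x)"
    and distinct_vs: "distinct (vs x)"
    and awalk_path: "\<exists>v. awalk (start x) (path x) v"
proof -
  have "is_string (component_of G x) (start x) (path x)"
    unfolding start_def path_def string_of_def using strings[OF x]
    by (metis (mono_tags, lifting) fst_conv snd_conv someI_ex)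
  then obtain v where v: "pre_digraph.apath (component_of G x) (start x) (path x) v"
    and e: "verts (component_of G x) = set (pre_digraph.awalk_verts (component_of G x) (start x) (path x))"
      "arcs (component_of G x) = set (path x)"
    by (auto simp: is_string_def)
  show "verts (component_of G x) = set (vs x)" using e by (simp add: component_of_def)
  show "arcs (component_of G x) = set (path x)" by (rule e)
  show "distinct (vs x)" using v by (simp add: pre_digraph.apath_def component_of_def)
  show "\<exists>v. awalk (start x) (path x) v"
    using v awalk_induce_iff[OF component_subset]
    by (auto simp: pre_digraph.apath_def component_of_def)
qed

lemma self_mem_component: "x \<in> verts G \<Longrightarrow> x \<in> verts (component_of G x)"
  by (simp add: component_of_def reachable_def)

lemma component_eq:
  assumes "y \<in> verts (component_of G x)"
  shows "component_of G y = component_of G x"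
proof -
  interpret S: pair_wf_digraph "mk_symmetric G" by (rule wellformed_mk_symmetric)
  have xy: "x \<rightarrow>\<^sup>*\<^bsub>with_proj (mk_symmetric G)\<^esub> y" using assms by (simp add: component_of_def)
  then have yx: "y \<rightarrow>\<^sup>*\<^bsub>with_proj (mk_symmetric G)\<^esub> x"
    by (rule symmetric_reachable[OF symmetric_mk_symmetric])
  have "(x \<rightarrow>\<^sup>*\<^bsub>with_proj (mk_symmetric G)\<^esub> z) = (y \<rightarrow>\<^sup>*\<^bsub>with_proj (mk_symmetric G)\<^esub> z)" for z
    using xy yx S.reachable_trans by blast
  then show ?thesis by (simp add: component_of_def)
qed

lemma component_arc:
  assumes f: "f \<in> arcs G"
  shows "component_of G (head G f) = component_of G (tail G f)"
    and "f \<in> arcs (component_of G (tail G f))"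
proof -
  interpret S: pair_wf_digraph "mk_symmetric G" by (rule wellformed_mk_symmetric)
  have "(tail G f, head G f) \<in> parcs (mk_symmetric G)" using f by (auto simp: parcs_mk_symmetric)
  then have h: "head G f \<in> verts (component_of G (tail G f))"
    by (simp add: component_of_def S.reachable_adjI)
  then show "component_of G (head G f) = component_of G (tail G f)" by (rule component_eq)
  show "f \<in> arcs (component_of G (tail G f))"
    using h self_mem_component[of "tail G f"] f by (simp add: component_of_def)
qed

lemma start_path_eq:
  "component_of G y = component_of G x \<Longrightarrow> start y = start x \<and> path y = path x"
  by (simp add: start_def path_def)

lemma string_rank_vs:
  assumes x: "x \<in> verts G" and n: "n \<le> length (path x)" "vs x ! n = x"
  shows "string_rank G x = n"
  unfolding string_rank_def start_def[symmetric] path_def[symmetric]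
proof (rule the_equality)
  fix m assume "m \<le> length (path x) \<and> vs x ! m = x"
  with n distinct_vs[OF x] show "m = n"
    by (metis length_awalk_verts less_Suc_eq_le nth_eq_iff_index_eq)
qed (use n in simp)

lemma vs_string_rank:
  assumes x: "x \<in> verts G"
  shows "string_rank G x \<le> length (path x)" "vs x ! string_rank G x = x"
proof -
  have "x \<in> set (vs x)" using self_mem_component[OF x] verts_component[OF x] by simp
  then obtain n where "n \<le> length (path x)" "vs x ! n = x" by (auto simp: mem_awalk_verts)
  with string_rank_vs[OF x this]
  show "string_rank G x \<le> length (path x)" "vs x ! string_rank G x = x" by simp_all
qed

text \<open>All arrows of a component occur in its chosen path, so an arrow is the entry of that
  path at the position of its tail, and its head comes one position later. Uniqueness of outgoing
  and incoming arrows and the rank needed for \<open>string_quiver\<close> are all read off from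
  this.\<close>

lemma arc_position:
  assumes f: "f \<in> arcs G"
  shows "string_rank G (tail G f) < length (path (tail G f))"
    and "f = path (tail G f) ! string_rank G (tail G f)"
    and "string_rank G (head G f) = Suc (string_rank G (tail G f))"
proof -
  let ?x = "tail G f"
  have x: "?x \<in> verts G" "head G f \<in> verts G" using f by auto
  obtain v where w: "awalk (start ?x) (path ?x) v" using awalk_path[OF x(1)] by blast
  have "f \<in> set (path ?x)" using component_arc(2)[OF f] arcs_component[OF x(1)] by simp
  then obtain n where n: "n < length (path ?x)" "f = path ?x ! n" by (auto simp: in_set_conv_nth)
  have "vs ?x ! n = ?x" using awalk_verts_nth(2)[OF w n(1)] n(2) by simp
  then have t: "string_rank G ?x = n" using n x by (intro string_rank_vs) auto
  show "string_rank G ?x < length (path ?x)" "f = path ?x ! string_rank G ?x"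
    using t n by simp_all
  have "vs ?x ! Suc n = head G f" using awalk_verts_nth(3)[OF w n(1)] n(2) by simp
  then have "string_rank G (head G f) = Suc n"
    using start_path_eq[OF component_arc(1)[OF f]] n x by (intro string_rank_vs) auto
  then show "string_rank G (head G f) = Suc (string_rank G ?x)" using t by simp
qed

lemma vertex_eqI:
  assumes "x \<in> verts G" "y \<in> verts G" "component_of G x = component_of G y"
    and "string_rank G x = string_rank G y"
  shows "x = y"
  using vs_string_rank(2)[OF assms(1)] vs_string_rank(2)[OF assms(2)] start_path_eq[OF assms(3)]
    assms(4) by metis

lemma arc_unique_tail:
  assumes "f \<in> arcs G" "g \<in> arcs G" "tail G f = tail G g"
  shows "f = g"
  using arc_position(2)[OF assms(1)] arc_position(2)[OF assms(2)] assms(3) by metis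

lemma arc_unique_head:
  assumes f: "f \<in> arcs G" and g: "g \<in> arcs G" and h: "head G f = head G g"
  shows "f = g"
proof (rule arc_unique_tail[OF f g])
  have "component_of G (tail G f) = component_of G (tail G g)"
    using component_arc(1)[OF f] component_arc(1)[OF g] h by simp
  moreover have "string_rank G (tail G f) = string_rank G (tail G g)"
    using arc_position(3)[OF f] arc_position(3)[OF g] h by simp
  ultimately show "tail G f = tail G g" using f g by (intro vertex_eqI) auto
qed

lemma awalk_start:
  assumes x: "x \<in> verts G"
  obtains p where "awalk (start x) p x" "length p = string_rank G x" "in_arcs G (start x) = {}"
proof -
  obtain v where w: "awalk (start x) (path x) v" using awalk_path[OF x] by blast
  let ?p = "take (string_rank G x) (path x)"
  have "awalk (start x) ?p (vs x ! string_rank G x)"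
  proof -
    have "awalk (start x) (?p @ drop (string_rank G x) (path x)) v" using w by simp
    then have "awalk (start x) ?p (awlast (start x) ?p)" by (simp only: awalk_append_iff)
    moreover have "awlast (start x) ?p = vs x ! string_rank G x"
    proof -
      have "awalk_verts (start x) ?p = take (Suc (string_rank G x)) (vs x)"
        using w by (intro awalk_verts_take_conv) auto
      then show ?thesis
        using vs_string_rank(1)[OF x]
        by (simp add: last_conv_nth length_awalk_verts take_Suc_conv_app_nth less_Suc_eq_le)
    qed
    ultimately show ?thesis by simp
  qed
  then have "awalk (start x) ?p x" using vs_string_rank(2)[OF x] by simp
  moreover have "length ?p = string_rank G x" using vs_string_rank(1)[OF x] by simp
  \<comment> \<open>The start has position 0, whereas the head of an arrow has positive
    position.\<close>
  moreover have "in_arcs G (start x) = {}"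
  proof (rule ccontr)
    assume "in_arcs G (start x) \<noteq> {}"
    then obtain f where f: "f \<in> arcs G" "head G f = start x" by (auto simp: in_arcs_def)
    have s: "start x \<in> verts G" using w by auto
    have "start x \<in> set (vs x)" using w hd_in_awalk_verts(1) by blast
    then have "component_of G (start x) = component_of G x"
      using component_eq verts_component[OF x] by simp
    from start_path_eq[OF this] have "vs (start x) ! 0 = start x"
      using awalk_verts_nth_0[OF w] by simp
    then have "string_rank G (start x) = 0" using s by (intro string_rank_vs) auto
    then show False using arc_position(3)[OF f(1)] f(2) by simp
  qed
  ultimately show ?thesis by (rule that)
qed

text \<open>Read both walks backwards from x: incoming arrows are unique, and each walk can only
  stop at a source. This makes the definite description in \<open>weight\<close> well
  defined.\<close>

lemma awalk_source_unique:
  assumes "awalk s p x" "awalk s' p' x" "in_arcs G s = {}" "in_arcs G s' = {}"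
  shows "s = s' \<and> p = p'"
  using assms
proof (induction p arbitrary: p' x rule: rev_induct)
  case Nil
  show ?case
  proof (cases p' rule: rev_cases)
    case (snoc q g)
    then have "g \<in> in_arcs G x" using Nil by (auto simp: in_arcs_def awalk_simps)
    then show ?thesis using Nil by (auto simp: awalk_simps)
  qed (use Nil in \<open>auto simp: awalk_simps\<close>)
next
  case (snoc f p)
  then have f: "f \<in> arcs G" "head G f = x" "awalk s p (tail G f)" by (auto simp: awalk_simps)
  show ?case
  proof (cases p' rule: rev_cases)
    case Nil
    then have "f \<in> in_arcs G s'" using f snoc.prems by (auto simp: in_arcs_def awalk_simps)
    then show ?thesis using snoc.prems by simp
  next
    case (snoc q g)
    then have g: "g \<in> arcs G" "head G g = x" "awalk s' q (tail G g)"
      using snoc.prems by (auto simp: awalk_simps)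
    then have "f = g" using f arc_unique_head by simp
    with snoc.IH[OF f(3) _ snoc.prems(3,4)] g snoc show ?thesis by simp
  qed
qed

end

lemma straightening_strings:
  assumes "fin_digraph Q" "is_straightening_basis Q M b"
  shows "strings (coefficient_quiver Q M b)"
  using assms fin_digraph_coefficient_quiver
  by (intro strings.intro strings_axioms.intro) (auto simp: is_straightening_basis_def)

lemma string_quiver_string_rank:
  fixes Q :: "('v, 'a) pre_digraph"
  assumes "strings (coefficient_quiver Q M b)"
  shows "string_quiver (coefficient_quiver Q M b) (string_rank (coefficient_quiver Q M b))"
proof -
  interpret strings "coefficient_quiver Q M b" by fact
  show ?thesis
    by (intro string_quiver.intro string_quiver_axioms.intro fin_digraph_axioms)
      (simp_all add: arc_unique_tail arc_unique_head arc_position(3) fst_tail_head)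
qed

section \<open>Torus fixed points\<close>

lemma weight_eq:
  fixes G :: "('v, 'a) coeff_quiver"
  assumes "strings G" "pre_digraph.awalk G s p x" "in_arcs G s = {}"
  shows "weight G t x = fst t (component_of G x) * prod_list (map (\<lambda>f. snd t (fst f)) p)"
  unfolding weight_def
proof (rule the_equality)
  interpret strings G by fact
  fix c assume "\<exists>s p. in_arcs G s = {} \<and> pre_digraph.awalk G s p x \<and>
    c = fst t (component_of G x) * prod_list (map (\<lambda>f. snd t (fst f)) p)"
  then show "c = fst t (component_of G x) * prod_list (map (\<lambda>f. snd t (fst f)) p)"
    using awalk_source_unique[OF assms(2) _ assms(3)] by blast
qed (use assms in blast)

lemma prod_list_map_const:
  fixes c :: complex
  shows "(\<And>f. f \<in> set p \<Longrightarrow> g f = c) \<Longrightarrow> prod_list (map g p) = c ^ length p"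
  by (induction p) auto

lemma torus_separates:
  fixes Q :: "('v, 'a) pre_digraph" and M :: "('v, 'a, 'm) quiver_rep"
  assumes Q: "fin_digraph Q" and M: "is_rep Q M" and b: "is_straightening_basis Q M b"
    and x: "x \<in> verts (coefficient_quiver Q M b)" and y: "y \<in> verts (coefficient_quiver Q M b)"
    and neq: "x \<noteq> y"
  shows "\<exists>t\<in>torus Q M b. weight (coefficient_quiver Q M b) t x \<noteq> weight (coefficient_quiver Q M b) t y"
proof -
  let ?G = "coefficient_quiver Q M b"
  interpret Q: fin_digraph Q by fact
  have str: "strings ?G" by (rule straightening_strings[OF Q b])
  interpret strings ?G by (rule str)
  \<comment> \<open>Torus elements are \<open>undefined\<close> off the support, so the factors
    along a path can be evaluated only once its arrows are known to lie over the support.\<close>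
  have supp: "fst f \<in> support_arrows Q M" if f: "f \<in> arcs ?G" for f
  proof -
    obtain a k l where akl: "f = (a, k, l)" by (cases f)
    with f have a: "a \<in> arcs Q" "k \<in> {1..rep_dim M (tail Q a)}" "l \<in> {1..rep_dim M (head Q a)}"
      and nz: "coord M b (head Q a) (rep_map M a (b (tail Q a) k)) l \<noteq> 0"
      by (simp_all add: arc_coefficient_quiver)
    have ib: "is_indexed_basis Q M b" using b by (simp add: is_straightening_basis_def)
    have "b (tail Q a) k \<in> carrier (rep_space M (tail Q a))"
      using a by (intro dual_basis.b_closed[OF dual_basis_rep_space[OF M ib]]) auto
    moreover have "rep_map M a (b (tail Q a) k) \<noteq> \<zero>\<^bsub>rep_space M (head Q a)\<^esub>"
      using nz dual_basis.\<kappa>_zero[OF dual_basis_rep_space[OF M ib], of "head Q a" l] a by auto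
    ultimately show ?thesis using a akl by (auto simp: support_arrows_def)
  qed
  obtain p where p: "awalk (start x) p x" "length p = string_rank ?G x" "in_arcs ?G (start x) = {}"
    using awalk_start[OF x] .
  obtain q where q: "awalk (start y) q y" "length q = string_rank ?G y" "in_arcs ?G (start y) = {}"
    using awalk_start[OF y] .
  have pq: "set p \<subseteq> arcs ?G" "set q \<subseteq> arcs ?G" using p(1) q(1) by auto
  have prod: "prod_list (map (\<lambda>f. snd t (fst f)) z) = c ^ length z"
    if "\<And>a. a \<in> support_arrows Q M \<Longrightarrow> snd t a = c" "set z \<subseteq> arcs ?G"
    for c and z and t :: "(('v, 'a) coeff_quiver \<Rightarrow> complex) \<times> ('a \<Rightarrow> complex)"
    using that(2) by (intro prod_list_map_const that(1) supp) blast
  have wx: "weight ?G t x = fst t (component_of ?G x) * c ^ length p"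
    and wy: "weight ?G t y = fst t (component_of ?G y) * c ^ length q"
    if "\<And>a. a \<in> support_arrows Q M \<Longrightarrow> snd t a = c" for t c
    using prod[OF that pq(1)] prod[OF that pq(2)]
    by (simp_all add: weight_eq[OF str p(1,3)] weight_eq[OF str q(1,3)])
  show ?thesis
  proof (cases "component_of ?G x = component_of ?G y")
    case True
    \<comment> \<open>On one string the two positions differ. Scaling by 2 along every arrow gives
      the weights 2 to the power of the position, which separate them.\<close>
    let ?t = "(\<lambda>C\<in>component_of ?G ` verts ?G. 1, \<lambda>a\<in>support_arrows Q M. 2)"
    have "length p \<noteq> length q" using vertex_eqI[OF x y True] neq p(2) q(2) by auto
    then have "(2::complex) ^ length p \<noteq> 2 ^ length q"
      by (metis of_nat_eq_iff of_nat_numeral of_nat_power power_inject_exp one_less_numeral_iff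
          semiring_norm(76))
    moreover have "weight ?G ?t x = 2 ^ length p" "weight ?G ?t y = 2 ^ length q"
      using wx[of ?t 2] wy[of ?t 2] x y by simp_all
    moreover have "?t \<in> torus Q M b" by (simp add: torus_def)
    ultimately show ?thesis by metis
  next
    case False
    \<comment> \<open>On different strings it suffices to scale the string of x by 2 and all others
      by 1.\<close>
    let ?t = "(\<lambda>C\<in>component_of ?G ` verts ?G. if C = component_of ?G x then 2 else 1,
      \<lambda>a\<in>support_arrows Q M. 1)"
    have "weight ?G ?t x = 2" "weight ?G ?t y = 1"
      using wx[of ?t 1] wy[of ?t 1] x y False by simp_all
    moreover have "?t \<in> torus Q M b" by (simp add: torus_def)
    moreover have "(2::complex) \<noteq> 1" by simp
    ultimately show ?thesis by metis
  qed
qed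

text \<open>Subtracting a multiple of \<open>x\<close> from its image under a torus element that separates two
  basis vectors in the support of \<open>x\<close> shrinks the support while keeping one of them.\<close>

lemma torus_fixed_point_coordinate:
  fixes Q :: "('v, 'a) pre_digraph" and M :: "('v, 'a, 'm) quiver_rep"
  assumes Q: "fin_digraph Q" and M: "is_rep Q M" and b: "is_straightening_basis Q M b"
    and U: "U \<in> torus_fixed_points Q M b e" and i: "i \<in> verts Q"
    and "x \<in> U i" "k \<in> {1..rep_dim M i}" "coord M b i x k \<noteq> 0"
  shows "b i k \<in> U i"
  using assms(6-8)
proof (induction "card {k \<in> {1..rep_dim M i}. coord M b i x k \<noteq> 0}" arbitrary: x rule: less_induct)
  case less
  let ?G = "coefficient_quiver Q M b" and ?V = "rep_space M i" and ?I = "{1..rep_dim M i}"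
  have ib: "is_indexed_basis Q M b" using b by (simp add: is_straightening_basis_def)
  interpret B: dual_basis ?V ?I "b i" "\<lambda>k x. coord M b i x k"
    by (rule dual_basis_rep_space[OF M ib i])
  have sub: "VectorSpace.subspace complex_field (U i) ?V"
    using U i by (simp add: torus_fixed_points_def quiver_Grassmannian_def is_subrep_def)
  interpret W: LinearCombinations.submodule complex_field "U i" ?V
    using sub by (simp add: VectorSpace.subspace_def)
  have xV: "x \<in> carrier ?V" using W.subset less.prems by blast
  have sm: "c \<odot>\<^bsub>?V\<^esub> z \<in> U i" if "z \<in> U i" for c z
    using that by (intro W.smult_closed) auto
  show ?case
  proof (cases "\<exists>j\<in>?I. j \<noteq> k \<and> coord M b i x j \<noteq> 0")
    case True
    then obtain j where j: "j \<in> ?I" "j \<noteq> k" "coord M b i x j \<noteq> 0" by blast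
    have "(i, k) \<in> verts ?G" "(i, j) \<in> verts ?G" "(i, k) \<noteq> (i, j)" using i j less.prems by auto
    from torus_separates[OF Q M b this] obtain t where t: "t \<in> torus Q M b"
      "weight ?G t (i, k) \<noteq> weight ?G t (i, j)" by blast
    define y where "y = torus_act Q M b t i x \<oplus>\<^bsub>?V\<^esub> (- weight ?G t (i, j)) \<odot>\<^bsub>?V\<^esub> x"
    have act: "torus_act Q M b t i x \<in> U i"
      using U t(1) i less.prems(1) unfolding torus_fixed_points_def by blast
    then have yU: "y \<in> U i" unfolding y_def by (intro W.m_closed sm less.prems)
    have cy: "coord M b i y l = (weight ?G t (i, l) - weight ?G t (i, j)) * coord M b i x l"
      if l: "l \<in> ?I" for l
    proof -
      have "coord M b i (torus_act Q M b t i x) l = weight ?G t (i, l) * coord M b i x l"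
        unfolding torus_act_def using B.\<kappa>_expansion[OF l subset_refl] l by simp
      then show ?thesis
        unfolding y_def using act W.subset xV l
        by (subst B.\<kappa>_add) (auto simp: B.\<kappa>_smult algebra_simps)
    qed
    have "{l \<in> ?I. coord M b i y l \<noteq> 0} \<subset> {l \<in> ?I. coord M b i x l \<noteq> 0}"
    proof
      show "{l \<in> ?I. coord M b i y l \<noteq> 0} \<subseteq> {l \<in> ?I. coord M b i x l \<noteq> 0}" using cy by auto
      show "{l \<in> ?I. coord M b i y l \<noteq> 0} \<noteq> {l \<in> ?I. coord M b i x l \<noteq> 0}"
        using cy[OF j(1)] j by auto
    qed
    then have "card {l \<in> ?I. coord M b i y l \<noteq> 0} < card {l \<in> ?I. coord M b i x l \<noteq> 0}"
      by (intro psubset_card_mono) auto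
    then show ?thesis
      using less.hyps[of y] yU less.prems cy[OF less.prems(2)] t(2) by simp
  next
    case False
    have "(1 / coord M b i x k) \<odot>\<^bsub>?V\<^esub> x = b i k"
    proof (rule B.\<kappa>_inject)
      fix l assume l: "l \<in> ?I"
      show "coord M b i ((1 / coord M b i x k) \<odot>\<^bsub>?V\<^esub> x) l = coord M b i (b i k) l"
        using l less.prems False xV
        by (cases "l = k") (auto simp: B.\<kappa>_smult B.\<kappa>_b simp del: atLeastAtMost_iff)
    qed (use xV less.prems in auto)
    then show ?thesis using sm[OF less.prems(1)] by metis
  qed
qed

section \<open>The tangent space at a fixed point\<close>

locale straight_fixed_point = coordinate_subrep Q M b U +
  S: closed_subquiver "coefficient_quiver Q M b" r "SIGMA i:verts Q. coordinate_subrep.J M b U i"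
  for Q :: "('v, 'a) pre_digraph" and M :: "('v, 'a, 'm) quiver_rep" and b U r +
  fixes e :: "'v \<Rightarrow> int"
  assumes normalized: "is_normalized Q M b"
    and dims: "i \<in> verts Q \<Longrightarrow> int (card (J i)) = e i"
    and no_overlap: "\<not> self_overlap (coefficient_quiver Q M b)
      (coefficient_quiver Q M b \<restriction> (SIGMA i:verts Q. J i))"
begin

abbreviation "G \<equiv> coefficient_quiver Q M b"
abbreviation "X \<equiv> SIGMA i:verts Q. J i"
abbreviation "mutations \<equiv> mutations_from Q G e (G \<restriction> X)"

lemma mem_X: "(i, k) \<in> X \<longleftrightarrow> i \<in> verts Q \<and> k \<in> J i"
  by simp

lemma mem_not_X: "(i, k) \<in> verts G - X \<longleftrightarrow> i \<in> verts Q \<and> k \<in> I i - J i"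
  by auto

text \<open>By normalization every nonzero coefficient is 1, so that commuting with the arrows
  becomes equality of matrix entries, without scalar factors.\<close>

lemma coord_map:
  assumes a: "a \<in> arcs Q" and k: "k \<in> I (tail Q a)" and l: "l \<in> I (head Q a)"
  shows "coord M b (head Q a) (rep_map M a (b (tail Q a) k)) l = (if (a, k, l) \<in> arcs G then 1 else 0)"
proof -
  have h: "head Q a \<in> verts Q" using a by simp
  consider m where "m \<in> I (head Q a)" "rep_map M a (b (tail Q a) k) = b (head Q a) m"
    | "rep_map M a (b (tail Q a) k) = \<zero>\<^bsub>rep_space M (head Q a)\<^esub>"
    using normalized a k unfolding is_normalized_def by blast
  then have "coord M b (head Q a) (rep_map M a (b (tail Q a) k)) l \<in> {0, 1}"
  proof cases
    case 1
    then show ?thesis using dual_basis.\<kappa>_b[OF coordinates[OF h] l 1(1)] by simp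
  next
    case 2
    then show ?thesis using dual_basis.\<kappa>_zero[OF coordinates[OF h] l] by simp
  qed
  then show ?thesis using assms by (auto simp: arc_coefficient_quiver)
qed

lemma arc_J: "(a, k, l) \<in> arcs G \<Longrightarrow> k \<in> J (tail Q a) \<Longrightarrow> l \<in> J (head Q a)"
  using S.X_closed[of "(a, k, l)"] by (auto simp: arc_coefficient_quiver)

lemma arc_ends:
  assumes "(a, k, l) \<in> arcs G"
  shows "a \<in> arcs Q" "k \<in> I (tail Q a)" "l \<in> I (head Q a)"
  using assms by (simp_all add: arc_coefficient_quiver)

lemma arc_head_unique: "(a, k, l) \<in> arcs G \<Longrightarrow> (a, k, m) \<in> arcs G \<longleftrightarrow> m = l"
  using S.out_unique[of "(a, k, l)" "(a, k, m)"] by auto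

lemma arc_tail_unique: "(a, k, l) \<in> arcs G \<Longrightarrow> (a, m, l) \<in> arcs G \<longleftrightarrow> m = k"
  using S.in_unique[of "(a, k, l)" "(a, m, l)"] by auto

lemma finite_I: "finite (I i)" by simp

lemma commutes_at_sums:
  assumes a: "a \<in> arcs Q" and k: "k \<in> J (tail Q a)" and l': "l' \<in> I (head Q a) - J (head Q a)"
  shows "commutes_at \<phi> a k l' \<longleftrightarrow>
    (\<Sum>l\<in>J (head Q a). if (a, k, l) \<in> arcs G then hmat \<phi> (head Q a, l) (head Q a, l') else 0) =
    (\<Sum>l\<in>I (tail Q a) - J (tail Q a).
       if (a, l, l') \<in> arcs G then hmat \<phi> (tail Q a, k) (tail Q a, l) else 0)"
proof -
  have "(\<Sum>l\<in>J (head Q a). coord M b (head Q a) (rep_map M a (b (tail Q a) k)) l *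
        hmat \<phi> (head Q a, l) (head Q a, l')) =
      (\<Sum>l\<in>J (head Q a). if (a, k, l) \<in> arcs G then hmat \<phi> (head Q a, l) (head Q a, l') else 0)"
    using coord_map[OF a, of k] k J_sub by (intro sum.cong refl) (simp add: subset_iff)
  moreover have "(\<Sum>l\<in>I (tail Q a) - J (tail Q a). hmat \<phi> (tail Q a, k) (tail Q a, l) *
        coord M b (head Q a) (rep_map M a (b (tail Q a) l)) l') =
      (\<Sum>l\<in>I (tail Q a) - J (tail Q a).
       if (a, l, l') \<in> arcs G then hmat \<phi> (tail Q a, k) (tail Q a, l) else 0)"
    using coord_map[OF a _, of _ l'] l' by (intro sum.cong refl) simp
  ultimately show ?thesis unfolding commutes_at_def by simp
qed

lemma sum_single:
  fixes F :: "nat \<Rightarrow> complex"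
  assumes "finite A" "l \<in> A" "\<And>m. P m \<longleftrightarrow> m = l"
  shows "(\<Sum>m\<in>A. if P m then F m else 0) = F l"
  using assms by simp

text \<open>At most one arrow over a starts at k, and closedness puts its head into J, so a single
  term survives. In \<open>sum_in\<close> closedness is used backwards: an arrow ending outside J
  starts outside J.\<close>

lemma sum_out:
  assumes "(a, k, l) \<in> arcs G" "k \<in> J (tail Q a)"
  shows "(\<Sum>m\<in>J (head Q a). if (a, k, m) \<in> arcs G then F m else (0::complex)) = F l"
  using arc_J[OF assms] finite_subset[OF J_sub finite_I] arc_head_unique[OF assms(1)]
  by (intro sum_single) auto

lemma sum_in:
  assumes "(a, k, l) \<in> arcs G" "l \<notin> J (head Q a)"
  shows "(\<Sum>m\<in>I (tail Q a) - J (tail Q a). if (a, m, l) \<in> arcs G then F m else (0::complex)) = F k"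
  using arc_J[OF assms(1)] assms(2) arc_ends[OF assms(1)] arc_tail_unique[OF assms(1)]
  by (intro sum_single) auto

text \<open>For given a, k, l' there are four cases, according to whether an arrow over a starts at
  k and whether one ends at l'. If both exist, \<open>commutes_at\<close> is the first clause of
  \<open>hom_matrix\<close>; if only the one ending at l' exists, the second; if only the one
  starting at k exists, the third; otherwise it reads 0 = 0.\<close>

lemma hom_matrix_iff:
  "S.hom_matrix (hmat \<phi>) \<longleftrightarrow> (\<forall>a\<in>arcs Q. \<forall>k\<in>J (tail Q a). \<forall>l\<in>I (head Q a) - J (head Q a).
     commutes_at \<phi> a k l)"
proof
  assume c: "S.hom_matrix (hmat \<phi>)"
  show "\<forall>a\<in>arcs Q. \<forall>k\<in>J (tail Q a). \<forall>l\<in>I (head Q a) - J (head Q a). commutes_at \<phi> a k l"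
  proof (intro ballI)
    fix a k l' assume a: "a \<in> arcs Q" and k: "k \<in> J (tail Q a)"
      and l': "l' \<in> I (head Q a) - J (head Q a)"
    have X1: "(tail Q a, k) \<in> X" unfolding mem_X using a k by simp
    have X2: "(head Q a, l') \<in> verts G - X" unfolding mem_not_X using a l' by simp
    have ln: "l' \<notin> J (head Q a)" using l' by blast
    note sums = commutes_at_sums[OF a k l']
    show "commutes_at \<phi> a k l'"
    proof (cases "\<exists>l. (a, k, l) \<in> arcs G")
      case True
      then obtain l where f: "(a, k, l) \<in> arcs G" by blast
      show ?thesis
      proof (cases "\<exists>m. (a, m, l') \<in> arcs G")
        case True
        then obtain m where g: "(a, m, l') \<in> arcs G" by blast
        show ?thesis
          unfolding sums sum_out[OF f k] sum_in[OF g ln]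
          using S.hom_matrixD(1)[OF c f g] X1 X2 by simp
      next
        case False
        have "hmat \<phi> (head G (a, k, l)) (head Q a, l') = 0"
          by (rule S.hom_matrixD(3)[OF c f X2]) (use X1 False in force)+
        then show ?thesis unfolding sums sum_out[OF f k] using False by simp
      qed
    next
      case no_f: False
      show ?thesis
      proof (cases "\<exists>m. (a, m, l') \<in> arcs G")
        case True
        then obtain m where g: "(a, m, l') \<in> arcs G" by blast
        have "hmat \<phi> (tail Q a, k) (tail G (a, m, l')) = 0"
          by (rule S.hom_matrixD(2)[OF c g X1]) (use X2 no_f in force)+
        then show ?thesis unfolding sums sum_in[OF g ln] using no_f by simp
      next
        case False
        then show ?thesis unfolding sums using no_f by simp
      qed
    qed
  qed
next
  assume c: "\<forall>a\<in>arcs Q. \<forall>k\<in>J (tail Q a). \<forall>l\<in>I (head Q a) - J (head Q a). commutes_at \<phi> a k l"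
  have eq: "(\<Sum>l\<in>J (head Q a). if (a, k, l) \<in> arcs G then hmat \<phi> (head Q a, l) (head Q a, l') else 0) =
    (\<Sum>l\<in>I (tail Q a) - J (tail Q a).
       if (a, l, l') \<in> arcs G then hmat \<phi> (tail Q a, k) (tail Q a, l) else 0)"
    if "a \<in> arcs Q" "k \<in> J (tail Q a)" "l' \<in> I (head Q a) - J (head Q a)" for a k l'
    using c that commutes_at_sums[OF that] by blast
  have ends: "k \<in> J (tail Q a)" if "tail G (a, k, l) \<in> X" for a k l using that by simp
  have ends': "l \<in> I (head Q a) - J (head Q a)" "l \<notin> J (head Q a)"
    if "(a, k, l) \<in> arcs G" "head G (a, k, l) \<notin> X" for a k l
    using that arc_ends[OF that(1)] by auto
  show "S.hom_matrix (hmat \<phi>)"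
    unfolding S.hom_matrix_def
  proof (intro conjI ballI impI)
    fix f g assume f: "f \<in> arcs G" and g: "g \<in> arcs G" and fg: "fst f = fst g"
      and t: "tail G f \<in> X" and h: "head G g \<notin> X"
    obtain a k l where f': "f = (a, k, l)" by (cases f)
    obtain m l' where g': "g = (a, m, l')" using fg f' by (cases g) simp
    note k = ends[OF t[unfolded f']] and l' = ends'[OF g[unfolded g'] h[unfolded g']]
    show "hmat \<phi> (tail G f) (tail G g) = hmat \<phi> (head G f) (head G g)"
      using eq[OF arc_ends(1)[OF f[unfolded f']] k l'(1)]
      unfolding sum_out[OF f[unfolded f'] k] sum_in[OF g[unfolded g'] l'(2)] by (simp add: f' g')
  next
    fix g x assume g: "g \<in> arcs G" and x: "x \<in> X" "fst x = fst (tail G g)" and h: "head G g \<notin> X"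
      and no: "\<forall>f\<in>arcs G. tail G f = x \<longrightarrow> fst f \<noteq> fst g"
    obtain a m l' where g': "g = (a, m, l')" by (cases g)
    obtain k where x': "x = (tail Q a, k)" using x(2) g' by (cases x) simp
    have k: "k \<in> J (tail Q a)" using x x' by simp
    note l' = ends'[OF g[unfolded g'] h[unfolded g']]
    have "(a, k, l) \<notin> arcs G" for l using no x' g' by force
    then show "hmat \<phi> x (tail G g) = 0"
      using eq[OF arc_ends(1)[OF g[unfolded g']] k l'(1)]
      unfolding sum_in[OF g[unfolded g'] l'(2)] by (simp add: x' g')
  next
    fix f y assume f: "f \<in> arcs G" and y: "y \<in> verts G - X" "fst y = fst (head G f)"
      and t: "tail G f \<in> X" and no: "\<forall>g\<in>arcs G. head G g = y \<longrightarrow> fst g \<noteq> fst f"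
    obtain a k l where f': "f = (a, k, l)" by (cases f)
    obtain l' where y': "y = (head Q a, l')" using y(2) f' by (cases y) simp
    note k = ends[OF t[unfolded f']]
    have l': "l' \<in> I (head Q a) - J (head Q a)" using y(1) unfolding y' mem_not_X by blast
    have "(a, m, l') \<notin> arcs G" for m using no y' f' by force
    then show "hmat \<phi> (head G f) y = 0"
      using eq[OF arc_ends(1)[OF f[unfolded f']] k l']
      unfolding sum_out[OF f[unfolded f'] k] by (simp add: y' f')
  qed
qed

text \<open>Needed because the matrix of a mutation morphism is controlled only on pairs in X times
  its complement over one vertex, the only entries that \<open>hom_matrix\<close> reads.\<close>

lemma hom_matrix_cong:
  assumes eq: "\<And>x y. x \<in> X \<Longrightarrow> y \<in> verts G - X \<Longrightarrow> fst x = fst y \<Longrightarrow> c x y = c' x y"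
    and c: "S.hom_matrix c"
  shows "S.hom_matrix c'"
proof -
  have t: "tail G g \<in> verts G - X" "head G g \<in> verts G - X" if "g \<in> arcs G" "head G g \<notin> X" for g
    using that(2) S.X_closed[OF that(1)] S.wellformed[OF that(1)] unfolding Diff_iff by metis+
  show ?thesis
    unfolding S.hom_matrix_def
  proof (intro conjI ballI impI)
    fix f g assume *: "f \<in> arcs G" "g \<in> arcs G" "fst f = fst g" "tail G f \<in> X" "head G g \<notin> X"
    show "c' (tail G f) (tail G g) = c' (head G f) (head G g)"
      using S.hom_matrixD(1)[OF c *]
      unfolding eq[OF *(4) t(1)[OF *(2,5)] S.proj_tail[OF *(1-3)]]
        eq[OF S.X_closed[OF *(1,4)] t(2)[OF *(2,5)] S.proj_head[OF *(1-3)]] .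
  next
    fix g x assume *: "g \<in> arcs G" "x \<in> X" "fst x = fst (tail G g)" "head G g \<notin> X"
      "\<forall>f\<in>arcs G. tail G f = x \<longrightarrow> fst f \<noteq> fst g"
    have "c x (tail G g) = 0" by (rule S.hom_matrixD(2)[OF c *(1-4)]) (use *(5) in blast)
    then show "c' x (tail G g) = 0" unfolding eq[OF *(2) t(1)[OF *(1,4)] *(3)] .
  next
    fix f y assume *: "f \<in> arcs G" "y \<in> verts G - X" "fst y = fst (head G f)" "tail G f \<in> X"
      "\<forall>g\<in>arcs G. head G g = y \<longrightarrow> fst g \<noteq> fst f"
    have "c (head G f) y = 0" by (rule S.hom_matrixD(3)[OF c *(1-4)]) (use *(5) in blast)
    then show "c' (head G f) y = 0" unfolding eq[OF S.X_closed[OF *(1,4)] *(2) *(3)[symmetric]] .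
  qed
qed

lemma S_mem: "G \<restriction> X \<in> succ_closed_subquivers Q G e"
proof -
  have "{k. (i, k) \<in> X} = J i" if "i \<in> verts Q" for i using that by auto
  then show ?thesis
    using S.X_sub S.X_closed dims
    unfolding succ_closed_subquivers_def successor_closed_def by auto
qed

text \<open>That the prescription on basis vectors is a morphism is seen from its matrix: it is the
  indicator of the matched pairs, to which \<open>hom_matrix_matched\<close> and
  \<open>hom_matrix_iff\<close> apply.\<close>

lemma mutation_hom_matrix:
  assumes m: "S.mut_path u p u' p'" and S': "S' = G \<restriction> S.mut_target u p u' p'"
  shows "mutation_hom Q M b U (G \<restriction> X) S' \<in> carrier H"
    and "x \<in> X \<Longrightarrow> y \<in> verts G - X \<Longrightarrow> fst x = fst y \<Longrightarrow>
      hmat (mutation_hom Q M b U (G \<restriction> X) S') x y = (if S.matched u p u' p' x y then 1 else 0)"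
proof -
  let ?h = "mutation_hom Q M b U (G \<restriction> X) S'"
  define L where "L = G \<restriction> set (S.awalk_verts u p)"
  define L' where "L' = G \<restriction> set (S.awalk_verts u' p')"
  define K where "K i = {k. (i, k) \<in> set (S.awalk_verts u p)}" for i
  define w where "w i k = U i +>\<^bsub>rep_space M i\<^esub> b i (snd (corresponding_vertex L L' (i, k)))" for i k
  have dL: "quiver_diff (G \<restriction> X) S' = L" "quiver_diff S' (G \<restriction> X) = L'"
    unfolding S' L_def L'_def quiver_diff_induce S.mut_target_diff[OF m] by simp_all
  have h_eq: "?h = (\<lambda>i\<in>verts Q. \<lambda>x\<in>U i.
      \<Oplus>\<^bsub>rep_space N i\<^esub>k\<in>K i. coord M b i x k \<odot>\<^bsub>rep_space N i\<^esub> w i k)"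
    unfolding mutation_hom_def Let_def dL w_def K_def by (simp add: L_def)
  have K_sub: "K i \<subseteq> J i" for i
    using S.mut_path_verts(1)[OF m] by (auto simp: K_def)
  have corr: "S.matched u p u' p' (i, k) (i, l) \<longleftrightarrow> l = snd (corresponding_vertex L L' (i, k))"
    and corr_mem: "i \<in> verts Q" "snd (corresponding_vertex L L' (i, k)) \<in> I i - J i"
    if k: "k \<in> K i" for i k l
  proof -
    have mm: "S.matched u p u' p' (i, k) y \<longleftrightarrow> y = corresponding_vertex L L' (i, k)" for y
      using S.matched_iff[OF m, of "(i, k)" y] k by (simp add: K_def L_def L'_def)
    then have mc: "S.matched u p u' p' (i, k) (corresponding_vertex L L' (i, k))" by simp
    \<comment> \<open>\<open>mutation_hom\<close> uses only the second component of the
      corresponding vertex and keeps i; this justifies it.\<close>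
    have f: "fst (corresponding_vertex L L' (i, k)) = i" using S.matched_fst[OF m mc] by simp
    show "S.matched u p u' p' (i, k) (i, l) \<longleftrightarrow> l = snd (corresponding_vertex L L' (i, k))"
      using mm f by (metis prod.collapse snd_conv)
    have "corresponding_vertex L L' (i, k) \<in> verts G - X" by (rule S.matched_mem(2)[OF m mc])
    then have "(i, snd (corresponding_vertex L L' (i, k))) \<in> verts G - X" using f by (metis prod.collapse)
    then show "i \<in> verts Q" "snd (corresponding_vertex L L' (i, k)) \<in> I i - J i"
      unfolding mem_not_X by blast+
  qed
  have w_closed: "w i k \<in> carrier (rep_space N i)" if "k \<in> K i" for i k
    using dual_basis.b_closed[OF quotient_dual_basis[OF corr_mem(1)[OF that]] corr_mem(2)[OF that]]
    by (simp add: w_def)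
  have lin: "linear_map complex_field (rep_space (sub_rep M U) i) (rep_space N i) (?h i)"
    if i: "i \<in> verts Q" for i
  proof (rule linear_map_cong)
    show "linear_map complex_field (rep_space (sub_rep M U) i) (rep_space N i)
        (\<lambda>x. \<Oplus>\<^bsub>rep_space N i\<^esub>k\<in>K i. coord M b i x k \<odot>\<^bsub>rep_space N i\<^esub> w i k)"
      using w_closed
      by (intro dual_basis.linear_map_finsum[OF sub_dual_basis[OF i]] N_vs[OF i] K_sub)
    show "?h i x = (\<Oplus>\<^bsub>rep_space N i\<^esub>k\<in>K i. coord M b i x k \<odot>\<^bsub>rep_space N i\<^esub> w i k)"
      if "x \<in> carrier (rep_space (sub_rep M U) i)" for x
      using that i by (simp add: h_eq sub_rep_def)
  qed
  have mat: "hmat ?h (i, k) (i, l) = (if S.matched u p u' p' (i, k) (i, l) then 1 else 0)"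
    if i: "i \<in> verts Q" and k: "k \<in> J i" and l: "l \<in> I i - J i" for i k l
  proof -
    interpret B: dual_basis "rep_space N i" "I i - J i" "\<lambda>k. U i +>\<^bsub>rep_space M i\<^esub> b i k" "qc i"
      by (rule quotient_dual_basis[OF i])
    have bk: "b i k \<in> U i" using k by (simp add: J_def)
    have Kfin: "finite (K i)" using K_sub J_sub finite_I by (meson finite_subset)
    have "hmat ?h (i, k) (i, l) =
        qc i l (\<Oplus>\<^bsub>rep_space N i\<^esub>j\<in>K i. coord M b i (b i k) j \<odot>\<^bsub>rep_space N i\<^esub> w i j)"
      using i bk by (simp add: hmat_def h_eq)
    also have "\<dots> = (\<Sum>j\<in>K i. qc i l (coord M b i (b i k) j \<odot>\<^bsub>rep_space N i\<^esub> w i j))"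
      using w_closed Kfin by (intro B.\<kappa>_finsum[OF l]) auto
    also have "\<dots> = (\<Sum>j\<in>K i. if j = k then (if l = snd (corresponding_vertex L L' (i, j)) then 1 else 0) else 0)"
    proof (intro sum.cong refl)
      fix j assume j: "j \<in> K i"
      have "coord M b i (b i k) j = (if j = k then 1 else 0)"
        using dual_basis.\<kappa>_b[OF coordinates[OF i], of j k] j k K_sub J_sub by blast
      moreover have "qc i l (w i j) = (if l = snd (corresponding_vertex L L' (i, j)) then 1 else 0)"
        unfolding w_def by (rule B.\<kappa>_b[OF l corr_mem(2)[OF j]])
      ultimately show "qc i l (coord M b i (b i k) j \<odot>\<^bsub>rep_space N i\<^esub> w i j) =
          (if j = k then (if l = snd (corresponding_vertex L L' (i, j)) then 1 else 0) else 0)"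
        using B.\<kappa>_smult[OF l w_closed[OF j]] by simp
    qed
    also have "\<dots> = (if k \<in> K i then (if l = snd (corresponding_vertex L L' (i, k)) then 1 else 0) else 0)"
      using Kfin by simp
    also have "\<dots> = (if S.matched u p u' p' (i, k) (i, l) then 1 else 0)"
    proof (cases "k \<in> K i")
      case True
      then show ?thesis using corr[OF True] by simp
    next
      case False
      then have "\<not> S.matched u p u' p' (i, k) (i, l)"
        using S.matched_iff[OF m] by (auto simp: K_def)
      with False show ?thesis by simp
    qed
    finally show ?thesis .
  qed
  have mat': "hmat ?h x y = (if S.matched u p u' p' x y then 1 else 0)"
    if xX: "x \<in> X" and yX: "y \<in> verts G - X" and eq: "fst x = fst y" for x y
  proof -
    obtain i k l where xy: "x = (i, k)" "y = (i, l)" using eq by (metis prod.collapse)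
    show ?thesis using xX yX mat[of i k l] unfolding xy mem_X mem_not_X by blast
  qed
  then show "x \<in> X \<Longrightarrow> y \<in> verts G - X \<Longrightarrow> fst x = fst y \<Longrightarrow>
      hmat ?h x y = (if S.matched u p u' p' x y then 1 else 0)" .
  have "S.hom_matrix (hmat ?h)"
    by (rule hom_matrix_cong[OF _ S.hom_matrix_matched[OF m]]) (rule mat'[symmetric])
  then show "?h \<in> carrier H"
    unfolding hom_matrix_iff
    by (intro hom_if_commutes_at lin) (auto simp: h_eq)
qed

text \<open>The starting vertices of the removed and of the added path, the position of the matrix
  entry that serves as functional dual to the mutation. For a mutation the choice is forced, since
  the two vertex sets determine the paths.\<close>

definition mutation_start :: "('v, 'a) coeff_quiver \<Rightarrow> ('v \<times> nat) \<times> ('v \<times> nat)" where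
  "mutation_start S' = (SOME (u, u'). \<exists>p p'. S.mut_path u p u' p' \<and> S' = G \<restriction> S.mut_target u p u' p')"

lemma mutation_startE:
  assumes "S' \<in> mutations"
  obtains u p u' p' where "mutation_start S' = (u, u')" "S.mut_path u p u' p'"
    "S' = G \<restriction> S.mut_target u p u' p'"
proof -
  obtain u p u' p' where "S.mut_path u p u' p'" "S' = G \<restriction> S.mut_target u p u' p'"
    using S.mutation_mut_path[OF assms] by blast
  then have "case (u, u') of (u, u') \<Rightarrow>
      \<exists>p p'. S.mut_path u p u' p' \<and> S' = G \<restriction> S.mut_target u p u' p'"
    unfolding prod.case by blast
  then have *: "case mutation_start S' of (u, u') \<Rightarrow>
      \<exists>p p'. S.mut_path u p u' p' \<and> S' = G \<restriction> S.mut_target u p u' p'"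
    unfolding mutation_start_def by (rule someI)
  obtain w w' where w: "mutation_start S' = (w, w')" by (rule prod.exhaust)
  show ?thesis using * that[OF w] unfolding w prod.case by blast
qed

lemma start_mem:
  assumes m: "S.mut_path u p u' p'"
  shows "u \<in> X" "u' \<in> verts G - X" "fst u = fst u'" "S.matched u p u' p' u u'"
proof -
  obtain v v' where w: "S.awalk u p v" "S.awalk u' p' v'" using S.mut_path_awalk[OF m] by blast
  show mt: "S.matched u p u' p' u u'"
    unfolding S.matched_def
    using S.awalk_verts_nth_0[OF w(1)] S.awalk_verts_nth_0[OF w(2)] by (intro exI[of _ 0]) simp
  show "u \<in> X" "u' \<in> verts G - X" using S.matched_mem[OF m mt] by blast+
  show "fst u = fst u'" using S.matched_fst[OF m mt] by simp
qed

lemma mutation_hom_closed: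
  assumes "S' \<in> mutations"
  shows "mutation_hom Q M b U (G \<restriction> X) S' \<in> carrier H"
  using assms by (rule mutation_startE) (rule mutation_hom_matrix(1))

text \<open>Biorthogonality rests on \<open>matched_start_unique\<close>. That the functionals
  separate points rests on \<open>hom_matrix_nonzero\<close>, which finds the nonzero entry of a
  nonzero morphism at a starting pair rather than somewhere along a chain.\<close>

lemma dual_basis_mutations:
  "dual_basis H mutations (mutation_hom Q M b U (G \<restriction> X))
     (\<lambda>S' \<phi>. hmat \<phi> (fst (mutation_start S')) (snd (mutation_start S')))"
proof (intro dual_basis.intro dual_basis_axioms.intro)
  show "vectorspace complex_field H" by (rule vectorspace_rep_hom)
  have "mutations \<subseteq> (\<lambda>Y. G \<restriction> Y) ` Pow (verts G)"
    by (auto simp: mutations_from_def succ_closed_subquivers_def)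
  then show "finite mutations" by (rule finite_subset) (simp add: S.finite_verts del: coefficient_quiver_simps)
  show "mutation_hom Q M b U (G \<restriction> X) S' \<in> carrier H" if "S' \<in> mutations" for S'
    by (rule mutation_hom_closed[OF that])
  have *: "\<exists>i k l. mutation_start S' = ((i, k), (i, l)) \<and> i \<in> verts Q \<and> k \<in> J i \<and> l \<in> I i - J i"
    if "S' \<in> mutations" for S'
    using that
  proof (rule mutation_startE)
    fix u p u' p' assume st: "mutation_start S' = (u, u')" and m: "S.mut_path u p u' p'"
    obtain i k l where u: "u = (i, k)" "u' = (i, l)" using start_mem(3)[OF m] by (metis prod.collapse)
    show ?thesis
      using st start_mem(1,2)[OF m] unfolding u mem_X mem_not_X by blast
  qed
  show "hmat (\<phi> \<oplus>\<^bsub>H\<^esub> \<psi>) (fst (mutation_start S')) (snd (mutation_start S')) =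
      hmat \<phi> (fst (mutation_start S')) (snd (mutation_start S')) +
      hmat \<psi> (fst (mutation_start S')) (snd (mutation_start S'))"
    if "S' \<in> mutations" "\<phi> \<in> carrier H" "\<psi> \<in> carrier H" for S' \<phi> \<psi>
    using *[OF that(1)] hmat_add[OF _ _ _ that(2,3)] by fastforce
  show "hmat (c \<odot>\<^bsub>H\<^esub> \<phi>) (fst (mutation_start S')) (snd (mutation_start S')) =
      c * hmat \<phi> (fst (mutation_start S')) (snd (mutation_start S'))"
    if "S' \<in> mutations" "\<phi> \<in> carrier H" for S' \<phi> c
    using *[OF that(1)] hmat_smult[OF _ _ _ that(2)] by fastforce
  show "hmat (mutation_hom Q M b U (G \<restriction> X) S'') (fst (mutation_start S')) (snd (mutation_start S')) =
      (if S' = S'' then 1 else 0)"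
    if S': "S' \<in> mutations" and S'': "S'' \<in> mutations" for S' S''
  proof -
    obtain u p u' p' where st: "mutation_start S' = (u, u')" and m: "S.mut_path u p u' p'"
      and T: "S' = G \<restriction> S.mut_target u p u' p'" using mutation_startE[OF S'] .
    obtain w q w' q' where m2: "S.mut_path w q w' q'" and T2: "S'' = G \<restriction> S.mut_target w q w' q'"
      using mutation_startE[OF S''] .
    have "S.matched w q w' q' u u' \<longleftrightarrow> S' = S''"
    proof
      assume "S.matched w q w' q' u u'"
      from S.matched_start_unique[OF m m2 this] show "S' = S''" using T T2 by simp
    next
      assume eq: "S' = S''"
      have "S.mut_target u p u' p' = S.mut_target w q w' q'"
        using eq unfolding T T2 by (metis induce_subgraph_verts)
      then have "set (S.awalk_verts u p) = set (S.awalk_verts w q)"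
        "set (S.awalk_verts u' p') = set (S.awalk_verts w' q')"
        using S.mut_target_diff[OF m] S.mut_target_diff[OF m2] by simp_all
      then have "u = w" "p = q" "u' = w'" "p' = q'"
        using S.mut_path_awalk[OF m] S.mut_path_awalk[OF m2] S.awalk_verts_set_unique by metis+
      then show "S.matched w q w' q' u u'" using start_mem(4)[OF m] by simp
    qed
    then show ?thesis
      using mutation_hom_matrix(2)[OF m2 T2 start_mem(1-3)[OF m]] st by simp
  qed
  show "\<phi> = \<zero>\<^bsub>H\<^esub>"
    if \<phi>: "\<phi> \<in> carrier H"
      and 0: "\<And>S'. S' \<in> mutations \<Longrightarrow> hmat \<phi> (fst (mutation_start S')) (snd (mutation_start S')) = 0"
    for \<phi>
  proof (rule hom_eq_zeroI[OF \<phi>], rule ccontr)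
    fix i k l assume ikl: "i \<in> verts Q" "k \<in> J i" "l \<in> I i - J i" and nz: "hmat \<phi> (i, k) (i, l) \<noteq> 0"
    have "S.hom_matrix (hmat \<phi>)" unfolding hom_matrix_iff using commutes_at_hom[OF \<phi>] by blast
    moreover have "(i, k) \<in> X" "(i, l) \<in> verts G - X" "fst (i, k) = fst (i, l)" using ikl by auto
    ultimately obtain u p u' p' where m: "S.mut_path u p u' p'" and c: "hmat \<phi> u u' \<noteq> 0"
      using S.hom_matrix_nonzero nz by blast
    define S' where "S' = G \<restriction> S.mut_target u p u' p'"
    \<comment> \<open>The exclusion of overlaps turns the path found for \<phi> into an actual
      mutation, whose functional vanishes on \<phi> by assumption.\<close>
    have S': "S' \<in> mutations"
      unfolding S'_def by (rule S.mut_path_mutation[OF m no_overlap S_mem])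
    obtain w q w' q' where st: "mutation_start S' = (w, w')" and m2: "S.mut_path w q w' q'"
      and T2: "S' = G \<restriction> S.mut_target w q w' q'" using mutation_startE[OF S'] .
    have "S.mut_target u p u' p' = S.mut_target w q w' q'"
      using T2 unfolding S'_def by (metis induce_subgraph_verts)
    then have "set (S.awalk_verts u p) = set (S.awalk_verts w q)"
      "set (S.awalk_verts u' p') = set (S.awalk_verts w' q')"
      using S.mut_target_diff[OF m] S.mut_target_diff[OF m2] by simp_all
    then have "u = w" "u' = w'"
      using S.mut_path_awalk[OF m] S.mut_path_awalk[OF m2] S.awalk_verts_set_unique by metis+
    then show False using 0[OF S'] c st by simp
  qed
qed

end

text \<open>The last assumption does not occur in the informal statement and cannot be dropped, as
  the nilpotent Jordan block of size two with its kernel shows. Quivers without oriented cycles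
  satisfy it by \<open>no_self_overlap_if_acyclic\<close>. Distinctness of the morphisms for
  distinct mutations is part of the claim, expressed by \<open>inj_on\<close>.\<close>

theorem theorem5p8:
  fixes Q :: "('v, 'a) pre_digraph"
    and M :: "('v, 'a, 'm) quiver_rep"
    and b :: "'v \<Rightarrow> nat \<Rightarrow> 'm"
    and e :: "'v \<Rightarrow> int"
    and U :: "'v \<Rightarrow> 'm set"
    and S :: "('v, 'a) coeff_quiver"
  assumes "fin_digraph Q"
    and "is_rep Q M"
    and "is_straightening_basis Q M b"
    and "is_normalized Q M b"
    and "U \<in> torus_fixed_points Q M b e"
    and "S = sub_coefficient_quiver Q M b U"
    and "\<not> self_overlap (coefficient_quiver Q M b) S"
  shows "vectorspace complex_field (tangent_space Q M U) \<and>
    inj_on (mutation_hom Q M b U S) (mutations_from Q (coefficient_quiver Q M b) e S) \<and>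
    vectorspace.basis complex_field (tangent_space Q M U)
      (mutation_hom Q M b U S ` mutations_from Q (coefficient_quiver Q M b) e S)"
proof -
  let ?G = "coefficient_quiver Q M b"
  interpret fin_digraph Q by fact
  have U: "is_subrep Q M U" "\<And>i. i \<in> verts Q \<Longrightarrow> int (rep_dim (sub_rep M U) i) = e i"
    using assms(5) by (auto simp: torus_fixed_points_def quiver_Grassmannian_def)
  interpret C: coordinate_subrep Q M b U
  proof (intro coordinate_subrep.intro coordinate_subrep_axioms.intro)
    show "is_indexed_basis Q M b" using assms(3) by (simp add: is_straightening_basis_def)
    show "b i k \<in> U i"
      if "i \<in> verts Q" "x \<in> U i" "k \<in> {1..rep_dim M i}" "coord M b i x k \<noteq> 0" for i x k
      by (rule torus_fixed_point_coordinate[OF assms(1,2,3,5) that])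
  qed (fact fin_digraph_axioms assms U(1))+
  let ?X = "SIGMA i:verts Q. C.J i"
  have "{(i, k). (i, k) \<in> verts ?G \<and> b i k \<in> U i} = ?X" by (auto simp: C.J_def)
  then have S: "S = ?G \<restriction> ?X" using assms(6) by (simp add: sub_coefficient_quiver_def)
  interpret F: straight_fixed_point Q M b U "string_rank ?G" e
  proof (intro straight_fixed_point.intro straight_fixed_point_axioms.intro
      closed_subquiver.intro closed_subquiver_axioms.intro)
    show "coordinate_subrep Q M b U" by (rule C.coordinate_subrep_axioms)
    show "string_quiver ?G (string_rank ?G)"
      by (intro string_quiver_string_rank straightening_strings assms(1,3))
    show "?X \<subseteq> verts ?G" using C.J_sub by auto
    \<comment> \<open>The image of a basis vector of U lies in U, and U contains all basis vectors
      occurring in it; the arrows of the coefficient quiver point to exactly these.\<close>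
    show "head ?G f \<in> ?X" if f: "f \<in> arcs ?G" "tail ?G f \<in> ?X" for f
    proof -
      obtain a k l where akl: "f = (a, k, l)" by (cases f)
      with f have a: "a \<in> arcs Q" "k \<in> C.J (tail Q a)" "l \<in> C.I (head Q a)"
        and nz: "coord M b (head Q a) (rep_map M a (b (tail Q a) k)) l \<noteq> 0"
        by (simp_all add: arc_coefficient_quiver)
      have "rep_map M a (b (tail Q a) k) \<in> U (head Q a)"
        using a by (intro C.U_map) (auto simp: C.J_def)
      from C.coordinate[OF _ this a(3) nz] show ?thesis using a akl by (simp add: C.J_def)
    qed
    show "int (card (C.J i)) = e i" if "i \<in> verts Q" for i
      using U(2)[OF that] dual_basis.dim_eq[OF C.sub_dual_basis[OF that]] by simp
    show "\<not> self_overlap ?G (?G \<restriction> ?X)" using assms(7) S by simp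
  qed fact
  interpret D: dual_basis C.H F.mutations "mutation_hom Q M b U (?G \<restriction> ?X)"
    "\<lambda>S' \<phi>. C.hmat \<phi> (fst (F.mutation_start S')) (snd (F.mutation_start S'))"
    by (rule F.dual_basis_mutations)
  show ?thesis
    using D.vectorspace_axioms D.inj_b D.basis_b unfolding S C.tangent_space_eq by blast
qed

end
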